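(* Let $\gamma\in(0,1)$, $0<\beta<1$, $\alpha_n=1-\gamma/n^\beta$ and $\sigma_n>0$ for $n\in\mathbb{N}$, and for each $n$ let $(X_{j,n})_{j\ge0}$ be the stationary process satisfying $X_{j,n}=\alpha_nX_{j-1,n}+\sigma_n\varepsilon_j$ for $j\ge1$, where $(\varepsilon_j)$ are i.i.d. $\mathcal{N}(0,1)$ independent of $X_{0,n}\sim\mathcal{N}(0,\delta_n^2)$, $\delta_n^2=\sigma_n^2/(1-\alpha_n^2)$. Let $1\le m\le p$ be integers, let $c_m,\dots,c_p$ be fixed reals with $c_m\ne0$, $c_p\ne0$, and set $$f_n(x)=\sum_{q=m}^pc_q\,\delta_n^q\,H_q(x/\delta_n).$$ Then $$\big(\hat S_{n,t}(f_n)\big)_{t\in[0,1]}\longrightarrow_{\mathcal D}(B(t))_{t\in[0,1]}\quad\text{in }D[0,1]\text{ as }n\to\infty,$$ where $B$ is a standard Brownian motion.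
   Context: For $t\in[0,1]$, $S_{n,t}(g)=\sum_{k=1}^{\lfloor nt\rfloor}g(X_{k,n})$ and $\hat S_{n,t}(g)=\dfrac{S_{n,t}(g)-\mathbb{E}S_{n,t}(g)}{\sqrt{\mathrm{Var}\,S_{n,1}(g)}}$. $H_q$ is the (probabilists') Hermite polynomial of order $q$. $D[0,1]$ is the Skorokhod space with the Skorokhod topology; $\longrightarrow_{\mathcal D}$ is convergence in distribution. *)

theory Defs
  imports "HOL-Probability.Probability"
begin

section \<open>Hermite polynomials\<close>

text \<open>Probabilists' normalisation: monic, orthogonal with respect to the standard normal law.\<close>

fun hermite :: "nat \<Rightarrow> real \<Rightarrow> real" where
  "hermite 0 x = 1"
| "hermite (Suc 0) x = x"
| "hermite (Suc (Suc q)) x = x * hermite (Suc q) x - real (Suc q) * hermite q x"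


section \<open>The Skorokhod space D[0,1]\<close>

text \<open>Elements are \<^const>\<open>extensional\<close>, so that a path is determined by its values on
  \<open>[0,1]\<close>.\<close>

definition skorokhod_space :: "(real \<Rightarrow> real) set" where
  "skorokhod_space =
     {x \<in> extensional {0..1}.
        (\<forall>t\<in>{0..<1}. (x \<longlongrightarrow> x t) (at_right t)) \<and>
        (\<forall>t\<in>{0<..1}. \<exists>l. (x \<longlongrightarrow> l) (at_left t))}"

definition time_changes :: "(real \<Rightarrow> real) set" where
  "time_changes =
     {l. strict_mono_on {0..1} l \<and> continuous_on {0..1} l \<and> l ` {0..1} = {0..1}}"

definition skorokhod_close :: "(real \<Rightarrow> real) \<Rightarrow> (real \<Rightarrow> real) \<Rightarrow> real \<Rightarrow> bool" where
  "skorokhod_close x y e \<longleftrightarrow>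
     e > 0 \<and> (\<exists>l\<in>time_changes. \<forall>t\<in>{0..1}. \<bar>l t - t\<bar> \<le> e \<and> \<bar>x t - y (l t)\<bar> \<le> e)"

text \<open>The value outside \<open>D[0,1]\<close> is irrelevant; it is set to \<open>0\<close> because \<^locale>\<open>Metric_space\<close>
  requires nonnegativity everywhere.\<close>

definition skorokhod_dist :: "(real \<Rightarrow> real) \<Rightarrow> (real \<Rightarrow> real) \<Rightarrow> real" where
  "skorokhod_dist x y =
     (if x \<in> skorokhod_space \<and> y \<in> skorokhod_space
      then Inf {e. skorokhod_close x y e}
      else 0)"

lemma time_changes_mem: "l \<in> time_changes \<Longrightarrow> t \<in> {0..1} \<Longrightarrow> l t \<in> {0..1}"
  unfolding time_changes_def by blast

lemma time_changes_id: "(\<lambda>t. t) \<in> time_changes"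
  by (simp add: time_changes_def strict_mono_on_def)

lemma time_changes_comp:
  assumes "l \<in> time_changes" "k \<in> time_changes"
  shows "(\<lambda>t. k (l t)) \<in> time_changes"
proof -
  have "(\<lambda>t. k (l t)) ` {0..1} = k ` (l ` {0..1})" by auto
  moreover have "continuous_on {0..1} (\<lambda>t. k (l t))"
    by (rule continuous_on_compose2[of "{0..1}" k "{0..1}" l])
      (use assms in \<open>simp_all add: time_changes_def\<close>)
  moreover have "strict_mono_on {0..1} (\<lambda>t. k (l t))"
    using assms time_changes_mem[OF assms(1)] unfolding time_changes_def strict_mono_on_def
    by blast
  ultimately show ?thesis using assms by (simp add: time_changes_def)
qed

lemma time_changes_inv:
  assumes "l \<in> time_changes"
  obtains k where "k \<in> time_changes" "\<And>t. t \<in> {0..1} \<Longrightarrow> l (k t) = t"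
    "\<And>t. t \<in> {0..1} \<Longrightarrow> k (l t) = t"
proof -
  define k where "k = inv_into {0..1::real} l"
  have inj: "inj_on l {0..1}"
    using assms strict_mono_on_imp_inj_on by (auto simp: time_changes_def)
  have im: "l ` {0..1} = {0..1}" and mono: "strict_mono_on {0..1} l"
    and cont: "continuous_on {0..1} l"
    using assms by (auto simp: time_changes_def)
  have lk: "l (k t) = t" if "t \<in> {0..1}" for t
    using that im by (simp add: k_def f_inv_into_f)
  have kl: "k (l t) = t" if "t \<in> {0..1}" for t
    using that inj by (simp add: k_def)
  have km: "k t \<in> {0..1}" if "t \<in> {0..1}" for t
    using that im by (metis inv_into_into k_def)
  have "k ` {0..1} = {0..1}"
    using km kl time_changes_mem[OF assms] by (metis image_eqI image_subsetI subsetI subset_antisym)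
  moreover have "continuous_on (l ` {0..1}) k"
    by (rule continuous_on_inv[OF cont]) (auto simp: kl)
  moreover have "strict_mono_on {0..1} k"
  proof (rule strict_mono_onI)
    fix r s :: real assume *: "r \<in> {0..1}" "s \<in> {0..1}" "r < s"
    show "k r < k s"
    proof (rule ccontr)
      assume "\<not> k r < k s"
      then have "l (k s) \<le> l (k r)"
        using strict_mono_on_leD[OF mono km[OF *(2)] km[OF *(1)]] by simp
      then show False using * lk by simp
    qed
  qed
  ultimately have "k \<in> time_changes" by (simp add: time_changes_def im)
  then show ?thesis using lk kl that by blast
qed

lemma time_changes_endpoints:
  assumes "l \<in> time_changes" shows "l 0 = 0" "l 1 = 1"
proof -
  have mono: "strict_mono_on {0..1} l" using assms by (simp add: time_changes_def)
  obtain k where k: "k \<in> time_changes" "\<And>t. t \<in> {0..1} \<Longrightarrow> l (k t) = t"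
    using time_changes_inv[OF assms] by metis
  have "l 0 \<le> l (k 0)" "l (k 1) \<le> l 1"
    using time_changes_mem[OF k(1), of 0] time_changes_mem[OF k(1), of 1]
    by (auto intro!: strict_mono_on_leD[OF mono])
  then show "l 0 = 0" "l 1 = 1"
    using k(2)[of 0] k(2)[of 1] time_changes_mem[OF assms, of 0] time_changes_mem[OF assms, of 1]
    by auto
qed

lemma skorokhod_close_sym: "skorokhod_close x y e \<Longrightarrow> skorokhod_close y x e"
proof -
  assume "skorokhod_close x y e"
  then obtain l where e: "e > 0" and l: "l \<in> time_changes"
    and b: "\<And>t. t \<in> {0..1} \<Longrightarrow> \<bar>l t - t\<bar> \<le> e \<and> \<bar>x t - y (l t)\<bar> \<le> e"
    by (auto simp: skorokhod_close_def)
  obtain k where k: "k \<in> time_changes" "\<And>t. t \<in> {0..1} \<Longrightarrow> l (k t) = t"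
    using time_changes_inv[OF l] by metis
  have "\<bar>k t - t\<bar> \<le> e \<and> \<bar>y t - x (k t)\<bar> \<le> e" if "t \<in> {0..1}" for t
    using b[OF time_changes_mem[OF k(1) that]] k(2)[OF that] by (simp add: abs_minus_commute)
  then show ?thesis using e k(1) unfolding skorokhod_close_def by blast
qed

lemma skorokhod_close_trans:
  assumes "skorokhod_close x y e" "skorokhod_close y z e'"
  shows "skorokhod_close x z (e + e')"
proof -
  obtain l where e: "e > 0" and l: "l \<in> time_changes"
    and b: "\<And>t. t \<in> {0..1} \<Longrightarrow> \<bar>l t - t\<bar> \<le> e \<and> \<bar>x t - y (l t)\<bar> \<le> e"
    using assms(1) by (auto simp: skorokhod_close_def)
  obtain k where e': "e' > 0" and k: "k \<in> time_changes"
    and b': "\<And>t. t \<in> {0..1} \<Longrightarrow> \<bar>k t - t\<bar> \<le> e' \<and> \<bar>y t - z (k t)\<bar> \<le> e'"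
    using assms(2) by (auto simp: skorokhod_close_def)
  have "\<bar>k (l t) - t\<bar> \<le> e + e' \<and> \<bar>x t - z (k (l t))\<bar> \<le> e + e'" if "t \<in> {0..1}" for t
    using b[OF that] b'[OF time_changes_mem[OF l that]] by linarith
  then show ?thesis
    using e e' unfolding skorokhod_close_def
    by (intro conjI bexI[OF _ time_changes_comp[OF l k]]) auto
qed

lemma skorokhod_space_bounded:
  assumes "x \<in> skorokhod_space"
  obtains K where "\<And>t. t \<in> {0..1} \<Longrightarrow> \<bar>x t\<bar> \<le> K"
proof -
  have loc: "\<exists>U K. open U \<and> t \<in> U \<and> (\<forall>s\<in>U \<inter> {0..1}. \<bar>x s\<bar> \<le> K)" if t: "t \<in> {0..1}" for t
  proof -
    have R: "\<exists>b>t. \<exists>K. \<forall>s. t < s \<and> s < b \<and> s \<le> 1 \<longrightarrow> \<bar>x s\<bar> \<le> K"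
    proof (cases "t < 1")
      case True
      then have "(x \<longlongrightarrow> x t) (at_right t)" using assms t by (auto simp: skorokhod_space_def)
      then have "\<forall>\<^sub>F s in at_right t. dist (x s) (x t) < 1" by (rule tendstoD) simp
      then obtain b where "b > t" "\<forall>s>t. s < b \<longrightarrow> dist (x s) (x t) < 1"
        unfolding eventually_at_right_field by blast
      then show ?thesis
        by (intro exI[of _ b] conjI exI[of _ "\<bar>x t\<bar> + 1"]) (force simp: dist_real_def)+
    next
      case False
      then show ?thesis by (intro exI[of _ "t + 1"]) auto
    qed
    have L: "\<exists>a<t. \<exists>K. \<forall>s. a < s \<and> s < t \<and> 0 \<le> s \<longrightarrow> \<bar>x s\<bar> \<le> K"
    proof (cases "0 < t")
      case True
      then have "t \<in> {0<..1}" using t by simp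
      then obtain l where "(x \<longlongrightarrow> l) (at_left t)"
        using assms unfolding skorokhod_space_def by blast
      then have "\<forall>\<^sub>F s in at_left t. dist (x s) l < 1" by (rule tendstoD) simp
      then obtain a where "a < t" "\<forall>s>a. s < t \<longrightarrow> dist (x s) l < 1"
        unfolding eventually_at_left_field by blast
      then show ?thesis
        by (intro exI[of _ a] conjI exI[of _ "\<bar>l\<bar> + 1"]) (force simp: dist_real_def)+
    next
      case False
      then show ?thesis by (intro exI[of _ "t - 1"]) auto
    qed
    obtain b K where b: "b > t" "\<And>s. t < s \<Longrightarrow> s < b \<Longrightarrow> s \<le> 1 \<Longrightarrow> \<bar>x s\<bar> \<le> K"
      using R by blast
    obtain a K' where a: "a < t" "\<And>s. a < s \<Longrightarrow> s < t \<Longrightarrow> 0 \<le> s \<Longrightarrow> \<bar>x s\<bar> \<le> K'"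
      using L by blast
    have "\<bar>x s\<bar> \<le> max \<bar>x t\<bar> (max K K')" if "s \<in> {a<..<b} \<inter> {0..1}" for s
      using a(2)[of s] b(2)[of s] that by (cases s t rule: linorder_cases) (auto simp: le_max_iff_disj)
    then show ?thesis using a(1) b(1)
      by (intro exI[of _ "{a<..<b}"] exI[of _ "max \<bar>x t\<bar> (max K K')"]) auto
  qed
  define C where "C = {U. open U \<and> (\<exists>K. \<forall>s\<in>U \<inter> {0..1}. \<bar>x s\<bar> \<le> K)}"
  have "{0..1::real} \<subseteq> \<Union> C" using loc unfolding C_def by blast
  moreover have "\<And>U. U \<in> C \<Longrightarrow> open U" by (simp add: C_def)
  ultimately obtain C' where C': "C' \<subseteq> C" "finite C'" "{0..1::real} \<subseteq> \<Union> C'"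
    using compact_Icc[of 0 "1::real"] by (metis compactE)
  have "\<forall>U\<in>C'. \<exists>K. \<forall>s\<in>U \<inter> {0..1}. \<bar>x s\<bar> \<le> K" using C'(1) by (auto simp: C_def)
  then obtain K where K: "\<And>U s. U \<in> C' \<Longrightarrow> s \<in> U \<inter> {0..1} \<Longrightarrow> \<bar>x s\<bar> \<le> K U" by metis
  have "\<bar>x t\<bar> \<le> Max (K ` C')" if t: "t \<in> {0..1}" for t
  proof -
    obtain U where U: "U \<in> C'" "t \<in> U" using C'(3) t by blast
    have "\<bar>x t\<bar> \<le> K U" using K U t by blast
    also have "\<dots> \<le> Max (K ` C')" using C'(2) U by simp
    finally show ?thesis .
  qed
  then show ?thesis using that by blast
qed

lemma skorokhod_close_ex:
  assumes "x \<in> skorokhod_space" "y \<in> skorokhod_space"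
  shows "\<exists>e. skorokhod_close x y e"
proof -
  obtain K where K: "\<And>t. t \<in> {0..1} \<Longrightarrow> \<bar>x t\<bar> \<le> K" using skorokhod_space_bounded assms(1) by blast
  obtain K' where K': "\<And>t. t \<in> {0..1} \<Longrightarrow> \<bar>y t\<bar> \<le> K'" using skorokhod_space_bounded assms(2) by blast
  have "\<bar>x t - y t\<bar> \<le> \<bar>K\<bar> + \<bar>K'\<bar> + 1" if "t \<in> {0..1}" for t
    using K[OF that] K'[OF that] by linarith
  then have "skorokhod_close x y (\<bar>K\<bar> + \<bar>K'\<bar> + 1)"
    unfolding skorokhod_close_def by (intro conjI bexI[OF _ time_changes_id]) auto
  then show ?thesis by blast
qed

lemma skorokhod_dist_eq:
  "x \<in> skorokhod_space \<Longrightarrow> y \<in> skorokhod_space \<Longrightarrow> skorokhod_dist x y = Inf {e. skorokhod_close x y e}"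
  by (simp add: skorokhod_dist_def)

lemma skorokhod_close_bdd_below: "bdd_below {e. skorokhod_close x y e}"
  by (intro bdd_belowI[of _ 0]) (auto simp: skorokhod_close_def)

lemma skorokhod_dist_lessD:
  assumes "x \<in> skorokhod_space" "y \<in> skorokhod_space" "skorokhod_dist x y < e"
  obtains e' where "e' < e" "skorokhod_close x y e'"
  using assms skorokhod_close_ex[OF assms(1,2)] cInf_lessD[of "{e. skorokhod_close x y e}" e]
  by (auto simp: skorokhod_dist_eq)

lemma skorokhod_dist_le:
  assumes "x \<in> skorokhod_space" "y \<in> skorokhod_space" "skorokhod_close x y e"
  shows "skorokhod_dist x y \<le> e"
  using assms by (auto simp: skorokhod_dist_eq intro!: cInf_lower skorokhod_close_bdd_below)

lemma skorokhod_dist_nonneg: "0 \<le> skorokhod_dist x y"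
proof (cases "x \<in> skorokhod_space \<and> y \<in> skorokhod_space")
  case True
  then show ?thesis
    using skorokhod_close_ex[of x y]
    by (auto simp: skorokhod_dist_eq intro!: cInf_greatest) (auto simp: skorokhod_close_def)
qed (auto simp: skorokhod_dist_def)

lemma skorokhod_dist_zeroD:
  assumes x: "x \<in> skorokhod_space" and y: "y \<in> skorokhod_space" and d: "skorokhod_dist x y = 0"
  shows "x = y"
proof (rule extensionalityI[of _ "{0..1}"])
  show "x \<in> extensional {0..1}" "y \<in> extensional {0..1}"
    using x y by (auto simp: skorokhod_space_def)
next
  fix t :: real assume t: "t \<in> {0..1}"
  have close: "\<exists>l\<in>time_changes. \<forall>t\<in>{0..1}. \<bar>l t - t\<bar> < e \<and> \<bar>x t - y (l t)\<bar> < e" if "e > 0" for e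
  proof -
    have "skorokhod_dist x y < e" using d that by simp
    then obtain e' where e': "e' < e" "skorokhod_close x y e'"
      by (rule skorokhod_dist_lessD[OF x y])
    then show ?thesis unfolding skorokhod_close_def by (meson le_less_trans)
  qed
  have "\<bar>x t - y t\<bar> \<le> e" if e: "e > 0" for e
  proof (cases "t = 1")
    case True
    obtain l where l: "l \<in> time_changes" "\<bar>x 1 - y (l 1)\<bar> < e" using close[OF e] by force
    then show ?thesis using True time_changes_endpoints(2)[OF l(1)] by simp
  next
    case False
    then have lims: "(x \<longlongrightarrow> x t) (at_right t)" "(y \<longlongrightarrow> y t) (at_right t)"
      using x y t by (auto simp: skorokhod_space_def)
    have e3: "e / 3 > 0" using e by simp
    obtain b where b: "b > t" "\<And>s. s > t \<Longrightarrow> s < b \<Longrightarrow> \<bar>x s - x t\<bar> < e / 3"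
      using tendstoD[OF lims(1) e3] unfolding eventually_at_right_field dist_real_def by blast
    obtain b' where b': "b' > t" "\<And>s. s > t \<Longrightarrow> s < b' \<Longrightarrow> \<bar>y s - y t\<bar> < e / 3"
      using tendstoD[OF lims(2) e3] unfolding eventually_at_right_field dist_real_def by blast
    define u where "u = min 1 (min b b')"
    define s where "s = (t + u) / 2"
    have u: "t < u" "u \<le> 1" "u \<le> b" "u \<le> b'" using False t b(1) b'(1) by (auto simp: u_def)
    have s: "t < s" "s < u" "s \<in> {0..1}" using u t by (auto simp: s_def field_simps)
    have "min ((u - t) / 2) (e / 3) > 0" using u e by simp
    then obtain l where l: "\<bar>l s - s\<bar> < min ((u - t) / 2) (e / 3)"
        "\<bar>x s - y (l s)\<bar> < min ((u - t) / 2) (e / 3)"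
      using close s(3) by meson
    have "l s > t" "l s < u" using l(1) by (auto simp: s_def field_simps abs_less_iff)
    then have "\<bar>y (l s) - y t\<bar> < e / 3" using b'(2) u by auto
    moreover have "\<bar>x s - x t\<bar> < e / 3" using b(2) s u by auto
    ultimately show ?thesis using l(2) by linarith
  qed
  then have "\<bar>x t - y t\<bar> \<le> 0" by (rule field_le_epsilon) simp
  then show "x t = y t" by simp
qed

interpretation skorokhod: Metric_space skorokhod_space skorokhod_dist
proof
  show "0 \<le> skorokhod_dist x y" for x y by (rule skorokhod_dist_nonneg)
  have "{e. skorokhod_close x y e} = {e. skorokhod_close y x e}" for x y
    using skorokhod_close_sym by blast
  then show "skorokhod_dist x y = skorokhod_dist y x" for x y
    using skorokhod_dist_eq by (metis skorokhod_dist_def)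
  show "skorokhod_dist x y = 0 \<longleftrightarrow> x = y" if "x \<in> skorokhod_space" "y \<in> skorokhod_space" for x y
  proof
    assume "x = y"
    have "skorokhod_close x x e" if "e > 0" for e
      using that time_changes_id by (force simp: skorokhod_close_def)
    then have "skorokhod_dist x x \<le> 0 + e" if "e > 0" for e
      using skorokhod_dist_le[of x x e] \<open>x \<in> skorokhod_space\<close> that by simp
    then have "skorokhod_dist x x \<le> 0" by (rule field_le_epsilon)
    then show "skorokhod_dist x y = 0" using skorokhod_dist_nonneg[of x x] \<open>x = y\<close> by simp
  qed (use that skorokhod_dist_zeroD in blast)
  show "skorokhod_dist x z \<le> skorokhod_dist x y + skorokhod_dist y z"
    if xyz: "x \<in> skorokhod_space" "y \<in> skorokhod_space" "z \<in> skorokhod_space" for x y z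
  proof (rule field_le_epsilon)
    fix e :: real assume e: "e > 0"
    obtain a where a: "a < skorokhod_dist x y + e / 2" "skorokhod_close x y a"
      using skorokhod_dist_lessD[OF xyz(1,2), of "skorokhod_dist x y + e / 2"] e by auto
    obtain b where b: "b < skorokhod_dist y z + e / 2" "skorokhod_close y z b"
      using skorokhod_dist_lessD[OF xyz(2,3), of "skorokhod_dist y z + e / 2"] e by auto
    show "skorokhod_dist x z \<le> skorokhod_dist x y + skorokhod_dist y z + e"
      using skorokhod_dist_le[OF xyz(1,3) skorokhod_close_trans[OF a(2) b(2)]] a(1) b(1) by linarith
  qed
qed

abbreviation skorokhod_topology :: "(real \<Rightarrow> real) topology" where
  "skorokhod_topology \<equiv> skorokhod.mtopology"


section \<open>Convergence in distribution\<close>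

definition borel_of :: "'s topology \<Rightarrow> 's measure" where
  "borel_of T = sigma (topspace T) {U. openin T U}"

text \<open>For random elements of a topological space. The measurability clauses make every integral below
  one of a bounded random variable.\<close>

definition converges_in_distribution ::
  "'s topology \<Rightarrow> 'a measure \<Rightarrow> (nat \<Rightarrow> 'a \<Rightarrow> 's) \<Rightarrow> 'b measure \<Rightarrow> ('b \<Rightarrow> 's) \<Rightarrow> bool" where
  "converges_in_distribution T M Y N Z \<longleftrightarrow>
     (\<forall>n. Y n \<in> M \<rightarrow>\<^sub>M borel_of T) \<and> Z \<in> N \<rightarrow>\<^sub>M borel_of T \<and>
     (\<forall>F. continuous_map T euclideanreal F \<and> (\<exists>C. \<forall>x\<in>topspace T. \<bar>F x\<bar> \<le> C) \<longrightarrow>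
        (\<lambda>n. \<integral>\<omega>. F (Y n \<omega>) \<partial>M) \<longlonglongrightarrow> (\<integral>\<omega>. F (Z \<omega>) \<partial>N))"

definition sample_path :: "(real \<Rightarrow> 'a \<Rightarrow> real) \<Rightarrow> 'a \<Rightarrow> real \<Rightarrow> real" where
  "sample_path Y \<omega> = (\<lambda>t\<in>{0..1}. Y t \<omega>)"


section \<open>Processes\<close>

definition standard_brownian_motion :: "'b measure \<Rightarrow> (real \<Rightarrow> 'b \<Rightarrow> real) \<Rightarrow> bool" where
  "standard_brownian_motion N B \<longleftrightarrow>
     prob_space N \<and>
     (\<forall>t\<in>{0..1}. B t \<in> borel_measurable N) \<and>
     (AE \<omega> in N. B 0 \<omega> = 0) \<and>
     (\<forall>s t. 0 \<le> s \<and> s < t \<and> t \<le> 1 \<longrightarrow>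
        distributed N lborel (\<lambda>\<omega>. B t \<omega> - B s \<omega>) (normal_density 0 (sqrt (t - s)))) \<and>
     (\<forall>k (\<tau> :: nat \<Rightarrow> real). 0 \<le> \<tau> 0 \<and> (\<forall>i<k. \<tau> i < \<tau> (Suc i)) \<and> \<tau> k \<le> 1 \<longrightarrow>
        prob_space.indep_vars N (\<lambda>_. borel) (\<lambda>i \<omega>. B (\<tau> (Suc i)) \<omega> - B (\<tau> i) \<omega>) {..<k}) \<and>
     (\<forall>\<omega>\<in>space N. continuous_on {0..1} (\<lambda>t. B t \<omega>))"

definition stationary_process :: "'a measure \<Rightarrow> (nat \<Rightarrow> 'a \<Rightarrow> real) \<Rightarrow> bool" where
  "stationary_process M Y \<longleftrightarrow>
     (\<forall>j. Y j \<in> borel_measurable M) \<and>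
     (\<forall>h. distr M (\<Pi>\<^sub>M j\<in>UNIV. borel) (\<lambda>\<omega> j. Y (j + h) \<omega>) =
          distr M (\<Pi>\<^sub>M j\<in>UNIV. borel) (\<lambda>\<omega> j. Y j \<omega>))"

text \<open>A triangular array is written \<open>X j n\<close>, with \<open>j\<close> the time and \<open>n\<close> the row.\<close>

definition partial_sum ::
  "(nat \<Rightarrow> nat \<Rightarrow> 'a \<Rightarrow> real) \<Rightarrow> (real \<Rightarrow> real) \<Rightarrow> nat \<Rightarrow> real \<Rightarrow> 'a \<Rightarrow> real" where
  "partial_sum X g n t \<omega> = (\<Sum>k = 1..nat \<lfloor>real n * t\<rfloor>. g (X k n \<omega>))"

definition normalized_sum ::
  "'a measure \<Rightarrow> (nat \<Rightarrow> nat \<Rightarrow> 'a \<Rightarrow> real) \<Rightarrow> (real \<Rightarrow> real) \<Rightarrow> nat \<Rightarrow> real \<Rightarrow> 'a \<Rightarrow> real" where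
  "normalized_sum M X g n t \<omega> =
     (partial_sum X g n t \<omega> - prob_space.expectation M (partial_sum X g n t)) /
     sqrt (prob_space.variance M (partial_sum X g n 1))"

end

(*  Each hermite q (X / \<delta>) is an eigenfunction of the AR(1) transition operator with eigenvalue \<alpha> ^ q.
    Hence the partial sums of f are, up to the boundary terms \<Sum>q. \<alpha> ^ q * w q * hermite q (X / \<delta>) with
    w q = c q * \<delta> ^ q / (1 - \<alpha> ^ q), a martingale with explicit increments. The boundary terms are negligible
    uniformly in time, because the mixing time n powr \<beta> / \<gamma> is small against n and all moments are finite.

    The characteristic functions of the martingale increments are compared with the Gaussian ones by a
    telescoping sum; the conditional variances, again polynomials of the chain, are averaged out by solving
    a Poisson equation in the Hermite basis. The estimate holds in the presence of a bounded weight that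
    depends on the past only, which gives the joint law of increments over consecutive blocks.

    No tightness theory is needed: test functions on D[0,1] may be taken Lipschitz (infimal convolution),
    paths are then replaced by their values on a finite grid, and the oscillation between grid points is
    controlled by Doob's inequality and the limit law of a single block. *)

theory Submission
  imports Defs
begin

section \<open>Hermite polynomials under the Gaussian law\<close>

text \<open>The obstacle is that \<open>\<alpha> n\<close> tends to 1 while
  \<open>\<sigma> n\<close>, and with it \<open>\<delta> n\<close>, is arbitrary: the Hermite order
  that dominates the variance may change with \<open>n\<close>, and ratios of coefficients need not
  converge. So no limiting variance is identified. Each row is measured by its own scale \<kappa>,
  the standard deviation of one martingale increment, which controls all orders at once: order q >=
  1 contributes (w q)^2 q! (1 - a^(2q)) >= (b w q)^2 to the variance, because 1 - a^(2q) >= 1 - a^2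
  = b^2. Hence b |w q| <= \<kappa>, and an increment is \<kappa> times a variable whose moments are
  bounded uniformly in the row. The martingale part then uses two facts about the array: n
  \<kappa>^2 tends to 1 and \<kappa>^2 / (1 - a) tends to 0. The second is where \<beta> < 1 is
  spent, as 1 - a is the spectral gap and n (1 - a) = \<gamma> n^(1 - \<beta>). The boundary terms
  use the polynomial rate n^(\<beta> - 1) itself: a union bound over the times is paid for by high
  moments.\<close>

lemma hermite_mult_X: "x * hermite q x = hermite (Suc q) x + real q * hermite (q - 1) x"
  by (cases q) simp_all

text \<open>Both sides satisfy the same three-term recurrence in \<open>q\<close>. On the right,
  multiplying by \<open>a * x + b * y\<close> raises or lowers one of the two indices. The raising
  terms form the sum for \<open>Suc q\<close>, the lowering terms give
  \<open>q * (a\<^sup>2 + b\<^sup>2)\<close> times the sum for \<open>q - 1\<close>, and the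
  condition on \<open>a\<close> and \<open>b\<close> makes that factor exactly
  \<open>q\<close>.\<close>

lemma hermite_add:
  assumes ab: "a\<^sup>2 + b\<^sup>2 = (1::real)"
  shows "hermite q (a * x + b * y) =
    (\<Sum>j\<le>q. real (q choose j) * a ^ (q - j) * b ^ j * hermite (q - j) x * hermite j y)"
proof -
  define A where "A q = (\<Sum>j\<le>q. real (q choose j) * a ^ (q - j) * b ^ j * hermite (q - j) x * hermite j y)"
      for q
  have rec: "A (Suc q) = (a * x + b * y) * A q - real q * A (q - 1)" for q
  proof -
    \<comment> \<open>Pascal's rule splits each coefficient; the two parts are the terms in which
      the index at \<open>x\<close>, respectively at \<open>y\<close>, has been raised.\<close>
    have s1: "A (Suc q) = (\<Sum>j\<le>q. real (q choose j) * a ^ (Suc q - j) * b ^ j * hermite (Suc q - j) x *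
        hermite j y)
       + (\<Sum>j\<le>q. real (q choose j) * a ^ (q - j) * b ^ Suc j * hermite (q - j) x * hermite (Suc j) y)"
    proof -
      define T where "T c j = c * a ^ (Suc q - j) * b ^ j * hermite (Suc q - j) x * hermite j y"
          for c :: real and j
      have "A (Suc q) = T 1 0 + (\<Sum>j\<le>q. T (real (Suc q choose Suc j)) (Suc j))"
        unfolding A_def T_def by (subst sum.atMost_Suc_shift) simp
      also have "(\<Sum>j\<le>q. T (real (Suc q choose Suc j)) (Suc j)) =
          (\<Sum>j\<le>q. T (real (q choose Suc j)) (Suc j)) + (\<Sum>j\<le>q. T (real (q choose j)) (Suc j))"
        by (simp add: T_def sum.distrib[symmetric] algebra_simps)
      also have "T 1 0 + ((\<Sum>j\<le>q. T (real (q choose Suc j)) (Suc j)) + (\<Sum>j\<le>q. T (real (q choose j)) (Suc j)))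
        = (\<Sum>j\<le>Suc q. T (real (q choose j)) j) + (\<Sum>j\<le>q. T (real (q choose j)) (Suc j))"
        by (subst sum.atMost_Suc_shift) simp
      also have "(\<Sum>j\<le>Suc q. T (real (q choose j)) j) = (\<Sum>j\<le>q. T (real (q choose j)) j)"
        by (simp add: T_def)
      finally show ?thesis by (simp add: T_def)
    qed
    \<comment> \<open>The lowering terms in \<open>x\<close>. The absorption identity
      \<open>(q choose j) * (q - j) = q * (q - 1 choose j)\<close> moves the factor \<open>q\<close>
      out; \<open>q = 0\<close> is separate because of the truncated \<open>q - 1\<close>.\<close>
    have s2: "(\<Sum>j\<le>q. real (q choose j) * real (q - j) * a ^ (Suc q - j) * b ^ j * hermite (q - j - 1) x *
        hermite j y)
        = real q * a\<^sup>2 * A (q - 1)"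
    proof (cases q)
      case (Suc r)
      have "(\<Sum>j\<le>q. real (q choose j) * real (q - j) * a ^ (Suc q - j) * b ^ j * hermite (q - j - 1) x *
          hermite j y)
        = (\<Sum>j\<le>r. real (q choose j) * real (q - j) * a ^ (Suc q - j) * b ^ j * hermite (q - j - 1) x *
            hermite j y)"
        by (simp add: Suc)
      also have "\<dots> = (\<Sum>j\<le>r. real q * a\<^sup>2 * (real (r choose j) * a ^ (r - j) * b ^ j * hermite (r - j) x *
          hermite j y))"
      proof (rule sum.cong[OF refl])
        fix j assume j: "j \<in> {..r}"
        have c: "real (q choose j) * real (q - j) = real q * real (r choose j)"
        proof -
          have "(q choose j) * (q - j) = q * (r choose j)"
            using j Suc binomial_absorb_comp[of q j] by (simp add: mult.commute)
          then show ?thesis by (metis of_nat_mult)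
        qed
        have e: "Suc q - j = 2 + (r - j)" "q - j - 1 = r - j" using j Suc by auto
        show "real (q choose j) * real (q - j) * a ^ (Suc q - j) * b ^ j * hermite (q - j - 1) x * hermite
            j y =
          real q * a\<^sup>2 * (real (r choose j) * a ^ (r - j) * b ^ j * hermite (r - j) x * hermite j y)"
          unfolding c e power_add by (simp add: algebra_simps)
      qed
      finally show ?thesis by (simp add: A_def Suc sum_distrib_left)
    qed simp
    have s3: "(\<Sum>j\<le>q. real (q choose j) * real j * a ^ (q - j) * b ^ Suc j * hermite (q - j) x * hermite (j
        - 1) y)
        = real q * b\<^sup>2 * A (q - 1)"
    proof (cases q)
      case (Suc r)
      have "(\<Sum>j\<le>q. real (q choose j) * real j * a ^ (q - j) * b ^ Suc j * hermite (q - j) x * hermite (j -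
          1) y)
        = (\<Sum>j\<le>r. real (q choose Suc j) * real (Suc j) * a ^ (q - Suc j) * b ^ Suc (Suc j) * hermite (q -
            Suc j) x * hermite j y)"
        unfolding Suc by (subst sum.atMost_Suc_shift) simp
      also have "\<dots> = (\<Sum>j\<le>r. real q * b\<^sup>2 * (real (r choose j) * a ^ (r - j) * b ^ j * hermite (r - j) x *
          hermite j y))"
      proof (rule sum.cong[OF refl])
        fix j assume j: "j \<in> {..r}"
        have c: "real (q choose Suc j) * real (Suc j) = real q * real (r choose j)"
        proof -
          have "(q choose Suc j) * Suc j = q * (r choose j)"
            using Suc Suc_times_binomial[of j r] by (simp only: mult.commute)
          then show ?thesis by (metis of_nat_mult)
        qed
        show "real (q choose Suc j) * real (Suc j) * a ^ (q - Suc j) * b ^ Suc (Suc j) * hermite (q - Suc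
            j) x * hermite j y =
          real q * b\<^sup>2 * (real (r choose j) * a ^ (r - j) * b ^ j * hermite (r - j) x * hermite j y)"
          unfolding c by (simp add: Suc power2_eq_square algebra_simps)
      qed
      finally show ?thesis by (simp add: A_def Suc sum_distrib_left)
    qed simp
    have "(a * x + b * y) * A q = (\<Sum>j\<le>q. real (q choose j) * a ^ (q - j) * b ^ j *
        (a * (x * hermite (q - j) x) * hermite j y + b * hermite (q - j) x * (y * hermite j y)))"
      unfolding A_def sum_distrib_left by (rule sum.cong[OF refl]) (simp add: algebra_simps)
    also have "\<dots> = (\<Sum>j\<le>q. real (q choose j) * a ^ (Suc q - j) * b ^ j * hermite (Suc q - j) x * hermite j y)
       + (\<Sum>j\<le>q. real (q choose j) * a ^ (q - j) * b ^ Suc j * hermite (q - j) x * hermite (Suc j) y)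
       + (\<Sum>j\<le>q. real (q choose j) * real (q - j) * a ^ (Suc q - j) * b ^ j * hermite (q - j - 1) x *
           hermite j y)
       + (\<Sum>j\<le>q. real (q choose j) * real j * a ^ (q - j) * b ^ Suc j * hermite (q - j) x * hermite (j - 1)
           y)"
      unfolding sum.distrib[symmetric] hermite_mult_X
      by (rule sum.cong[OF refl]) (simp add: algebra_simps Suc_diff_le)
    also have "\<dots> = A (Suc q) + real q * (a\<^sup>2 + b\<^sup>2) * A (q - 1)"
      unfolding s1 s2 s3 by (simp add: algebra_simps)
    finally show ?thesis by (simp add: ab)
  qed
  have "hermite q (a * x + b * y) = A q" for q
  proof (induction q rule: less_induct)
    case (less q)
    show ?case
    proof (cases q)
      case (Suc r)
      have "hermite (Suc r) (a * x + b * y) = (a * x + b * y) * hermite r (a * x +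
          b * y) - real r * hermite (r - 1) (a * x + b * y)"
        using hermite_mult_X[of "a * x + b * y" r] by simp
      then show ?thesis using less[of r] less[of "r - 1"] rec[of r] Suc by (cases r) simp_all
    qed (simp add: A_def)
  qed
  then show ?thesis by (simp add: A_def)
qed

lemma hermite_bound: "\<exists>C\<ge>0. \<forall>x. \<bar>hermite q x\<bar> \<le> C * (1 + \<bar>x\<bar>) ^ q"
proof (induction q rule: less_induct)
  case (less q)
  show ?case
  proof (cases "q = 0 \<or> q = 1")
    case True
    then show ?thesis by (intro exI[of _ 1]) auto
  next
    case False
    then obtain r where r: "q = Suc (Suc r)" by (metis One_nat_def not0_implies_Suc)
    obtain C where C: "C \<ge> 0" "\<And>x. \<bar>hermite (Suc r) x\<bar> \<le> C * (1 + \<bar>x\<bar>) ^ Suc r" using less[of "Suc r"] r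
        by auto
    obtain D where D: "D \<ge> 0" "\<And>x. \<bar>hermite r x\<bar> \<le> D * (1 + \<bar>x\<bar>) ^ r" using less[of r] r by auto
    have "\<bar>hermite q x\<bar> \<le> (C + real (Suc r) * D) * (1 + \<bar>x\<bar>) ^ q" for x
    proof -
      have "\<bar>hermite q x\<bar> \<le> \<bar>x\<bar> * \<bar>hermite (Suc r) x\<bar> + real (Suc r) * \<bar>hermite r x\<bar>"
        unfolding r hermite.simps by (rule order_trans[OF abs_triangle_ineq4]) (simp add: abs_mult)
      also have "\<dots> \<le> (1 + \<bar>x\<bar>) * (C * (1 + \<bar>x\<bar>) ^ Suc r) + real (Suc r) * (D * (1 + \<bar>x\<bar>) ^ r)"
        by (intro add_mono mult_mono C D) (use C in auto)
      also have "\<dots> \<le> C * (1 + \<bar>x\<bar>) ^ q + real (Suc r) * (D * (1 + \<bar>x\<bar>) ^ q)"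
        by (intro add_mono mult_left_mono power_increasing) (use C(1) D(1) in \<open>auto simp: r\<close>)
      finally show ?thesis by (simp only: algebra_simps)
    qed
    then show ?thesis using C D by (intro exI[of _ "C + real (Suc r) * D"]) auto
  qed
qed

lemma hermite_measurable [measurable]: "hermite q \<in> borel_measurable borel"
proof (induction q rule: less_induct)
  case (less q)
  show ?case
  proof (cases "q = 0 \<or> q = 1")
    case True
    then show ?thesis by (auto simp: fun_eq_iff[symmetric] cong: measurable_cong)
  next
    case False
    then obtain r where r: "q = Suc (Suc r)" by (metis One_nat_def not0_implies_Suc)
    note [measurable] = less[of r, unfolded r, simplified] less[of "Suc r", unfolded r, simplified]
    show ?thesis unfolding r by simp
  qed
qed

text \<open>The same polynomials as formal ones, so that differentiation is algebraic and Stein's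
  identity applies to products of Hermite polynomials and their derivatives.\<close>

fun hermite_poly :: "nat \<Rightarrow> real poly" where
  "hermite_poly 0 = 1"
| "hermite_poly (Suc 0) = [:0, 1:]"
| "hermite_poly (Suc (Suc q)) = [:0, 1:] * hermite_poly (Suc q) - smult (real (Suc q)) (hermite_poly q)"

lemma poly_hermite_poly [simp]: "poly (hermite_poly q) x = hermite q x"
  by (induction q x rule: hermite.induct) (simp_all add: algebra_simps)

text \<open>Differentiating the recurrence leaves a multiple of the recurrence one order lower,
  which is \<open>*\<close>. The factor \<open>q\<close> makes the truncated \<open>q - 1\<close>
  harmless at order 0.\<close>

lemma pderiv_hermite_poly: "pderiv (hermite_poly q) = smult (real q) (hermite_poly (q - 1))"
proof (induction q rule: hermite_poly.induct)
  case (3 q)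
  have *: "smult (real (Suc q)) (hermite_poly (Suc q)) =
      [:0, 1:] * smult (real (Suc q)) (hermite_poly q) - smult (real (Suc q)) (smult (real q)
          (hermite_poly (q - 1)))"
    by (cases q) (simp_all add: algebra_simps smult_diff_right)
  have "pderiv (hermite_poly (Suc (Suc q))) =
      hermite_poly (Suc q) + smult (real (Suc q)) (hermite_poly (Suc q))"
    unfolding hermite_poly.simps(3) pderiv_diff pderiv_mult pderiv_smult 3 *
    by (simp add: pderiv_pCons algebra_simps)
  also have "\<dots> = smult (real (Suc (Suc q))) (hermite_poly (Suc q))"
    by (metis (no_types) of_nat_Suc smult_1_left smult_add_left)
  finally show ?case by simp
qed (simp_all add: pderiv_pCons)

section \<open>Gaussian integration by parts and orthogonality\<close>

abbreviation gaussian :: "real measure" where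
  "gaussian \<equiv> std_normal_distribution"

interpretation gaussian: prob_space gaussian
  using real_dist_normal_dist by (simp add: real_distribution_def)

lemma integrable_poly_gaussian: "integrable gaussian (\<lambda>x. poly p x)"
  unfolding poly_altdef by (intro Bochner_Integration.integrable_sum integrable_mult_right
      integrable_std_normal_distribution_moment)

text \<open>Stein's identity for a monomial. For even \<open>i\<close> both sides vanish by
  symmetry; for odd \<open>i\<close> it is the ratio of two consecutive even moments
  \<open>(2k)! / (2^k k!)\<close>.\<close>

lemma integral_gaussian_power: "(\<integral>x. x * x ^ i \<partial>gaussian) = real i * (\<integral>x. x ^ (i - 1) \<partial>gaussian)"
proof (cases "even i")
  case True
  then obtain k where k: "i = 2 * k" by (elim evenE)
  have "(\<integral>x. x ^ (i - 1) \<partial>gaussian) = 0" if "i > 0"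
    by (rule integral_std_normal_distribution_moment_odd) (use True that in simp)
  moreover have "(\<integral>x. x ^ Suc i \<partial>gaussian) = 0"
    by (rule integral_std_normal_distribution_moment_odd) (use True in simp)
  ultimately show ?thesis by (cases "i = 0") auto
next
  case False
  then obtain k where k: "i = 2 * k + 1" by (elim oddE)
  have e: "(\<integral>x. x ^ (2 * k) \<partial>gaussian) = fact (2 * k) / (2 ^ k * fact k)" for k
    using std_normal_distribution_even_moments[of k] by simp
  have "(\<integral>x. x ^ (2 * Suc k) \<partial>gaussian) = real i * (\<integral>x. x ^ (i - 1) \<partial>gaussian)"
  proof -
    have "(fact (2 * Suc k) :: real) / (2 ^ Suc k * fact (Suc k)) =
        (2 * real (Suc k) * (real (2 * k + 1) * fact (2 * k))) / (2 * real (Suc k) * (2 ^ k * fact k))"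
      by (simp add: algebra_simps)
    also have "\<dots> = real (2 * k + 1) * fact (2 * k) / (2 ^ k * fact k)"
      by (rule mult_divide_mult_cancel_left) simp
    finally show ?thesis unfolding e k add_diff_cancel_right' by simp
  qed
  then show ?thesis using k by simp
qed

text \<open>Gaussian integration by parts, extended by linearity from monomials to
  polynomials.\<close>

lemma gaussian_Stein:
  "(\<integral>x. x * poly p x \<partial>gaussian) = (\<integral>x. poly (pderiv p) x \<partial>gaussian)"
proof -
  have int: "integrable gaussian (\<lambda>x. x * poly p x)" for p :: "real poly"
    using integrable_poly_gaussian[of "[:0, 1:] * p"] by simp
  have "(\<integral>x. x * poly (\<Sum>i\<le>d. monom (a i) i) x \<partial>gaussian) =
      (\<integral>x. poly (pderiv (\<Sum>i\<le>d. monom (a i) i)) x \<partial>gaussian)" for d and a :: "nat \<Rightarrow> real"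
  proof (induction d)
    case (Suc d)
    have m: "(\<integral>x. x * poly (monom (a i) i) x \<partial>gaussian) = (\<integral>x. poly (pderiv (monom (a i) i)) x \<partial>gaussian)"
        for i
      using integral_gaussian_power[of i]
      by (simp add: poly_monom pderiv_monom mult.left_commute[of _ "a i"])
    show ?case
      using Suc.IH m[of "Suc d"] int integrable_poly_gaussian
      by (simp add: pderiv_add distrib_left)
  qed (simp add: pderiv_monom poly_monom pderiv_pCons integral_gaussian_power[of 0, simplified] monom_0)
  from this[of "coeff p" "degree p"] show ?thesis by (simp add: poly_as_sum_of_monoms)
qed

lemma integrable_hermite_mult: "integrable gaussian (\<lambda>x. hermite q x * hermite r x)"
  using integrable_poly_gaussian[of "hermite_poly q * hermite_poly r"] by simp

lemma integrable_hermite: "integrable gaussian (hermite q)"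
  using integrable_hermite_mult[of q 0] by simp

text \<open>As the polynomial of order \<open>q + 1\<close> is \<open>x\<close> times that of order
  \<open>q\<close> minus its derivative, integration by parts moves the derivative to the second
  factor: the pair \<open>(q + 1, r)\<close> becomes \<open>r\<close> times the pair
  \<open>(q, r - 1)\<close>. Iteration gives the factorial on the diagonal and 0 off it.\<close>

lemma hermite_orthogonal:
  "(\<integral>x. hermite q x * hermite r x \<partial>gaussian) = (if q = r then fact q else 0)"
proof (induction q arbitrary: r)
  case (Suc q)
  have rec: "(\<integral>x. hermite (Suc q) x * hermite r x \<partial>gaussian) =
      real r * (\<integral>x. hermite q x * hermite (r - 1) x \<partial>gaussian)" for q r
  proof -
    have "hermite (Suc q) x * hermite r x =
        x * poly (hermite_poly q * hermite_poly r) x - poly (pderiv (hermite_poly q) * hermite_poly r) x"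
            for x
    proof -
      have "hermite (Suc q) x = x * hermite q x - real q * hermite (q - 1) x"
        using hermite_mult_X[of x q] by simp
      then have "hermite (Suc q) x * hermite r x = (x * hermite q x - real q * hermite (q - 1) x) *
          hermite r x"
        by (rule arg_cong)
      then show ?thesis by (simp add: pderiv_hermite_poly algebra_simps)
    qed
    moreover have "integrable gaussian (\<lambda>x. x * poly p x)" for p :: "real poly"
      using integrable_poly_gaussian[of "[:0, 1:] * p"] by simp
    ultimately have "(\<integral>x. hermite (Suc q) x * hermite r x \<partial>gaussian) =
       (\<integral>x. poly (pderiv (hermite_poly q * hermite_poly r)) x \<partial>gaussian) -
       (\<integral>x. poly (pderiv (hermite_poly q) * hermite_poly r) x \<partial>gaussian)"
      using integrable_poly_gaussian by (simp only: gaussian_Stein[symmetric]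
          Bochner_Integration.integral_diff)
    also have "\<dots> = (\<integral>x. poly (hermite_poly q * pderiv (hermite_poly r)) x \<partial>gaussian)"
      using integrable_poly_gaussian
      by (subst Bochner_Integration.integral_diff[symmetric])
        (auto simp del: poly_hermite_poly simp: pderiv_mult algebra_simps intro!:
            Bochner_Integration.integral_cong)
    finally show ?thesis by (simp add: pderiv_hermite_poly mult.left_commute)
  qed
  show ?case unfolding rec Suc by (cases r) auto
next
  case 0
  have "(\<integral>x. hermite r x \<partial>gaussian) = 0" if "r > 0"
  proof -
    have "(\<integral>x. x * poly (hermite_poly (r - 1)) x \<partial>gaussian) =
        (\<integral>x. poly (pderiv (hermite_poly (r - 1))) x \<partial>gaussian)"
      by (rule gaussian_Stein)
    moreover have "hermite r x = x * poly (hermite_poly (r - 1)) x - poly (pderiv (hermite_poly (r - 1)))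
        x" for x
      using hermite_mult_X[of x "r - 1"] that by (simp add: pderiv_hermite_poly)
    moreover have "integrable gaussian (\<lambda>x. x * poly p x)" for p :: "real poly"
      using integrable_poly_gaussian[of "[:0, 1:] * p"] by simp
    ultimately show ?thesis using integrable_poly_gaussian
      by (simp only: Bochner_Integration.integral_diff)
  qed
  then show ?case by (cases "r = 0") (auto simp: gaussian.prob_space[simplified])
qed

lemma integral_hermite: "(\<integral>x. hermite q x \<partial>gaussian) = (if q = 0 then 1 else 0)"
  using hermite_orthogonal[of q 0] by simp

section \<open>Expansions in the Hermite basis\<close>

definition hermite_sum :: "nat \<Rightarrow> (nat \<Rightarrow> real) \<Rightarrow> real \<Rightarrow> real" where
  "hermite_sum d w x = (\<Sum>q\<le>d. w q * hermite q x)"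

text \<open>One envelope for all Hermite sums of order at most \<open>d\<close>. The term of order 0
  makes it at least 1, so that lower powers are dominated by higher ones.\<close>

definition hermite_abs :: "nat \<Rightarrow> real \<Rightarrow> real" where
  "hermite_abs d x = (\<Sum>q\<le>d. \<bar>hermite q x\<bar>)"

lemma hermite_sum_measurable [measurable]: "hermite_sum d w \<in> borel_measurable borel"
  unfolding hermite_sum_def[abs_def] by measurable

lemma hermite_abs_measurable [measurable]: "hermite_abs d \<in> borel_measurable borel"
  unfolding hermite_abs_def[abs_def] by measurable

lemma hermite_abs_ge_1: "1 \<le> hermite_abs d x"
proof -
  have "\<bar>hermite 0 x\<bar> \<le> hermite_abs d x"
    unfolding hermite_abs_def by (rule member_le_sum) auto
  then show ?thesis by simp
qed

lemma hermite_le_hermite_abs: "q \<le> d \<Longrightarrow> \<bar>hermite q x\<bar> \<le> hermite_abs d x"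
  unfolding hermite_abs_def by (rule member_le_sum) auto

lemma hermite_sum_bound:
  assumes "\<And>q. q \<le> d \<Longrightarrow> \<bar>w q\<bar> \<le> A"
  shows "\<bar>hermite_sum d w x\<bar> \<le> A * hermite_abs d x"
  unfolding hermite_sum_def hermite_abs_def sum_distrib_left
  by (rule order_trans[OF sum_abs]) (auto intro!: sum_mono mult_right_mono assms simp: abs_mult)

lemma integrable_hermite_abs_power: "integrable gaussian (\<lambda>x. hermite_abs d x ^ k)"
proof -
  have "\<forall>q. \<exists>C\<ge>0. \<forall>x. \<bar>hermite q x\<bar> \<le> C * (1 + \<bar>x\<bar>) ^ q" using hermite_bound by blast
  then obtain C where C: "\<And>q. C q \<ge> 0" "\<And>q x. \<bar>hermite q x\<bar> \<le> C q * (1 + \<bar>x\<bar>) ^ q" by metis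
  define K where "K = (\<Sum>q\<le>d. C q)"
  have K: "hermite_abs d x \<le> K * (1 + \<bar>x\<bar>) ^ d" for x
    unfolding hermite_abs_def K_def sum_distrib_right
    by (intro sum_mono order_trans[OF C(2)] mult_left_mono power_increasing C(1)) auto
  have "integrable lborel (\<lambda>x. std_normal_density x * \<bar>x\<bar> ^ i)" for i
    by (rule integrable_std_normal_moment_abs)
  then have "integrable gaussian (\<lambda>x. \<bar>x\<bar> ^ i)" for i
    by (subst integrable_density) auto
  then have "integrable gaussian (\<lambda>x. K ^ k * (\<Sum>i\<le>d * k. of_nat (d * k choose i) * 1 ^ i * \<bar>x\<bar> ^ (d * k -
      i)))"
    by (intro integrable_mult_right Bochner_Integration.integrable_sum)
  then have "integrable gaussian (\<lambda>x. K ^ k * (1 + \<bar>x\<bar>) ^ (d * k))"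
    by (subst binomial_ring)
  then show ?thesis
  proof (rule Bochner_Integration.integrable_bound)
    have "hermite_abs d x ^ k \<le> K ^ k * (1 + \<bar>x\<bar>) ^ (d * k)" for x
      using power_mono[OF K[of x], of k] hermite_abs_ge_1[of d x]
          by (simp add: power_mult_distrib power_mult)
    moreover have "0 \<le> hermite_abs d x ^ k" for x using hermite_abs_ge_1[of d x] by simp
    ultimately show "AE x in gaussian. norm (hermite_abs d x ^ k) \<le> norm (K ^ k * (1 + \<bar>x\<bar>) ^ (d * k))"
      by (auto intro!: AE_I2 order_trans[OF _ abs_ge_self])
  qed measurable
qed

text \<open>Linearisation of products, by induction on \<open>i\<close> through the three-term
  recurrence. The coefficients depend on \<open>i\<close> and \<open>j\<close> only, which later
  makes the bounds on conditional variances uniform in the rows of the array.\<close>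

lemma hermite_mult_ex: "\<exists>L. \<forall>x. hermite i x * hermite j x = hermite_sum (i + j) L x"
proof (induction i rule: less_induct)
  case (less i)
  have pad: "\<exists>w'. \<forall>x. hermite_sum d w x = hermite_sum d' w' x" if "d \<le> d'" for d d' w
  proof -
    have "hermite_sum d w x = hermite_sum d' (\<lambda>q. if q \<le> d then w q else 0) x" for x
    proof -
      have "hermite_sum d' (\<lambda>q. if q \<le> d then w q else 0) x = (\<Sum>q\<in>{..d'} \<inter> {q. q \<le> d}. w q * hermite q x)"
        unfolding hermite_sum_def by (subst sum.inter_restrict) (auto intro!: sum.cong)
      also have "{..d'} \<inter> {q. q \<le> d} = {..d}" using that by auto
      finally show ?thesis by (simp add: hermite_sum_def)
    qed
    then show ?thesis by blast
  qed
  have X: "\<exists>w'. \<forall>x. x * hermite_sum d w x = hermite_sum (Suc d) w' x" for d w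
  proof -
    have "x * hermite_sum d w x = hermite_sum (Suc d)
       (\<lambda>q. (if q = 0 then 0 else w (q - 1)) + (if q < d then real (Suc q) * w (Suc q) else 0)) x" for x
    proof -
      have "x * hermite_sum d w x = (\<Sum>q\<le>d. w q * hermite (Suc q) x) +
          (\<Sum>q\<le>d. w q * (real q * hermite (q - 1) x))"
        unfolding hermite_sum_def sum_distrib_left sum.distrib[symmetric]
        by (rule sum.cong[OF refl]) (simp only: mult.left_commute[of x] hermite_mult_X distrib_left)
      also have "(\<Sum>q\<le>d. w q * hermite (Suc q) x) = (\<Sum>q\<le>Suc d. (if q =
          0 then 0 else w (q - 1)) * hermite q x)"
        by (subst sum.atMost_Suc_shift) simp
      also have "(\<Sum>q\<le>d. w q * (real q * hermite (q - 1) x)) =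
         (\<Sum>q<d. real (Suc q) * w (Suc q) * hermite q x)"
        by (subst sum.atMost_shift) (simp add: algebra_simps)
      also have "\<dots> = (\<Sum>q\<le>Suc d. (if q < d then real (Suc q) * w (Suc q) else 0) * hermite q x)"
        by (rule sum.mono_neutral_cong_left) auto
      finally show ?thesis unfolding hermite_sum_def by (simp add: sum.distrib distrib_right)
    qed
    then show ?thesis by blast
  qed
  show ?case
  proof (cases "i = 0 \<or> i = 1")
    case True
    have "hermite j x = hermite_sum j (\<lambda>q. if q = j then 1 else 0) x" for x
    proof -
      have "hermite_sum j (\<lambda>q. if q = j then 1 else 0) x = (\<Sum>q\<le>j. if q = j then hermite q x else 0)"
        unfolding hermite_sum_def by (rule sum.cong) auto
      then show ?thesis by simp
    qed
    then show ?thesis using X[of j "\<lambda>q. if q = j then 1 else 0"] True by auto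
  next
    case False
    then obtain r where r: "i = Suc (Suc r)" by (metis One_nat_def not0_implies_Suc)
    obtain u where u: "\<And>x. hermite (Suc r) x * hermite j x = hermite_sum (Suc r + j) u x"
        using less[of "Suc r"] r by auto
    obtain v where v: "\<And>x. hermite r x * hermite j x = hermite_sum (r + j) v x" using less[of r] r by auto
    obtain u' where u': "\<And>x. x * hermite_sum (Suc r + j) u x = hermite_sum (i + j) u' x"
        using X[of "Suc r + j" u] r by auto
    obtain v' where v': "\<And>x. hermite_sum (r + j) v x = hermite_sum (i + j) v' x" using pad[of "r + j" "i +
        j" v] r by auto
    have "hermite i x * hermite j x = hermite_sum (i + j) (\<lambda>q. u' q - real (Suc r) * v' q) x" for x
    proof -
      have "hermite i x * hermite j x = x * (hermite (Suc r) x * hermite j x) - real (Suc r) * (hermite r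
          x * hermite j x)"
        unfolding r by (simp add: algebra_simps)
      also have "\<dots> = hermite_sum (i + j) u' x - real (Suc r) * hermite_sum (i + j) v' x"
        unfolding u v u' v' ..
      finally show ?thesis
        unfolding hermite_sum_def by (simp add: left_diff_distrib sum_subtractf sum_distrib_left mult.assoc)
    qed
    then show ?thesis by blast
  qed
qed

lemma hermite_sum_pad:
  assumes "d \<le> d'"
  shows "hermite_sum d w x = hermite_sum d' (\<lambda>q. if q \<le> d then w q else 0) x"
  unfolding hermite_sum_def using assms by (intro sum.mono_neutral_cong_left) auto

lemma integrable_hermite_sum: "integrable gaussian (hermite_sum d w)"
  unfolding hermite_sum_def[abs_def]
  by (intro Bochner_Integration.integrable_sum integrable_mult_right integrable_hermite)

lemma integral_hermite_sum: "(\<integral>x. hermite_sum d w x \<partial>gaussian) = w 0"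
proof -
  have "(\<integral>x. hermite_sum d w x \<partial>gaussian) = (\<Sum>q\<le>d. w q * (\<integral>x. hermite q x \<partial>gaussian))"
    unfolding hermite_sum_def
    by (subst Bochner_Integration.integral_sum) (auto intro: integrable_mult_right integrable_hermite)
  also have "\<dots> = (\<Sum>q\<le>d. if q = 0 then w q else 0)"
    by (rule sum.cong) (auto simp: integral_hermite)
  finally show ?thesis by simp
qed

lemma integrable_hermite_sum_power2: "integrable gaussian (\<lambda>x. (hermite_sum d w x)\<^sup>2)"
  unfolding hermite_sum_def power2_eq_square sum_product
  using integrable_hermite_mult
  by (intro Bochner_Integration.integrable_sum)
    (auto simp: mult.assoc mult.left_commute[of "hermite _ _"])

lemma integral_hermite_sum_power2:
  "(\<integral>x. (hermite_sum d w x)\<^sup>2 \<partial>gaussian) = (\<Sum>q\<le>d. (w q)\<^sup>2 * fact q)"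
proof -
  have "(\<integral>x. (hermite_sum d w x)\<^sup>2 \<partial>gaussian) =
      (\<integral>x. (\<Sum>q\<le>d. \<Sum>r\<le>d. w q * w r * (hermite q x * hermite r x)) \<partial>gaussian)"
    unfolding hermite_sum_def power2_eq_square sum_product
    by (intro Bochner_Integration.integral_cong sum.cong) (auto simp: algebra_simps)
  also have "\<dots> = (\<Sum>q\<le>d. \<Sum>r\<le>d. w q * w r * (\<integral>x. hermite q x * hermite r x \<partial>gaussian))"
    by (simp add: Bochner_Integration.integral_sum integrable_hermite_mult)
  also have "\<dots> = (\<Sum>q\<le>d. \<Sum>r\<le>d. if q = r then (w q)\<^sup>2 * fact q else 0)"
    by (intro sum.cong) (auto simp: hermite_orthogonal power2_eq_square)
  finally show ?thesis by simp
qed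

text \<open>If \<open>a\<^sup>2 + b\<^sup>2 = 1\<close>, then \<open>hermite q\<close> is an eigenfunction with eigenvalue \<open>a ^ q\<close> of the transition operator
  of the chain \<open>x \<mapsto> a x + b e\<close> with Gaussian innovation \<open>e\<close>, so \<open>hermite_step\<close> is a martingale increment.\<close>

definition hermite_step :: "real \<Rightarrow> real \<Rightarrow> nat \<Rightarrow> (nat \<Rightarrow> real) \<Rightarrow> real \<Rightarrow> real \<Rightarrow> real" where
  "hermite_step a b d w x e = hermite_sum d w (a * x + b * e) - hermite_sum d (\<lambda>q. a ^ q * w q) x"

lemma hermite_step_measurable [measurable]:
  "case_prod (hermite_step a b d w) \<in> borel_measurable (borel \<Otimes>\<^sub>M borel)"
  unfolding hermite_step_def[abs_def] by measurable

text \<open>Coefficient of \<open>hermite (q - j) x * hermite j e\<close> in the addition formula.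
  The term \<open>j = 0\<close> is \<open>a ^ q * w q * hermite q x\<close>, exactly what
  \<open>hermite_step\<close> subtracts, and is therefore set to 0.\<close>

definition step_coeff :: "real \<Rightarrow> real \<Rightarrow> (nat \<Rightarrow> real) \<Rightarrow> nat \<Rightarrow> nat \<Rightarrow> real" where
  "step_coeff a b w j q =
     (if 1 \<le> j \<and> j \<le> q then w q * real (q choose j) * a ^ (q - j) * b ^ j else 0)"

lemma hermite_step_expand:
  assumes "a\<^sup>2 + b\<^sup>2 = 1"
  shows "hermite_step a b d w x e =
    (\<Sum>j\<le>d. (\<Sum>q\<le>d. step_coeff a b w j q * hermite (q - j) x) * hermite j e)"
proof -
  have "w q * hermite q (a * x + b * e) - a ^ q * w q * hermite q x =
      (\<Sum>j\<le>d. step_coeff a b w j q * hermite (q - j) x * hermite j e)" if "q \<le> d" for q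
  proof -
    have "w q * hermite q (a * x + b * e) =
        (\<Sum>j\<le>q. w q * real (q choose j) * a ^ (q - j) * b ^ j * hermite (q - j) x * hermite j e)"
      unfolding hermite_add[OF assms] sum_distrib_left by (simp add: mult.assoc)
    also have "\<dots> = a ^ q * w q * hermite q x +
        (\<Sum>j=1..q. w q * real (q choose j) * a ^ (q - j) * b ^ j * hermite (q - j) x * hermite j e)"
      by (simp add: atMost_atLeast0 sum.atLeast_Suc_atMost)
    also have "(\<Sum>j=1..q. w q * real (q choose j) * a ^ (q - j) * b ^ j * hermite (q - j) x * hermite j e) =
        (\<Sum>j\<le>d. step_coeff a b w j q * hermite (q - j) x * hermite j e)"
      using that by (intro sum.mono_neutral_cong_left) (auto simp: step_coeff_def)
    finally show ?thesis by simp
  qed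
  then have "hermite_step a b d w x e = (\<Sum>q\<le>d. \<Sum>j\<le>d. step_coeff a b w j q * hermite (q - j) x * hermite j
      e)"
    unfolding hermite_step_def hermite_sum_def by (simp add: sum_subtractf[symmetric])
  also have "\<dots> = (\<Sum>j\<le>d. \<Sum>q\<le>d. step_coeff a b w j q * hermite (q - j) x * hermite j e)"
    by (rule sum.swap)
  finally show ?thesis by (simp add: sum_distrib_right)
qed

text \<open>As \<open>j >= 1\<close>, every coefficient carries at least one factor
  \<open>b\<close>. This gain makes one step of the chain small although the function itself is not:
  \<open>b\<close> tends to 0 along the array.\<close>

lemma step_coeff_bound:
  assumes "0 \<le> a" "a \<le> 1" "0 \<le> b" "b \<le> 1" "\<bar>w q\<bar> \<le> A" "q \<le> d"
  shows "\<bar>step_coeff a b w j q\<bar> \<le> b * A * 2 ^ d"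
proof (cases "1 \<le> j \<and> j \<le> q")
  case True
  have A: "0 \<le> A" using assms by linarith
  have "real (q choose j) \<le> real (2 ^ q)" using binomial_le_pow2 by (intro of_nat_mono)
  also have "\<dots> \<le> 2 ^ d" using assms by (simp add: power_increasing)
  finally have c: "real (q choose j) \<le> 2 ^ d" .
  have "b ^ j \<le> b ^ 1" using True assms by (intro power_decreasing) auto
  then have b: "b ^ j \<le> b" by simp
  have a: "a ^ (q - j) \<le> 1" using assms by (intro power_le_one) auto
  have "\<bar>step_coeff a b w j q\<bar> = \<bar>w q\<bar> * real (q choose j) * a ^ (q - j) * b ^ j"
    using True assms by (simp add: step_coeff_def abs_mult)
  also have "\<dots> \<le> A * 2 ^ d * 1 * b"
    using assms A a b c by (intro mult_mono) auto
  finally show ?thesis by (simp add: mult_ac)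
qed (use assms in \<open>auto simp: step_coeff_def intro!: mult_nonneg_nonneg\<close>)

text \<open>The factor \<open>Suc d\<close> counts the orders \<open>q\<close>; the power bounds the
  binomial coefficients.\<close>

definition step_const :: "nat \<Rightarrow> real" where "step_const d = real (Suc d) * 2 ^ d"

lemma step_const_pos: "0 < step_const d" by (simp add: step_const_def)

lemma hermite_step_bound:
  assumes ab: "a\<^sup>2 + b\<^sup>2 = 1" "0 \<le> a" "a \<le> 1" "0 \<le> b" "b \<le> 1" and w: "\<And>q. q \<le> d \<Longrightarrow> \<bar>w q\<bar> \<le> A"
  shows "\<bar>hermite_step a b d w x e\<bar> \<le> b * A * (step_const d * hermite_abs d x * hermite_abs d e)"
proof -
  have A: "0 \<le> A" using w[of 0] by simp
  have "\<bar>hermite_step a b d w x e\<bar> \<le> (\<Sum>j\<le>d. \<Sum>q\<le>d. \<bar>step_coeff a b w j q\<bar> * \<bar>hermite (q - j) x\<bar> * \<bar>hermite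
      j e\<bar>)"
    unfolding hermite_step_expand[OF ab(1)] sum_distrib_right
    by (rule order_trans[OF sum_abs] sum_mono)+ (simp add: abs_mult)
  also have "\<dots> \<le> (\<Sum>j\<le>d. \<Sum>q\<le>d. (b * A * 2 ^ d) * hermite_abs d x * \<bar>hermite j e\<bar>)"
    using ab A w hermite_abs_ge_1
    by (intro sum_mono mult_mono step_coeff_bound hermite_le_hermite_abs) (auto intro!: mult_nonneg_nonneg
        intro: order_trans[OF zero_le_one])
  also have "\<dots> = b * A * (step_const d * hermite_abs d x * hermite_abs d e)"
    by (simp add: step_const_def hermite_abs_def[of d e] sum_distrib_left[symmetric]
        sum_distrib_right[symmetric] mult_ac)
  finally show ?thesis .
qed

text \<open>For a fixed state the step is a Hermite sum in the innovation whose coefficient of order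
  0 vanishes. Centring and the conditional variance then follow from orthogonality.\<close>

lemma hermite_step_sum_eq:
  assumes "a\<^sup>2 + b\<^sup>2 = 1"
  shows "hermite_step a b d w x = hermite_sum d (\<lambda>j. \<Sum>q\<le>d. step_coeff a b w j q * hermite (q - j) x)"
  by (simp add: fun_eq_iff hermite_step_expand[OF assms] hermite_sum_def)

lemma integral_hermite_step:
  assumes "a\<^sup>2 + b\<^sup>2 = 1"
  shows "(\<integral>e. hermite_step a b d w x e \<partial>gaussian) = 0"
  by (simp add: hermite_step_sum_eq[OF assms] integral_hermite_sum step_coeff_def)

text \<open>The conditional variance of a step as a polynomial of the state. Orthogonality in the
  innovation gives a sum of squares of Hermite sums in \<open>x\<close>, which the linearisation of
  products turns back into a Hermite sum of order \<open>2 * d\<close>. The constant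
  \<open>C\<close> is quantified before \<open>a\<close>, \<open>b\<close> and \<open>w\<close>
  because it has to serve all rows of an array in which \<open>a\<close> approaches 1.\<close>

lemma integral_hermite_step_power2:
  "\<exists>C\<ge>0. \<forall>a b w A. a\<^sup>2 + b\<^sup>2 = 1 \<longrightarrow> 0 \<le> a \<longrightarrow> a \<le> 1 \<longrightarrow> 0 \<le> b \<longrightarrow> b \<le> 1 \<longrightarrow> (\<forall>q\<le>d. \<bar>w q\<bar> \<le> A) \<longrightarrow>
     (\<exists>v. (\<forall>x. (\<integral>e. (hermite_step a b d w x e)\<^sup>2 \<partial>gaussian) = hermite_sum (2 * d) v x) \<and>
        (\<forall>r\<le>2 * d. \<bar>v r\<bar> \<le> C * (b * A)\<^sup>2) \<and> v 0 = (\<Sum>q\<le>d. (w q)\<^sup>2 * fact q * (1 - a ^ (2 * q))))"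
proof -
  have "\<forall>i j. \<exists>L. \<forall>x. hermite i x * hermite j x = hermite_sum (i + j) L x" using hermite_mult_ex by blast
  then obtain L0 where L0: "\<And>i j x. hermite i x * hermite j x = hermite_sum (i + j) (L0 i j) x" by metis
  \<comment> \<open>Extended by 0, so that all products can be expanded up to the common order
    \<open>2 * d\<close>.\<close>
  define L where "L i j r = (if r \<le> i + j then L0 i j r else 0)" for i j r
  have L: "hermite i x * hermite j x = (\<Sum>r\<le>2 * d. L i j r * hermite r x)" if "i \<le> d" "j \<le> d" for i j x
    unfolding L0 L_def using that by (subst hermite_sum_pad[of "i +
        j" "2 * d"]) (auto simp: hermite_sum_def)
  \<comment> \<open>Summing over \<open>r\<close> as well gives one constant for every
    coefficient.\<close>
  define C where "C = (\<Sum>r\<le>2 * d. \<Sum>j\<le>d. \<Sum>q\<le>d. \<Sum>q'\<le>d. fact j * (2 ^ d)\<^sup>2 * \<bar>L (q - j) (q' - j) r\<bar>)"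
  have "\<exists>v. (\<forall>x. (\<integral>e. (hermite_step a b d w x e)\<^sup>2 \<partial>gaussian) = hermite_sum (2 * d) v x) \<and>
        (\<forall>r\<le>2 * d. \<bar>v r\<bar> \<le> C * (b * A)\<^sup>2) \<and> v 0 = (\<Sum>q\<le>d. (w q)\<^sup>2 * fact q * (1 - a ^ (2 * q)))"
    if ab: "a\<^sup>2 + b\<^sup>2 = 1" "0 \<le> a" "a \<le> 1" "0 \<le> b" "b \<le> 1" and w: "\<forall>q\<le>d. \<bar>w q\<bar> \<le> A" for a b A and w
  proof (intro exI conjI allI impI)
    define v where "v r = (\<Sum>j\<le>d. \<Sum>q\<le>d. \<Sum>q'\<le>d. fact j * step_coeff a b w j q * step_coeff a b w j q' * L (q
        - j) (q' - j) r)" for r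
    have A: "0 \<le> A" using w by (meson abs_ge_zero le0 order_trans)
    have sq: "(\<integral>e. (hermite_step a b d w x e)\<^sup>2 \<partial>gaussian) =
        (\<Sum>j\<le>d. (\<Sum>q\<le>d. step_coeff a b w j q * hermite (q - j) x)\<^sup>2 * fact j)" for x
      unfolding hermite_step_sum_eq[OF ab(1)] integral_hermite_sum_power2 ..
    show v: "(\<integral>e. (hermite_step a b d w x e)\<^sup>2 \<partial>gaussian) = hermite_sum (2 * d) v x" for x
    proof -
      have "(\<Sum>j\<le>d. (\<Sum>q\<le>d. step_coeff a b w j q * hermite (q - j) x)\<^sup>2 * fact j) =
          (\<Sum>j\<le>d. \<Sum>q\<le>d. \<Sum>q'\<le>d. fact j * step_coeff a b w j q * step_coeff a b w j q' * (hermite (q - j) x *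
              hermite (q' - j) x))"
        unfolding power2_eq_square sum_product
        by (intro sum.cong refl, simp only: sum_distrib_right, intro sum.cong refl) (simp add: mult_ac)
      also have "\<dots> = (\<Sum>j\<le>d. \<Sum>q\<le>d. \<Sum>q'\<le>d. \<Sum>r\<le>2 * d. fact j * step_coeff a b w j q * step_coeff a b w j q' *
          L (q - j) (q' - j) r * hermite r x)"
        by (intro sum.cong refl) (simp add: L sum_distrib_left mult.assoc)
      also have "\<dots> = (\<Sum>j\<le>d. \<Sum>q\<le>d. \<Sum>r\<le>2 * d. \<Sum>q'\<le>d. fact j * step_coeff a b w j q * step_coeff a b w j q' *
          L (q - j) (q' - j) r * hermite r x)"
        by (intro sum.cong refl sum.swap)
      also have "\<dots> = (\<Sum>j\<le>d. \<Sum>r\<le>2 * d. \<Sum>q\<le>d. \<Sum>q'\<le>d. fact j * step_coeff a b w j q * step_coeff a b w j q' *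
          L (q - j) (q' - j) r * hermite r x)"
        by (intro sum.cong refl sum.swap)
      also have "\<dots> = (\<Sum>r\<le>2 * d. \<Sum>j\<le>d. \<Sum>q\<le>d. \<Sum>q'\<le>d. fact j * step_coeff a b w j q * step_coeff a b w j q' *
          L (q - j) (q' - j) r * hermite r x)"
        by (rule sum.swap)
      also have "\<dots> = hermite_sum (2 * d) v x"
        unfolding hermite_sum_def v_def sum_distrib_right ..
      finally show ?thesis unfolding sq .
    qed
    show "\<bar>v r\<bar> \<le> C * (b * A)\<^sup>2" if "r \<le> 2 * d" for r
    proof -
      have "\<bar>v r\<bar> \<le> (\<Sum>j\<le>d. \<Sum>q\<le>d. \<Sum>q'\<le>d. fact j * \<bar>step_coeff a b w j q\<bar> * \<bar>step_coeff a b w j q'\<bar> * \<bar>L (q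
          - j) (q' - j) r\<bar>)"
        unfolding v_def by (rule order_trans[OF sum_abs] sum_mono)+ (simp add: abs_mult)
      also have "\<dots> \<le> (\<Sum>j\<le>d. \<Sum>q\<le>d. \<Sum>q'\<le>d. fact j * (b * A * 2 ^ d) * (b * A * 2 ^ d) * \<bar>L (q - j) (q' - j)
          r\<bar>)"
        using ab w A by (intro sum_mono mult_right_mono mult_mono step_coeff_bound) auto
      also have "\<dots> = (\<Sum>j\<le>d. \<Sum>q\<le>d. \<Sum>q'\<le>d. fact j * (2 ^ d)\<^sup>2 * \<bar>L (q - j) (q' - j) r\<bar>) * (b * A)\<^sup>2"
        unfolding sum_distrib_right by (simp add: power2_eq_square mult_ac)
      also have "\<dots> \<le> C * (b * A)\<^sup>2"
        unfolding C_def using that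
        by (intro mult_right_mono member_le_sum[of r "{..2 * d}"]) (auto intro!: sum_nonneg)
      finally show ?thesis .
    qed
    \<comment> \<open>The coefficient of order 0 is the stationary mean; integrating the sum of
      squares over \<open>x\<close> allows a second use of orthogonality.\<close>
    have "v 0 = (\<integral>x. hermite_sum (2 * d) v x \<partial>gaussian)" by (simp add: integral_hermite_sum)
    also have "\<dots> = (\<integral>x. (\<Sum>j\<le>d. (\<Sum>q\<le>d. step_coeff a b w j q * hermite (q - j) x)\<^sup>2 * fact j) \<partial>gaussian)"
      unfolding v[symmetric] sq ..
    also have "\<dots> = (\<integral>x. (\<Sum>j\<le>d. (hermite_sum (d - j) (\<lambda>q. step_coeff a b w j (q +
        j)) x)\<^sup>2 * fact j) \<partial>gaussian)"
    proof -
      \<comment> \<open>Orders below \<open>j\<close> have coefficient 0, which neutralises the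
        truncation in \<open>q - j\<close>; after the shift the orders are distinct and
        orthogonality applies.\<close>
      have "(\<Sum>q\<le>d. step_coeff a b w j q * hermite (q - j) x) =
          hermite_sum (d - j) (\<lambda>q. step_coeff a b w j (q + j)) x"
        if "j \<le> d" for j x
      proof -
        have "(\<Sum>q\<le>d. step_coeff a b w j q * hermite (q - j) x) =
            (\<Sum>q\<in>{j..d}. step_coeff a b w j q * hermite (q - j) x)"
          by (rule sum.mono_neutral_right) (auto simp: step_coeff_def)
        also have "\<dots> = (\<Sum>q\<in>{..d - j}. step_coeff a b w j (q + j) * hermite q x)"
          using that by (intro sum.reindex_bij_witness[of _ "\<lambda>q. q + j" "\<lambda>q. q - j"]) auto
        finally show ?thesis by (simp add: hermite_sum_def)
      qed
      then show ?thesis by simp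
    qed
    also have "\<dots> = (\<Sum>j\<le>d. \<Sum>q\<le>d - j. (step_coeff a b w j (q + j))\<^sup>2 * fact q * fact j)"
      by (simp add: Bochner_Integration.integral_sum integrable_hermite_sum_power2
          integral_hermite_sum_power2 sum_distrib_right)
    also have "\<dots> = (\<Sum>j\<le>d. \<Sum>q\<in>{j..d}. (step_coeff a b w j q)\<^sup>2 * fact (q - j) * fact j)"
    proof (rule sum.cong[OF refl])
      fix j assume "j \<in> {..d}"
      then show "(\<Sum>q\<le>d - j. (step_coeff a b w j (q + j))\<^sup>2 * fact q * fact j) =
          (\<Sum>q\<in>{j..d}. (step_coeff a b w j q)\<^sup>2 * fact (q - j) * fact j)"
        by (intro sum.reindex_bij_witness[of _ "\<lambda>q. q - j" "\<lambda>q. q + j"]) auto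
    qed
    also have "\<dots> = (\<Sum>j\<le>d. \<Sum>q\<le>d. (step_coeff a b w j q)\<^sup>2 * fact (q - j) * fact j)"
      by (intro sum.cong refl sum.mono_neutral_left) (auto simp: step_coeff_def)
    also have "\<dots> = (\<Sum>q\<le>d. \<Sum>j\<le>d. (step_coeff a b w j q)\<^sup>2 * fact (q - j) * fact j)"
      by (rule sum.swap)
    also have "\<dots> = (\<Sum>q\<le>d. (w q)\<^sup>2 * fact q * (1 - a ^ (2 * q)))"
    proof (rule sum.cong[OF refl])
      fix q assume q: "q \<in> {..d}"
      have "(\<Sum>j\<le>d. (step_coeff a b w j q)\<^sup>2 * fact (q - j) * fact j) =
          (\<Sum>j\<in>{1..q}. (step_coeff a b w j q)\<^sup>2 * fact (q - j) * fact j)"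
        using q by (intro sum.mono_neutral_right) (auto simp: step_coeff_def)
      \<comment> \<open>The factorials and one of the two binomial coefficients combine to
        \<open>fact q\<close>. What remains is the binomial expansion of
        \<open>(b\<^sup>2 + a\<^sup>2) ^ q = 1\<close> without its term
        \<open>j = 0\<close>.\<close>
      also have "\<dots> = (\<Sum>j\<in>{1..q}. (w q)\<^sup>2 * fact q * (real (q choose j) * (b\<^sup>2) ^ j * (a\<^sup>2) ^ (q - j)))"
      proof (rule sum.cong[OF refl])
        fix j assume j: "j \<in> {1..q}"
        have "fact j * fact (q - j) * (q choose j) = (fact q :: nat)"
          using j binomial_fact_lemma[of j q] by simp
        then have f: "fact j * fact (q - j) * real (q choose j) = fact q"
          by (metis of_nat_fact of_nat_mult)
        have "(step_coeff a b w j q)\<^sup>2 * fact (q - j) * fact j =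
            (w q)\<^sup>2 * (fact j * fact (q - j) * real (q choose j)) * (real (q choose j) * (b ^ j)\<^sup>2 * (a ^
                (q - j))\<^sup>2)"
          using j by (simp add: step_coeff_def power2_eq_square mult_ac)
        then show "(step_coeff a b w j q)\<^sup>2 * fact (q - j) * fact j =
            (w q)\<^sup>2 * fact q * (real (q choose j) * (b\<^sup>2) ^ j * (a\<^sup>2) ^ (q - j))"
          unfolding f by (simp add: power_mult[symmetric] mult.commute)
      qed
      also have "\<dots> = (w q)\<^sup>2 * fact q * ((\<Sum>j\<le>q. real (q choose j) * (b\<^sup>2) ^ j * (a\<^sup>2) ^ (q - j)) - a ^ (2
          * q))"
        by (simp add: sum_distrib_left[symmetric] atMost_atLeast0 sum.atLeast_Suc_atMost power_mult)
      also have "(\<Sum>j\<le>q. real (q choose j) * (b\<^sup>2) ^ j * (a\<^sup>2) ^ (q - j)) = 1"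
        using binomial_ring[of "b\<^sup>2" "a\<^sup>2" q] ab(1) by (simp add: add.commute)
      finally show "(\<Sum>j\<le>d. (step_coeff a b w j q)\<^sup>2 * fact (q - j) * fact j) =
          (w q)\<^sup>2 * fact q * (1 - a ^ (2 * q))" .
    qed
    finally show "v 0 = (\<Sum>q\<le>d. (w q)\<^sup>2 * fact q * (1 - a ^ (2 * q)))" .
  qed
  then show ?thesis by (intro exI[of _ C]) (auto simp: C_def intro!: sum_nonneg)
qed

section \<open>Weak convergence in the Skorokhod space\<close>

lemma space_borel_of [simp]: "space (borel_of T) = topspace T"
  unfolding borel_of_def by (rule space_measure_of) (auto dest: openin_subset)

lemma sets_borel_of: "sets (borel_of T) = sigma_sets (topspace T) {U. openin T U}"
  unfolding borel_of_def by (rule sets_measure_of) (auto dest: openin_subset)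

lemma measurable_borel_of_continuous_map:
  assumes "continuous_map T euclideanreal F"
  shows "F \<in> borel_measurable (borel_of T)"
proof (rule borel_measurableI)
  fix S :: "real set" assume "open S"
  then have "openin T {x \<in> topspace T. F x \<in> S}"
    using assms by (auto simp: continuous_map_def)
  moreover have "F -` S \<inter> space (borel_of T) = {x \<in> topspace T. F x \<in> S}" by auto
  ultimately show "F -` S \<inter> space (borel_of T) \<in> sets (borel_of T)"
    unfolding sets_borel_of by auto
qed

lemma measurable_to_borel_of:
  assumes "\<And>x. x \<in> space M \<Longrightarrow> f x \<in> topspace T"
    and "\<And>U. openin T U \<Longrightarrow> f -` U \<inter> space M \<in> sets M"
  shows "f \<in> M \<rightarrow>\<^sub>M borel_of T"
  unfolding borel_of_def using assms by (intro measurable_measure_of) (auto dest: openin_subset)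

section \<open>Lipschitz test functions and limits of measurable maps in a metric space\<close>

context Metric_space begin

lemma Lipschitz_continuous_map:
  assumes "\<And>x y. x \<in> M \<Longrightarrow> y \<in> M \<Longrightarrow> \<bar>F x - F y\<bar> \<le> L * d x y"
  shows "continuous_map mtopology euclideanreal F"
  unfolding continuous_map_def
proof (intro conjI allI impI)
  fix U :: "real set" assume "openin euclideanreal U"
  then have U: "open U" by simp
  have "\<exists>r>0. mball x r \<subseteq> {x \<in> M. F x \<in> U}" if x: "x \<in> M" "F x \<in> U" for x
  proof -
    obtain e where e: "e > 0" "\<And>z. \<bar>z - F x\<bar> < e \<Longrightarrow> z \<in> U"
      using U x(2) unfolding open_dist dist_real_def by blast
    \<comment> \<open>The constant \<open>L\<close> may be 0 or negative;
      \<open>\<bar>L\<bar> + 1\<close> is a positive substitute.\<close>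
    define r where "r = e / (\<bar>L\<bar> + 1)"
    have r: "r > 0" using e by (simp add: r_def)
    have "F y \<in> U" if "y \<in> mball x r" for y
    proof (rule e(2))
      have y: "y \<in> M" "d x y < r" using that by auto
      have "\<bar>F y - F x\<bar> \<le> L * d y x" using assms y x by auto
      also have "\<dots> \<le> (\<bar>L\<bar> + 1) * d x y"
        unfolding commute[of y x] by (rule mult_right_mono) auto
      also have "\<dots> < (\<bar>L\<bar> + 1) * r" using y by (intro mult_strict_left_mono) auto
      finally show "\<bar>F y - F x\<bar> < e" by (simp add: r_def)
    qed
    then show ?thesis using r by (intro exI[of _ r]) auto
  qed
  then show "openin mtopology {x \<in> topspace mtopology. F x \<in> U}"
    by (auto simp: openin_mtopology)
qed auto

text \<open>The infimal convolutions \<open>F\<^sub>k x = (INF y. F y + k * d x y)\<close> are Lipschitz and increase to \<open>F\<close>.\<close>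

lemma converges_in_distribution_LipschitzI:
  fixes P :: "'p measure" and Q :: "'q measure"
  assumes P: "prob_space P" and Q: "prob_space Q"
    and Y: "\<And>n. Y n \<in> P \<rightarrow>\<^sub>M borel_of mtopology" and Z: "Z \<in> Q \<rightarrow>\<^sub>M borel_of mtopology"
    and lip: "\<And>F L C. \<lbrakk>\<And>x y. x \<in> M \<Longrightarrow> y \<in> M \<Longrightarrow> \<bar>F x - F y\<bar> \<le> L * d x y; \<And>x. x \<in> M \<Longrightarrow> \<bar>F x\<bar> \<le> C; L \<ge> 0\<rbrakk> \<Longrightarrow>
       (\<lambda>n. \<integral>\<omega>. F (Y n \<omega>) \<partial>P) \<longlonglongrightarrow> (\<integral>\<omega>. F (Z \<omega>) \<partial>Q)"
  shows "converges_in_distribution mtopology P Y Q Z"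
proof -
  interpret P: prob_space P by fact
  interpret Q: prob_space Q by fact
  have YM: "Y n \<omega> \<in> M" if "\<omega> \<in> space P" for n \<omega> using measurable_space[OF Y that] by simp
  have ZM: "Z \<omega> \<in> M" if "\<omega> \<in> space Q" for \<omega> using measurable_space[OF Z that] by simp
  \<comment> \<open>A one-sided bound: \<open>G k \<le> F\<close> transfers lower bounds from the
    Lipschitz functions to \<open>F\<close>. The upper bound comes from applying it to
    \<open>- F\<close>.\<close>
  have lower: "\<forall>\<^sub>F n in sequentially. (\<integral>\<omega>. F (Z \<omega>) \<partial>Q) - e < (\<integral>\<omega>. F (Y n \<omega>) \<partial>P)"
    if F: "continuous_map mtopology euclideanreal F" and C: "\<And>x. x \<in> M \<Longrightarrow> \<bar>F x\<bar> \<le> C" and e: "e > 0" for F C e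
  proof -
    define G where "G k x = (INF y\<in>M. F y + real k * d x y)" for k x
    have bdd: "bdd_below ((\<lambda>y. F y + real k * d x y) ` M)" for k x
      using C by (intro bdd_belowI[of _ "- C"]) (force simp: abs_le_iff intro: add_increasing2)
    have G_le: "G k x \<le> F y + real k * d x y" if "y \<in> M" for k x y
      unfolding G_def by (rule cINF_lower[OF bdd that])
    have G_ge: "l \<le> G k x" if "x \<in> M" "\<And>y. y \<in> M \<Longrightarrow> l \<le> F y + real k * d x y" for k x l
      unfolding G_def using that by (intro cINF_greatest) auto
    have G1: "G k x \<le> F x" if "x \<in> M" for k x using G_le[OF that, of k x] that by simp
    have Glip0: "G k x \<le> G k y + real k * d x y" if xy: "x \<in> M" "y \<in> M" for k x y
    proof -
      have "G k x - real k * d x y \<le> F z + real k * d y z" if z: "z \<in> M" for z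
      proof -
        have "real k * d x z \<le> real k * (d x y + d y z)" using triangle[OF xy z]
            by (intro mult_left_mono) auto
        then show ?thesis using G_le[OF z, of k x] by (simp add: algebra_simps)
      qed
      then have "G k x - real k * d x y \<le> G k y" using xy by (intro G_ge) auto
      then show ?thesis by simp
    qed
    have Glip: "\<bar>G k x - G k y\<bar> \<le> real k * d x y" if xy: "x \<in> M" "y \<in> M" for k x y
      using Glip0[OF xy, of k] Glip0[OF xy(2,1), of k] commute[of x y] by (simp add: abs_le_iff)
    have Gb: "\<bar>G k x\<bar> \<le> C" if "x \<in> M" for k x
    proof -
      have "- C \<le> G k x"
        by (rule G_ge[OF that]) (use C in \<open>force simp: abs_le_iff intro: add_increasing2\<close>)
      then show ?thesis using G1[OF that, of k] C[OF that] by (simp add: abs_le_iff)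
    qed
    have Glim: "(\<lambda>k. G k x) \<longlonglongrightarrow> F x" if x: "x \<in> M" for x
    proof (rule LIMSEQ_I)
      fix r :: real assume r: "r > 0"
      have preimage: "openin mtopology {y \<in> M. F y \<in> S}" if "open S" for S
        using F that by (auto simp: continuous_map_def)
      have "openin mtopology {y \<in> M. F y \<in> ball (F x) (r / 2)}" by (rule preimage[OF open_ball])
      then have "\<forall>z\<in>{y \<in> M. F y \<in> ball (F x) (r / 2)}. \<exists>s>0. mball z s \<subseteq> {y \<in> M. F y \<in> ball (F x) (r / 2)}"
        unfolding openin_mtopology by (intro ballI) (elim conjE allE impE, assumption+)
      moreover have "x \<in> {y \<in> M. F y \<in> ball (F x) (r / 2)}" using x r by simp
      ultimately obtain s where s: "s > 0" "mball x s \<subseteq> {y \<in> M. F y \<in> ball (F x) (r / 2)}"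
        by (drule_tac bspec) auto
      \<comment> \<open>Beyond distance \<open>s\<close> the penalty exceeds \<open>2 * C\<close>,
        the largest possible drop of \<open>F\<close>, so points outside the ball do not bring the
        infimum below \<open>F x\<close>.\<close>
      obtain k0 :: nat where k0: "real k0 * s > 2 * C" using s(1) reals_Archimedean3 by blast
      have "norm (G k x - F x) < r" if k: "k \<ge> k0" for k
      proof -
        have "F x - r / 2 \<le> F y + real k * d x y" if y: "y \<in> M" for y
        proof (cases "d x y < s")
          case True
          then have "F y \<in> ball (F x) (r / 2)" using s(2) x y by auto
          then have "F x - r / 2 \<le> F y" unfolding mem_ball dist_real_def by linarith
          then show ?thesis by (simp add: add_increasing2)
        next
          case False
          have "real k0 * s \<le> real k * d x y" using False k s(1) by (intro mult_mono) auto
          then show ?thesis using k0 C[OF x] C[OF y] r by linarith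
        qed
        then have "F x - r / 2 \<le> G k x" by (intro G_ge[OF x])
        then show ?thesis using G1[OF x, of k] r unfolding real_norm_def by linarith
      qed
      then show "\<exists>k0. \<forall>k\<ge>k0. norm (G k x - F x) < r" by blast
    qed
    have Gm: "G k \<in> borel_measurable (borel_of mtopology)" for k
      by (rule measurable_borel_of_continuous_map[OF Lipschitz_continuous_map[OF Glip]])
    have Fm: "F \<in> borel_measurable (borel_of mtopology)"
      by (rule measurable_borel_of_continuous_map[OF F])
    note meas = measurable_compose[OF Y Gm] measurable_compose[OF Y Fm]
      measurable_compose[OF Z Gm] measurable_compose[OF Z Fm]
    have "(\<lambda>k. \<integral>\<omega>. G k (Z \<omega>) \<partial>Q) \<longlonglongrightarrow> (\<integral>\<omega>. F (Z \<omega>) \<partial>Q)"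
      by (rule integral_dominated_convergence[where w = "\<lambda>_. C"])
        (auto intro!: meas AE_I2 Glim Gb ZM)
    then have "\<forall>\<^sub>F k in sequentially. (\<integral>\<omega>. F (Z \<omega>) \<partial>Q) - e < (\<integral>\<omega>. G k (Z \<omega>) \<partial>Q)"
      using e by (intro order_tendstoD(1)) auto
    then obtain k where k: "(\<integral>\<omega>. F (Z \<omega>) \<partial>Q) - e < (\<integral>\<omega>. G k (Z \<omega>) \<partial>Q)"
      by (auto simp: eventually_sequentially)
    have "(\<lambda>n. \<integral>\<omega>. G k (Y n \<omega>) \<partial>P) \<longlonglongrightarrow> (\<integral>\<omega>. G k (Z \<omega>) \<partial>Q)"
      using Glip Gb by (rule lip) auto
    then have "\<forall>\<^sub>F n in sequentially. (\<integral>\<omega>. F (Z \<omega>) \<partial>Q) - e < (\<integral>\<omega>. G k (Y n \<omega>) \<partial>P)"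
      using k by (intro order_tendstoD(1)) auto
    then show ?thesis
    proof eventually_elim
      case (elim n)
      have "(\<integral>\<omega>. G k (Y n \<omega>) \<partial>P) \<le> (\<integral>\<omega>. F (Y n \<omega>) \<partial>P)"
        by (intro integral_mono P.integrable_const_bound[of _ C])
          (auto intro!: meas AE_I2 Gb C G1 YM)
      then show ?case using elim by linarith
    qed
  qed
  have "(\<lambda>n. \<integral>\<omega>. F (Y n \<omega>) \<partial>P) \<longlonglongrightarrow> (\<integral>\<omega>. F (Z \<omega>) \<partial>Q)"
    if F: "continuous_map mtopology euclideanreal F" and C: "\<And>x. x \<in> M \<Longrightarrow> \<bar>F x\<bar> \<le> C" for F C
  proof (rule LIMSEQ_I)
    fix e :: real assume e: "e > 0"
    have "continuous_map mtopology euclideanreal (\<lambda>x. - F x)"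
      using F by (rule continuous_map_minus)
    then have "\<forall>\<^sub>F n in sequentially. (\<integral>\<omega>. - F (Z \<omega>) \<partial>Q) - e < (\<integral>\<omega>. - F (Y n \<omega>) \<partial>P)"
      using C e by (intro lower) auto
    moreover have "\<forall>\<^sub>F n in sequentially. (\<integral>\<omega>. F (Z \<omega>) \<partial>Q) - e < (\<integral>\<omega>. F (Y n \<omega>) \<partial>P)"
      using C by (intro lower[OF F _ e])
    ultimately have "\<forall>\<^sub>F n in sequentially. norm ((\<integral>\<omega>. F (Y n \<omega>) \<partial>P) - (\<integral>\<omega>. F (Z \<omega>) \<partial>Q)) < e"
      by eventually_elim (auto simp: abs_less_iff)
    then show "\<exists>n0. \<forall>n\<ge>n0. norm ((\<integral>\<omega>. F (Y n \<omega>) \<partial>P) - (\<integral>\<omega>. F (Z \<omega>) \<partial>Q)) < e"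
      by (simp add: eventually_sequentially)
  qed
  then show ?thesis unfolding converges_in_distribution_def using Y Z by auto
qed

text \<open>An open set is the positivity set of the distance \<open>D\<close> to its complement,
  and \<open>D\<close> is Lipschitz, so measurability passes to pointwise limits through real
  functions. This is how Brownian paths become random elements of the Skorokhod space: they are
  limits of step paths.\<close>

lemma measurable_borel_of_limit:
  assumes Y: "\<And>k. Y k \<in> P \<rightarrow>\<^sub>M borel_of mtopology" and Z: "\<And>\<omega>. \<omega> \<in> space P \<Longrightarrow> Z \<omega> \<in> M"
    and lim: "\<And>\<omega>. \<omega> \<in> space P \<Longrightarrow> (\<lambda>k. d (Y k \<omega>) (Z \<omega>)) \<longlonglongrightarrow> 0"
  shows "Z \<in> P \<rightarrow>\<^sub>M borel_of mtopology"
proof (rule measurable_to_borel_of)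
  fix U assume U: "openin mtopology U"
  have YM: "Y n \<omega> \<in> M" if "\<omega> \<in> space P" for n \<omega> using measurable_space[OF Y that] by simp
  show "Z -` U \<inter> space P \<in> sets P"
  \<comment> \<open>With empty complement the infimum defining \<open>D\<close> would range over the
    empty set.\<close>
  proof (cases "M - U = {}")
    case True
    then have "Z -` U \<inter> space P = space P" using Z by auto
    then show ?thesis by simp
  next
    case False
    define D where "D x = (INF y\<in>M - U. d x y)" for x
    have bdd: "bdd_below ((\<lambda>y. d x y) ` (M - U))" for x
      by (intro bdd_belowI[of _ 0]) auto
    have D0: "D x \<le> D y + d x y" if xy: "x \<in> M" "y \<in> M" for x y
    proof -
      have "D x - d x y \<le> d y z" if z: "z \<in> M - U" for z
        using triangle[OF xy, of z] z cINF_lower[OF bdd z, of x] by (simp add: D_def)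
      then have "D x - d x y \<le> D y" unfolding D_def[of y] using False by (intro cINF_greatest) auto
      then show ?thesis by simp
    qed
    have D: "\<bar>D x - D y\<bar> \<le> 1 * d x y" if xy: "x \<in> M" "y \<in> M" for x y
      using D0[OF xy] D0[OF xy(2,1)] commute[of x y] by (simp add: abs_le_iff)
    have U_eq: "x \<in> U \<longleftrightarrow> D x > 0" if x: "x \<in> M" for x
    proof
      assume "x \<in> U"
      then obtain r where r: "r > 0" "mball x r \<subseteq> U" using U unfolding openin_mtopology by blast
      have "r \<le> D x"
        unfolding D_def using False r(2) x by (intro cINF_greatest) (auto simp: not_less[symmetric])
      then show "D x > 0" using r by simp
    next
      assume *: "D x > 0"
      show "x \<in> U"
      proof (rule ccontr)
        assume "x \<notin> U"
        then have "D x \<le> d x x" unfolding D_def using x by (intro cINF_lower[OF bdd]) auto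
        then show False using * x by simp
      qed
    qed
    have Dm: "D \<in> borel_measurable (borel_of mtopology)"
      by (rule measurable_borel_of_continuous_map[OF Lipschitz_continuous_map[OF D]])
    have "(\<lambda>\<omega>. D (Z \<omega>)) \<in> borel_measurable P"
    proof (rule borel_measurable_LIMSEQ_real)
      show "(\<lambda>\<omega>. D (Y k \<omega>)) \<in> borel_measurable P" for k by (rule measurable_compose[OF Y Dm])
      show "(\<lambda>k. D (Y k \<omega>)) \<longlonglongrightarrow> D (Z \<omega>)" if "\<omega> \<in> space P" for \<omega>
      proof (rule Lim_null_comparison[THEN LIM_zero_cancel])
        show "\<forall>\<^sub>F k in sequentially. norm (D (Y k \<omega>) - D (Z \<omega>)) \<le> d (Y k \<omega>) (Z \<omega>)"
          using D[OF YM[OF that] Z[OF that]] by simp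
      qed (rule lim[OF that])
    qed
    then have "{\<omega> \<in> space P. D (Z \<omega>) > 0} \<in> sets P" by measurable
    moreover have "Z -` U \<inter> space P = {\<omega> \<in> space P. D (Z \<omega>) > 0}" using U_eq Z by auto
    ultimately show ?thesis by simp
  qed
qed (simp add: Z)

end

section \<open>Step paths and continuous paths in the Skorokhod space\<close>

lemma skorokhod_dist_le_uniform:
  assumes "x \<in> skorokhod_space" "y \<in> skorokhod_space" "\<And>t. t \<in> {0..1} \<Longrightarrow> \<bar>x t - y t\<bar> \<le> e"
  shows "skorokhod_dist x y \<le> e"
proof (rule field_le_epsilon)
  \<comment> \<open>\<open>skorokhod_close\<close> asks for a positive radius, but \<open>e\<close>
    may be 0; hence the slack \<open>r\<close>.\<close>
  fix r :: real assume r: "r > 0"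
  have "0 \<le> e" using assms(3)[of 0] by simp
  then have "skorokhod_close x y (e + r)"
    unfolding skorokhod_close_def using r assms(3) by (intro conjI bexI[OF _ time_changes_id]) (auto
        intro: add_increasing2)
  then show "skorokhod_dist x y \<le> e + r" by (rule skorokhod_dist_le[OF assms(1,2)])
qed

text \<open>Common form of the normalised sums and of Brownian motion sampled on a grid. Only the
  values \<open>v 0, ..., v n\<close> matter, so questions about such paths become questions about
  finite sequences.\<close>

definition step_path :: "nat \<Rightarrow> (nat \<Rightarrow> real) \<Rightarrow> real \<Rightarrow> real" where
  "step_path n v = (\<lambda>t\<in>{0..1}. v (nat \<lfloor>real n * t\<rfloor>))"

lemma step_path_in_skorokhod_space: "step_path n v \<in> skorokhod_space"
proof (cases "n = 0")
  case True
  have "(step_path n v \<longlongrightarrow> step_path n v t) (at_right t)" if "t \<in> {0..<1}" for t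
  proof (rule tendsto_eventually)
    show "\<forall>\<^sub>F s in at_right t. step_path n v s = step_path n v t"
      unfolding eventually_at_right_field using that True by (intro exI[of _ 1]) (auto simp: step_path_def)
  qed
  moreover have "\<exists>l. (step_path n v \<longlongrightarrow> l) (at_left t)" if "t \<in> {0<..1}" for t
  proof (rule exI, rule tendsto_eventually)
    show "\<forall>\<^sub>F s in at_left t. step_path n v s = v 0"
      unfolding eventually_at_left_field using that True by (intro exI[of _ 0]) (auto simp: step_path_def)
  qed
  moreover have "step_path n v \<in> extensional {0..1}" by (simp add: step_path_def)
  ultimately show ?thesis unfolding skorokhod_space_def by simp
next
  case False
  then have n: "real n > 0" by simp
  have "(step_path n v \<longlongrightarrow> step_path n v t) (at_right t)" if t: "t \<in> {0..<1}" for t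
  proof (rule tendsto_eventually)
    \<comment> \<open>The next jump time after \<open>t\<close>, capped at 1.\<close>
    define b where "b = min 1 ((of_int \<lfloor>real n * t\<rfloor> + 1) / real n)"
    have "t < b" using t n by (simp add: b_def less_divide_eq mult.commute)
    moreover have "step_path n v s = step_path n v t" if "t < s" "s < b" for s
    proof -
      have "real n * s < of_int \<lfloor>real n * t\<rfloor> + 1" using that n
          by (simp add: b_def less_divide_eq mult.commute)
      moreover have "real n * t \<le> real n * s" using that n by simp
      ultimately have "\<lfloor>real n * s\<rfloor> = \<lfloor>real n * t\<rfloor>" by linarith
      then show ?thesis using that t by (auto simp: step_path_def b_def)
    qed
    ultimately show "\<forall>\<^sub>F s in at_right t. step_path n v s = step_path n v t"
      unfolding eventually_at_right_field by blast
  qed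
  moreover have "\<exists>l. (step_path n v \<longlongrightarrow> l) (at_left t)" if t: "t \<in> {0<..1}" for t
  proof (rule exI, rule tendsto_eventually)
    \<comment> \<open>The last jump time strictly before \<open>t\<close>: the ceiling minus 1
      differs from the floor exactly when \<open>t\<close> is itself of the form
      \<open>k / n\<close>.\<close>
    define b where "b = max 0 ((of_int \<lceil>real n * t\<rceil> - 1) / real n)"
    have "of_int \<lceil>real n * t\<rceil> - 1 < real n * t" by linarith
    then have "b < t" using t n by (simp add: b_def divide_less_eq mult.commute)
    moreover have "step_path n v s = v (nat (\<lceil>real n * t\<rceil> - 1))" if "b < s" "s < t" for s
    proof -
      have "of_int \<lceil>real n * t\<rceil> - 1 < real n * s" using that n
          by (simp add: b_def divide_less_eq mult.commute)
      moreover have "real n * s < real n * t" using that n by simp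
      ultimately have "\<lfloor>real n * s\<rfloor> = \<lceil>real n * t\<rceil> - 1" by linarith
      then show ?thesis using that t by (auto simp: step_path_def b_def)
    qed
    ultimately show "\<forall>\<^sub>F s in at_left t. step_path n v s = v (nat (\<lceil>real n * t\<rceil> - 1))"
      unfolding eventually_at_left_field by blast
  qed
  ultimately show ?thesis by (auto simp: skorokhod_space_def step_path_def)
qed

lemma nat_floor_mult_le:
  assumes "t \<in> {0..1}" shows "nat \<lfloor>real n * t\<rfloor> \<le> n"
proof -
  have "real n * t \<le> real n" using assms by (simp add: mult_left_le)
  then show ?thesis by linarith
qed

lemma skorokhod_dist_step_path_le:
  assumes "\<And>k. k \<le> n \<Longrightarrow> \<bar>v k - w k\<bar> \<le> e"
  shows "skorokhod_dist (step_path n v) (step_path n w) \<le> e"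
  using assms nat_floor_mult_le[of _ n]
  by (intro skorokhod_dist_le_uniform step_path_in_skorokhod_space) (auto simp: step_path_def)

text \<open>The path depends continuously on its sequence of values in the product topology, because
  the largest of the finitely many differences dominates the Skorokhod distance. Measurability thus
  reduces to that of the coordinates.\<close>

lemma measurable_step_path:
  assumes V: "\<And>k. V k \<in> borel_measurable M"
  shows "(\<lambda>\<omega>. step_path n (\<lambda>k. V k \<omega>)) \<in> M \<rightarrow>\<^sub>M borel_of skorokhod_topology"
proof (rule measurable_to_borel_of)
  fix U assume U: "openin skorokhod_topology U"
  have "open {v :: nat \<Rightarrow> real. step_path n v \<in> U}"
  proof (subst openin_subopen[of euclidean, unfolded open_openin[symmetric]], intro ballI)
    fix v assume "v \<in> {v. step_path n v \<in> U}"
    then obtain r where r: "r > 0" "skorokhod.mball (step_path n v) r \<subseteq> U"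
      using U unfolding skorokhod.openin_mtopology by blast
    define T where "T = {w. \<forall>k\<in>{..n}. w k \<in> ball (v k) (r / 2)}"
    have "open T" unfolding T_def
      using product_topology_basis'[of "{..n}" "\<lambda>k. ball (v k) (r / 2)" "\<lambda>k. k"] by simp
    moreover have "v \<in> T" using r by (simp add: T_def)
    moreover have "T \<subseteq> {v. step_path n v \<in> U}"
    proof
      fix w assume "w \<in> T"
      then have "skorokhod_dist (step_path n v) (step_path n w) \<le> r / 2"
        by (intro skorokhod_dist_step_path_le) (auto simp: T_def dist_real_def less_imp_le)
      then show "w \<in> {v. step_path n v \<in> U}" using r by (auto simp: step_path_in_skorokhod_space)
    qed
    ultimately show "\<exists>T. open T \<and> v \<in> T \<and> T \<subseteq> {v. step_path n v \<in> U}" by blast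
  qed
  moreover have "(\<lambda>\<omega> k. V k \<omega>) \<in> M \<rightarrow>\<^sub>M borel"
    by (rule measurable_coordinatewise_then_product) (rule V)
  ultimately have "(\<lambda>\<omega> k. V k \<omega>) -` {v. step_path n v \<in> U} \<inter> space M \<in> sets M"
    by (intro measurable_sets) auto
  then show "(\<lambda>\<omega>. step_path n (\<lambda>k. V k \<omega>)) -` U \<inter> space M \<in> sets M"
    by (simp add: vimage_def)
qed (simp add: step_path_in_skorokhod_space)

lemma sample_path_continuous_in_skorokhod_space:
  assumes "continuous_on {0..1} (\<lambda>t. B t \<omega>)"
  shows "sample_path B \<omega> \<in> skorokhod_space"
proof -
  have c: "continuous_on {0..1} (sample_path B \<omega>)"
    using assms by (rule continuous_on_eq) (simp add: sample_path_def)
  have "(sample_path B \<omega> \<longlongrightarrow> sample_path B \<omega> t) (at_right t)" if "t \<in> {0..<1}" for t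
  proof -
    have "(sample_path B \<omega> \<longlongrightarrow> sample_path B \<omega> t) (at t within {0..1})"
      using c that by (auto simp: continuous_on_def)
    then have "(sample_path B \<omega> \<longlongrightarrow> sample_path B \<omega> t) (at t within {t<..<1})"
      by (rule tendsto_within_subset) (use that in auto)
    moreover have "at t within {t<..<1} = at_right t"
      by (rule at_within_nhd[of t "{..<1}"]) (use that in auto)
    ultimately show ?thesis by simp
  qed
  moreover have "\<exists>l. (sample_path B \<omega> \<longlongrightarrow> l) (at_left t)" if "t \<in> {0<..1}" for t
  proof -
    have "(sample_path B \<omega> \<longlongrightarrow> sample_path B \<omega> t) (at t within {0..1})"
      using c that by (auto simp: continuous_on_def)
    then have "(sample_path B \<omega> \<longlongrightarrow> sample_path B \<omega> t) (at t within {0<..<t})"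
      by (rule tendsto_within_subset) (use that in auto)
    moreover have "at t within {0<..<t} = at_left t"
      by (rule at_within_nhd[of t "{0<..}"]) (use that in auto)
    ultimately show ?thesis by auto
  qed
  moreover have "sample_path B \<omega> \<in> extensional {0..1}" by (simp add: sample_path_def)
  ultimately show ?thesis unfolding skorokhod_space_def by simp
qed

lemma step_path_approx_continuous:
  assumes "continuous_on {0..1} (\<lambda>t. B t \<omega>)"
  shows "(\<lambda>K. skorokhod_dist (step_path K (\<lambda>i. B (real i / real K) \<omega>)) (sample_path B \<omega>)) \<longlonglongrightarrow> 0"
proof (rule LIMSEQ_I)
  fix e :: real assume e: "e > 0"
  have "uniformly_continuous_on {0..1} (\<lambda>t. B t \<omega>)"
    by (rule compact_uniformly_continuous[OF assms]) simp
  then obtain r where r: "r > 0" "\<And>s t. s \<in> {0..1} \<Longrightarrow> t \<in> {0..1} \<Longrightarrow> \<bar>s - t\<bar> < r \<Longrightarrow> \<bar>B s \<omega> - B t \<omega>\<bar> < e / 2"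
    unfolding uniformly_continuous_on_def dist_real_def using e by (metis half_gt_zero)
  obtain K0 :: nat where K0: "1 / real (Suc K0) < r" using r(1) nat_approx_posE by blast
  have "norm (skorokhod_dist (step_path K (\<lambda>i. B (real i / real K) \<omega>)) (sample_path B \<omega>) - 0) < e"
    if K: "K \<ge> Suc K0" for K
  proof -
    have "1 / real K \<le> 1 / real (Suc K0)" using K by (intro divide_left_mono) auto
    then have Kr: "1 / real K < r" using K0 by simp
    have Kp: "real K > 0" using K by simp
    have "skorokhod_dist (step_path K (\<lambda>i. B (real i / real K) \<omega>)) (sample_path B \<omega>) \<le> e / 2"
    proof (rule skorokhod_dist_le_uniform[OF step_path_in_skorokhod_space
        sample_path_continuous_in_skorokhod_space[of B, OF assms]])
      fix t :: real assume t: "t \<in> {0..1}"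
      define i where "i = nat \<lfloor>real K * t\<rfloor>"
      have "real i \<le> real K * t" "real K * t < real i + 1" using t Kp by (auto simp: i_def)
      then have i: "real i / real K \<le> t" "t < real i / real K + 1 / real K"
        using Kp by (auto simp: field_simps)
      have "real i / real K \<in> {0..1}" using i t by auto
      then have "\<bar>B (real i / real K) \<omega> - B t \<omega>\<bar> < e / 2"
        using i Kr t by (intro r(2)) auto
      then show "\<bar>step_path K (\<lambda>i. B (real i / real K) \<omega>) t - sample_path B \<omega> t\<bar> \<le> e / 2"
        using t by (simp add: step_path_def sample_path_def i_def)
    qed
    then show ?thesis using e skorokhod_dist_nonneg[of "step_path K (\<lambda>i. B (real i / real K) \<omega>)"
        "sample_path B \<omega>"] by simp
  qed
  then show "\<exists>K0. \<forall>K\<ge>K0. norm (skorokhod_dist (step_path K (\<lambda>i. B (real i / real K) \<omega>)) (sample_path B \<omega>)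
      - 0) < e"
    by blast
qed

section \<open>From products of one-variable functions to Lipschitz functions of several
  variables\<close>

definition ramp :: "real \<Rightarrow> real" where "ramp z = max 0 (min 1 z)"

lemma continuous_on_ramp [continuous_intros]:
  "continuous_on S f \<Longrightarrow> continuous_on S (\<lambda>x. ramp (f x))"
  unfolding ramp_def by (intro continuous_intros)

lemma ramp_mono: "x \<le> y \<Longrightarrow> ramp x \<le> ramp y" by (auto simp: ramp_def)

text \<open>A partition of unity on the line: the hats telescope.\<close>

definition hat :: "nat \<Rightarrow> real \<Rightarrow> real" where
  "hat i z = ramp (z + 1 - real i) - ramp (z - real i)"

lemma hat_nonneg: "0 \<le> hat i z" by (simp add: hat_def ramp_mono)

lemma hat_nonzero: "hat i z \<noteq> 0 \<Longrightarrow> \<bar>z - real i\<bar> < 1"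
  by (auto simp: hat_def ramp_def max_def min_def split: if_splits)

lemma sum_hat: "(\<Sum>i<m. hat i z) = ramp (z + 1) - ramp (z + 1 - real m)"
  by (induction m) (auto simp: hat_def algebra_simps)

lemma sum_hat_le_1: "(\<Sum>i<m. hat i z) \<le> 1"
  unfolding sum_hat by (auto simp: ramp_def)

text \<open>Induction over the coordinates: the dependence of \<open>G\<close> on one coordinate is
  replaced by piecewise linear interpolation between grid nodes. This turns \<open>G\<close> into a
  finite sum of products of a hat function and a function of the remaining coordinates, and the hat
  joins the product of one-variable functions.\<close>

lemma tensor_convergence:
  fixes P :: "'a measure" and Q :: "'b measure" and x :: "nat \<Rightarrow> 'a \<Rightarrow> nat \<Rightarrow> real" and y :: "'b \<Rightarrow> nat \<Rightarrow> real"
  assumes P: "prob_space P" and Q: "prob_space Q"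
    and x[measurable]: "\<And>n j. (\<lambda>\<omega>. x n \<omega> j) \<in> borel_measurable P"
        and y[measurable]: "\<And>j. (\<lambda>\<omega>. y \<omega> j) \<in> borel_measurable Q"
    and tensor: "\<And>\<phi> :: nat \<Rightarrow> real \<Rightarrow> real. (\<And>i. continuous_on UNIV (\<phi> i)) \<Longrightarrow> (\<And>i z. \<bar>\<phi> i z\<bar> \<le> 1) \<Longrightarrow>
       (\<lambda>n. \<integral>\<omega>. (\<Prod>i<K. \<phi> i (x n \<omega> i)) \<partial>P) \<longlonglongrightarrow> (\<integral>\<omega>. (\<Prod>i<K. \<phi> i (y \<omega> i)) \<partial>Q)"
    and bdd: "\<And>u. \<bar>G u\<bar> \<le> C" and lip: "\<And>u v. \<bar>G u - G v\<bar> \<le> L * (\<Sum>j<K. \<bar>u j - v j\<bar>)" and L: "L \<ge> 0"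
    and G: "G \<in> borel_measurable borel"
  shows "(\<lambda>n. \<integral>\<omega>. G (x n \<omega>) \<partial>P) \<longlonglongrightarrow> (\<integral>\<omega>. G (y \<omega>) \<partial>Q)"
proof -
  interpret P: prob_space P by fact
  interpret Q: prob_space Q by fact
  have C: "C \<ge> 0" using bdd[of "\<lambda>_. 0"] by linarith
  have xm: "x n \<in> P \<rightarrow>\<^sub>M borel" for n by (rule measurable_coordinatewise_then_product) (rule x)
  have ym: "y \<in> Q \<rightarrow>\<^sub>M borel" by (rule measurable_coordinatewise_then_product) (rule y)
  \<comment> \<open>Induction statement: \<open>G\<close> depends on the coordinates below
    \<open>j\<close>, the others are already separated into a product.\<close>
  have "(\<lambda>n. \<integral>\<omega>. G (x n \<omega>) * (\<Prod>i\<in>{j..<K}. \<phi> i (x n \<omega> i)) \<partial>P) \<longlonglongrightarrow> (\<integral>\<omega>. G (y \<omega>) * (\<Prod>i\<in>{j..<K}. \<phi> i (y \<omega> i)) \<partial>Q)"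
    if "j \<le> K" "\<And>i. continuous_on UNIV (\<phi> i)" "\<And>i z. \<bar>\<phi> i z\<bar> \<le> 1"
      "\<And>u. \<bar>G u\<bar> \<le> C" "\<And>u v. \<bar>G u - G v\<bar> \<le> L * (\<Sum>i<j. \<bar>u i - v i\<bar>)" "G \<in> borel_measurable borel"
    for j G and \<phi> :: "nat \<Rightarrow> real \<Rightarrow> real"
    using that
  proof (induction j arbitrary: G \<phi>)
    case 0
    have "G u = G (\<lambda>_. 0)" for u using 0(5)[of u "\<lambda>_. 0"] by simp
    then have "(\<lambda>u. G u) = (\<lambda>_. G (\<lambda>_. 0))" by blast
    then obtain g where g: "\<And>u. G u = g" by metis
    show ?case unfolding g using tensor[OF 0(2,3)]
      by (auto simp: atLeast0LessThan intro: tendsto_mult_left)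
  next
    case (Suc j G \<phi>)
    note [measurable] = Suc.prems(6) xm ym
    have \<phi>m[measurable]: "\<phi> i \<in> borel_measurable borel" for i
      by (rule borel_measurable_continuous_onI) (rule Suc.prems)
    define R where "R = (\<lambda>u :: nat \<Rightarrow> real. \<Prod>i\<in>{Suc j..<K}. \<phi> i (u i))"
    have Rb: "\<bar>R u\<bar> \<le> 1" for u unfolding R_def abs_prod using Suc.prems by (intro prod_le_1) auto
    have R_split: "(\<Prod>i\<in>{j..<K}. \<psi> i (u i)) = \<psi> j (u j) * R u" if "\<And>i. i > j \<Longrightarrow> \<psi> i = \<phi> i" for \<psi> u
      unfolding R_def using Suc.prems(1) that by (subst prod.atLeast_Suc_lessThan) auto
    have Rm[measurable]: "(\<lambda>\<omega>. R (x n \<omega>)) \<in> borel_measurable P" "(\<lambda>\<omega>. R (y \<omega>)) \<in> borel_measurable Q" for n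
      unfolding R_def by measurable
    define I where "I n = (\<integral>\<omega>. G (x n \<omega>) * R (x n \<omega>) \<partial>P)" for n
    define J where "J = (\<integral>\<omega>. G (y \<omega>) * R (y \<omega>) \<partial>Q)"
    have "\<forall>\<^sub>F n in sequentially. \<bar>I n - J\<bar> < e" if e: "e > 0" for e
    proof -
      \<comment> \<open>Mesh width: moving one coordinate by at most \<open>h\<close> changes
        \<open>G\<close> by at most \<open>e / 8\<close>; \<open>L + 1\<close> allows
        \<open>L = 0\<close>.\<close>
      define h where "h = e / (8 * (L + 1))"
      have h: "h > 0" "L * h \<le> e / 8" using e L by (auto simp: h_def field_simps mult_left_mono)
      \<comment> \<open>The nodes run from \<open>- h * N\<close> to \<open>h * (N + 1)\<close>;
        their hats add up to 1 between \<open>- h * N\<close> and \<open>h * N\<close>.\<close>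
      define m :: "nat \<Rightarrow> nat" where "m N = 2 * N + 2" for N
      define W where "W N z = (\<Sum>i<m N. hat i (z / h + real N))" for N z
      have Wm[measurable]: "W N \<in> borel_measurable borel" for N
        unfolding W_def hat_def by (intro borel_measurable_continuous_onI continuous_intros) (use h in auto)
      have W01: "0 \<le> W N z" "W N z \<le> 1" for N z
        unfolding W_def by (auto intro!: sum_nonneg hat_nonneg sum_hat_le_1)
      have Wlim: "(\<lambda>N. W N z) \<longlonglongrightarrow> 1" for z
      proof (rule tendsto_eventually)
        obtain N0 :: nat where N0: "\<bar>z / h\<bar> \<le> real N0" using real_arch_simple by blast
        have "W N z = 1" if "N \<ge> N0" for N
        proof -
          have "\<bar>z / h\<bar> \<le> real N" using N0 that by linarith
          then have "z / h \<le> real N" "- real N \<le> z / h" by linarith+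
          then show ?thesis unfolding W_def sum_hat by (auto simp: m_def ramp_def max_def min_def)
        qed
        then show "\<forall>\<^sub>F N in sequentially. W N z = 1" using eventually_sequentially by blast
      qed
      \<comment> \<open>\<open>N\<close> is chosen for the limit \<open>y\<close> alone. Since
        \<open>W N\<close> is itself an admissible one-variable function, the same mass bound
        reaches \<open>x n\<close> for large \<open>n\<close>.\<close>
      have "(\<lambda>N. \<integral>\<omega>. W N (y \<omega> j) \<partial>Q) \<longlonglongrightarrow> (\<integral>\<omega>. 1 \<partial>Q)"
        by (rule integral_dominated_convergence[where w = "\<lambda>_. 1"]) (auto simp: Wlim W01)
      then have "\<forall>\<^sub>F N in sequentially. (\<integral>\<omega>. W N (y \<omega> j) \<partial>Q) > 1 - e / (8 * (C + 1))"
        using e C by (intro order_tendstoD(1)) (auto simp: Q.prob_space)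
      then obtain N where N: "(\<integral>\<omega>. W N (y \<omega> j) \<partial>Q) > 1 - e / (8 * (C + 1))"
        by (auto simp: eventually_sequentially)
      have CW: "C * (1 - w) \<le> e / 8" if "w > 1 - e / (8 * (C + 1))" for w
      proof -
        have "C * (1 - w) \<le> C * (e / (8 * (C + 1)))" using that C by (intro mult_left_mono) auto
        also have "\<dots> \<le> (C + 1) * (e / (8 * (C + 1)))" using C e by (intro mult_right_mono) auto
        also have "\<dots> = e / 8" using C by (simp add: divide_simps)
        finally show ?thesis .
      qed
      \<comment> \<open>\<open>G\<close> with coordinate \<open>j\<close> frozen at node
        \<open>i\<close>. It depends on the coordinates below \<open>j\<close> only, so the
        induction hypothesis covers it.\<close>
      define H where "H i u = G (u(j := h * (real i - real N)))" for i and u :: "nat \<Rightarrow> real"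
      define A where "A u = (\<Sum>i<m N. hat i (u j / h + real N) * H i u)" for u :: "nat \<Rightarrow> real"
      have updm: "(\<lambda>u. u(j := c)) \<in> borel \<rightarrow>\<^sub>M borel" for c :: real
        by (rule measurable_coordinatewise_then_product) (auto simp: fun_upd_def)
      have Hm[measurable]: "H i \<in> borel_measurable borel" for i
        unfolding H_def by (rule measurable_compose[OF updm Suc.prems(6)])
      have approx: "\<bar>G u * R u - A u * R u\<bar> \<le> e / 8 + C * (1 - W N (u j))" for u
      proof -
        have "\<bar>G u - A u\<bar> \<le> L * h + C * (1 - W N (u j))"
        proof -
          have "G u - A u = (\<Sum>i<m N. hat i (u j / h + real N) * (G u - H i u)) + G u * (1 - W N (u j))"
            unfolding A_def W_def by (simp add: right_diff_distrib left_diff_distrib sum_subtractf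
                sum_distrib_left mult.commute)
          moreover have "\<bar>\<Sum>i<m N. hat i (u j / h + real N) * (G u - H i u)\<bar> \<le> (\<Sum>i<m N. hat i (u j / h +
              real N) * (L * h))"
          proof (rule order_trans[OF sum_abs sum_mono])
            fix i
            show "\<bar>hat i (u j / h + real N) * (G u - H i u)\<bar> \<le> hat i (u j / h + real N) * (L * h)"
            proof (cases "hat i (u j / h + real N) = 0")
              case False
              then have "\<bar>u j / h + real N - real i\<bar> < 1" by (rule hat_nonzero)
              then have "h * \<bar>u j / h + real N - real i\<bar> \<le> h * 1" using h by (intro mult_left_mono) auto
              moreover have "u j - h * (real i - real N) = h * (u j / h + real N - real i)"
                using h by (simp add: right_diff_distrib distrib_left)
              ultimately have d: "\<bar>u j - h * (real i - real N)\<bar> \<le> h"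
                using h by (simp add: abs_mult)
              have "\<bar>G u - H i u\<bar> \<le> L * (\<Sum>k<Suc j. \<bar>u k - (u(j := h * (real i - real N))) k\<bar>)"
                unfolding H_def by (rule Suc.prems(5))
              also have "\<dots> \<le> L * h" using d L by (intro mult_left_mono) auto
              finally show ?thesis by (simp add: abs_mult hat_nonneg mult_left_mono)
            qed simp
          qed
          moreover have "(\<Sum>i<m N. hat i (u j / h + real N) * (L * h)) \<le> 1 * (L * h)"
            unfolding sum_distrib_right[symmetric] using L h by (intro mult_right_mono sum_hat_le_1) auto
          moreover have "\<bar>G u * (1 - W N (u j))\<bar> \<le> C * (1 - W N (u j))"
            unfolding abs_mult using Suc.prems(4)[of u] W01[of N "u j"] by (intro mult_mono) auto
          ultimately show ?thesis by linarith
        qed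
        also have "\<dots> \<le> e / 8 + C * (1 - W N (u j))" using h by simp
        finally have "\<bar>G u - A u\<bar> * \<bar>R u\<bar> \<le> (e / 8 + C * (1 - W N (u j))) * 1"
          using Rb by (intro mult_mono) auto
        then show ?thesis by (simp add: abs_mult[symmetric] left_diff_distrib)
      qed
      have Hb: "\<bar>H i u\<bar> \<le> C" for i u unfolding H_def by (rule Suc.prems)
      have hatb: "\<bar>hat i z\<bar> \<le> 1" for i z by (auto simp: hat_def ramp_def)
      have hatm[measurable]: "hat i \<in> borel_measurable borel" for i
        unfolding hat_def by (intro borel_measurable_continuous_onI continuous_intros)
      have hH: "\<bar>hat i z * H i u * R u\<bar> \<le> C" for i z u
      proof -
        have "\<bar>hat i z * H i u * R u\<bar> \<le> 1 * C * 1" unfolding abs_mult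
          using hatb Hb Rb C by (intro mult_mono) (auto intro: mult_nonneg_nonneg)
        then show ?thesis by simp
      qed
      have AI: "(\<integral>\<omega>. A (x n \<omega>) * R (x n \<omega>) \<partial>P) =
          (\<Sum>i<m N. \<integral>\<omega>. hat i (x n \<omega> j / h + real N) * H i (x n \<omega>) * R (x n \<omega>) \<partial>P)" for n
        unfolding A_def sum_distrib_right
        by (rule Bochner_Integration.integral_sum, rule P.integrable_const_bound[of _ C]) (auto intro: hH)
      have AJ: "(\<integral>\<omega>. A (y \<omega>) * R (y \<omega>) \<partial>Q) =
          (\<Sum>i<m N. \<integral>\<omega>. hat i (y \<omega> j / h + real N) * H i (y \<omega>) * R (y \<omega>) \<partial>Q)"
        unfolding A_def sum_distrib_right
        by (rule Bochner_Integration.integral_sum, rule Q.integrable_const_bound[of _ C]) (auto intro: hH)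
      have "(\<lambda>n. \<integral>\<omega>. hat i (x n \<omega> j / h + real N) * H i (x n \<omega>) * R (x n \<omega>) \<partial>P) \<longlonglongrightarrow>
          (\<integral>\<omega>. hat i (y \<omega> j / h + real N) * H i (y \<omega>) * R (y \<omega>) \<partial>Q)" for i
      proof -
        \<comment> \<open>The hat occupies slot \<open>j\<close> of the product, which was free so
          far.\<close>
        define \<psi> where "\<psi> = \<phi>(j := \<lambda>z. hat i (z / h + real N))"
        have "continuous_on UNIV (\<psi> k)" for k
          unfolding \<psi>_def hat_def using h Suc.prems(2) by (auto intro!: continuous_intros)
        moreover have "\<bar>\<psi> k z\<bar> \<le> 1" for k z unfolding \<psi>_def using Suc.prems(3) hatb by simp
        moreover have "\<bar>H i u - H i v\<bar> \<le> L * (\<Sum>k<j. \<bar>u k - v k\<bar>)" for u v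
        proof -
          have "(\<Sum>k<Suc j. \<bar>(u(j := h * (real i - real N))) k - (v(j := h * (real i - real N))) k\<bar>) =
              (\<Sum>k<j. \<bar>u k - v k\<bar>)"
            by simp
          then show ?thesis
            using Suc.prems(5)[of "u(j := h * (real i - real N))" "v(j := h * (real i - real N))"]
            unfolding H_def by (simp only:)
        qed
        ultimately have "(\<lambda>n. \<integral>\<omega>. H i (x n \<omega>) * (\<Prod>i\<in>{j..<K}. \<psi> i (x n \<omega> i)) \<partial>P) \<longlonglongrightarrow>
            (\<integral>\<omega>. H i (y \<omega>) * (\<Prod>i\<in>{j..<K}. \<psi> i (y \<omega> i)) \<partial>Q)"
          using Suc.prems(1) Hb Hm by (intro Suc.IH) auto
        moreover have "(\<Prod>i\<in>{j..<K}. \<psi> i (u i)) = hat i (u j / h + real N) * R u" for u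
          using R_split[of \<psi> u] by (simp add: \<psi>_def)
        ultimately show ?thesis by (simp add: mult_ac)
      qed
      then have "(\<lambda>n. \<integral>\<omega>. A (x n \<omega>) * R (x n \<omega>) \<partial>P) \<longlonglongrightarrow> (\<integral>\<omega>. A (y \<omega>) * R (y \<omega>) \<partial>Q)"
        unfolding AI AJ by (rule tendsto_sum)
      then have evA: "\<forall>\<^sub>F n in sequentially. dist (\<integral>\<omega>. A (x n \<omega>) * R (x n \<omega>) \<partial>P) (\<integral>\<omega>. A (y \<omega>) * R (y \<omega>)
          \<partial>Q) < e / 8"
        using e by (intro tendstoD) auto
      have "(\<lambda>n. \<integral>\<omega>. W N (x n \<omega> j) \<partial>P) \<longlonglongrightarrow> (\<integral>\<omega>. W N (y \<omega> j) \<partial>Q)"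
      proof -
        define \<psi> where "\<psi> i z = (if i = j then W N z else 1)" for i z
        have "continuous_on UNIV (\<psi> k)" for k
          unfolding \<psi>_def W_def hat_def using h by (cases "k = j") (auto intro!: continuous_intros)
        moreover have "\<bar>\<psi> k z\<bar> \<le> 1" for k z unfolding \<psi>_def using W01[of N z] by simp
        moreover have "(\<Prod>i<K. \<psi> i (u i)) = W N (u j)" for u
          unfolding \<psi>_def using Suc.prems(1) by (subst prod.delta) auto
        ultimately show ?thesis using tensor[of \<psi>] by simp
      qed
      then have "\<forall>\<^sub>F n in sequentially. (\<integral>\<omega>. W N (x n \<omega> j) \<partial>P) > 1 - e / (8 * (C + 1))"
        using N by (intro order_tendstoD(1))
      then show ?thesis using evA
      proof eventually_elim
        case (elim n)
        have Ab: "\<bar>A u\<bar> \<le> real (m N) * C" for u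
        proof -
          have "\<bar>A u\<bar> \<le> (\<Sum>i<m N. 1 * C)" unfolding A_def
            by (rule order_trans[OF sum_abs sum_mono], unfold abs_mult) (intro mult_mono hatb Hb, use C in
                auto)
          then show ?thesis by simp
        qed
        have ARb: "\<bar>A u * R u\<bar> \<le> real (m N) * C" for u
        proof -
          have "\<bar>A u\<bar> * \<bar>R u\<bar> \<le> real (m N) * C * 1" using Ab Rb C by (intro mult_mono) auto
          then show ?thesis by (simp add: abs_mult)
        qed
        have GRb: "\<bar>G u * R u\<bar> \<le> C" for u
        proof -
          have "\<bar>G u\<bar> * \<bar>R u\<bar> \<le> C * 1" using Suc.prems(4) Rb C by (intro mult_mono) auto
          then show ?thesis by (simp add: abs_mult)
        qed
        have GRC: "\<bar>G u * R u\<bar> \<le> real (m N) * C + C" for u using GRb[of u] C by (simp add: add_increasing)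
        have ARC: "\<bar>A u * R u\<bar> \<le> real (m N) * C + C" for u using ARb[of u] C by linarith
        have Am[measurable]: "A \<in> borel_measurable borel"
          unfolding A_def by measurable
        have "\<bar>I n - (\<integral>\<omega>. A (x n \<omega>) * R (x n \<omega>) \<partial>P)\<bar> \<le> (\<integral>\<omega>. e / 8 + C * (1 - W N (x n \<omega> j)) \<partial>P)"
        proof -
          have i: "integrable P (\<lambda>\<omega>. G (x n \<omega>) * R (x n \<omega>))" "integrable P (\<lambda>\<omega>. A (x n \<omega>) * R (x n \<omega>))"
            by (auto intro!: P.integrable_const_bound[of _ "real (m N) * C + C"] GRC ARC)
          have w: "integrable P (\<lambda>\<omega>. W N (x n \<omega> j))"
            by (rule P.integrable_const_bound[of _ 1]) (use W01 in auto)
          show ?thesis unfolding I_def Bochner_Integration.integral_diff[OF i, symmetric]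
            by (rule order_trans[OF integral_abs_bound integral_mono])
              (use i w approx in \<open>auto intro!: integrable_abs\<close>)
        qed
        also have "\<dots> = e / 8 + C * (1 - (\<integral>\<omega>. W N (x n \<omega> j) \<partial>P))"
        proof -
          have w: "integrable P (\<lambda>\<omega>. W N (x n \<omega> j))"
            by (rule P.integrable_const_bound[of _ 1]) (use W01 in auto)
          then show ?thesis by (simp add: P.prob_space)
        qed
        finally have 1: "\<bar>I n - (\<integral>\<omega>. A (x n \<omega>) * R (x n \<omega>) \<partial>P)\<bar> \<le> e / 4"
          using CW[OF elim(1)] by simp
        have "\<bar>J - (\<integral>\<omega>. A (y \<omega>) * R (y \<omega>) \<partial>Q)\<bar> \<le> (\<integral>\<omega>. e / 8 + C * (1 - W N (y \<omega> j)) \<partial>Q)"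
        proof -
          have i: "integrable Q (\<lambda>\<omega>. G (y \<omega>) * R (y \<omega>))" "integrable Q (\<lambda>\<omega>. A (y \<omega>) * R (y \<omega>))"
            by (auto intro!: Q.integrable_const_bound[of _ "real (m N) * C + C"] GRC ARC)
          have w: "integrable Q (\<lambda>\<omega>. W N (y \<omega> j))"
            by (rule Q.integrable_const_bound[of _ 1]) (use W01 in auto)
          show ?thesis unfolding J_def Bochner_Integration.integral_diff[OF i, symmetric]
            by (rule order_trans[OF integral_abs_bound integral_mono])
              (use i w approx in \<open>auto intro!: integrable_abs\<close>)
        qed
        also have "\<dots> = e / 8 + C * (1 - (\<integral>\<omega>. W N (y \<omega> j) \<partial>Q))"
        proof -
          have w: "integrable Q (\<lambda>\<omega>. W N (y \<omega> j))"
            by (rule Q.integrable_const_bound[of _ 1]) (use W01 in auto)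
          then show ?thesis by (simp add: Q.prob_space)
        qed
        finally have 2: "\<bar>J - (\<integral>\<omega>. A (y \<omega>) * R (y \<omega>) \<partial>Q)\<bar> \<le> e / 4"
          using CW[OF N] by simp
        show ?case using 1 2 elim(2) e unfolding dist_real_def by linarith
      qed
    qed
    then have "I \<longlonglongrightarrow> J" by (intro tendstoI) (simp add: dist_real_def)
    then show ?case by (simp only: I_def[abs_def] J_def R_def)
  qed
  \<comment> \<open>For \<open>j = K\<close> the product is empty.\<close>
  from this[of K "\<lambda>_ _. 1" G] show ?thesis using bdd lip G by auto
qed

text \<open>Four objects are compared: the path of \<open>s\<close>, the martingale sampled at
  \<open>K\<close> times, Brownian motion sampled at the same times, and its continuous path.
  \<open>rem\<close> and \<open>osc\<close> give the first comparison in uniform distance,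
  \<open>fdd\<close> the second for fixed \<open>K\<close>, path continuity the third.
  \<open>K\<close> is fixed before \<open>n\<close> tends to infinity.\<close>

lemma functional_clt_criterion:
  fixes P :: "'a measure" and Q :: "'b measure" and s mart :: "nat \<Rightarrow> nat \<Rightarrow> 'a \<Rightarrow> real"
      and B :: "real \<Rightarrow> 'b \<Rightarrow> real"
  assumes P: "prob_space P" and BM: "standard_brownian_motion Q B"
    and s[measurable]: "\<And>n k. s n k \<in> borel_measurable P"
    and mart[measurable]: "\<And>n k. mart n k \<in> borel_measurable P"
    and mart_0: "\<And>n \<omega>. mart n 0 \<omega> = 0"
    and fdd: "\<And>K \<phi> :: nat \<Rightarrow> real \<Rightarrow> real. K \<ge> 1 \<Longrightarrow> (\<And>i. continuous_on UNIV (\<phi> i)) \<Longrightarrow> (\<And>i z. \<bar>\<phi> i z\<bar> \<le> 1) \<Longrightarrow>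
       (\<lambda>n. \<integral>\<omega>. (\<Prod>i<K. \<phi> i (mart n (n * Suc i div K) \<omega> - mart n (n * i div K) \<omega>)) \<partial>P) \<longlonglongrightarrow>
       (\<integral>\<omega>. (\<Prod>i<K. \<phi> i (B (real (Suc i) / real K) \<omega> - B (real i / real K) \<omega>)) \<partial>Q)"
    and osc: "\<And>e \<eta>. e > 0 \<Longrightarrow> \<eta> > 0 \<Longrightarrow> \<exists>K0. \<forall>K\<ge>K0. \<forall>\<^sub>F n in sequentially.
       measure P {\<omega> \<in> space P. \<exists>i<K. \<exists>k\<in>{n * i div K..n * Suc i div K}. e < \<bar>mart n k \<omega> - mart n (n * i
           div K) \<omega>\<bar>} < \<eta>"
    and rem: "\<And>e. e > 0 \<Longrightarrow> (\<lambda>n. measure P {\<omega> \<in> space P. \<exists>k\<le>n. e < \<bar>s n k \<omega> - mart n k \<omega>\<bar>}) \<longlonglongrightarrow> 0"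
  shows "converges_in_distribution skorokhod_topology P (\<lambda>n \<omega>. step_path n (\<lambda>k. s n k \<omega>)) Q (sample_path B)"
proof -
  interpret P: prob_space P by fact
  have Q: "prob_space Q" and Bm: "\<And>t. t \<in> {0..1} \<Longrightarrow> B t \<in> borel_measurable Q"
    and B0: "AE \<omega> in Q. B 0 \<omega> = 0" and Bc: "\<And>\<omega>. \<omega> \<in> space Q \<Longrightarrow> continuous_on {0..1} (\<lambda>t. B t \<omega>)"
    using BM unfolding standard_brownian_motion_def by auto
  interpret Q: prob_space Q by fact
  \<comment> \<open>Indices above \<open>K\<close> are sent to time 0, since \<open>B t\<close> is
    known to be a random variable only for \<open>t\<close> in the unit interval.\<close>
  define B' where "B' K i \<omega> = B (if i \<le> K then real i / real K else 0) \<omega>" for K i \<omega>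
  have B'm[measurable]: "B' K i \<in> borel_measurable Q" for K i
    unfolding B'_def by (rule Bm) (auto simp: divide_le_eq)
  have B'_eq: "step_path K (\<lambda>i. B' K i \<omega>) = step_path K (\<lambda>i. B (real i / real K) \<omega>)" for K \<omega>
    using nat_floor_mult_le[of _ K] by (auto simp: step_path_def B'_def fun_eq_iff)
  have Zlim: "(\<lambda>K. skorokhod_dist (step_path K (\<lambda>i. B' K i \<omega>)) (sample_path B \<omega>)) \<longlonglongrightarrow> 0" if "\<omega> \<in> space Q"
      for \<omega>
    unfolding B'_eq by (rule step_path_approx_continuous[of B, OF Bc[OF that]])
  have Zin: "sample_path B \<omega> \<in> skorokhod_space" if "\<omega> \<in> space Q" for \<omega>
    by (rule sample_path_continuous_in_skorokhod_space[of B, OF Bc[OF that]])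
  have Zm: "sample_path B \<in> Q \<rightarrow>\<^sub>M borel_of skorokhod_topology"
    by (rule skorokhod.measurable_borel_of_limit[OF measurable_step_path[OF B'm] Zin Zlim])
  show ?thesis
  proof (rule skorokhod.converges_in_distribution_LipschitzI[OF P Q measurable_step_path[OF s] Zm])
    fix F L C
    assume lip: "\<And>x y. x \<in> skorokhod_space \<Longrightarrow> y \<in> skorokhod_space \<Longrightarrow> \<bar>F x - F y\<bar> \<le> L * skorokhod_dist x y"
      and C: "\<And>x. x \<in> skorokhod_space \<Longrightarrow> \<bar>F x\<bar> \<le> C" and L: "L \<ge> (0 :: real)"
    have Fm: "F \<in> borel_measurable (borel_of skorokhod_topology)"
      by (rule measurable_borel_of_continuous_map[OF skorokhod.Lipschitz_continuous_map[OF lip]])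
    have C0: "0 \<le> C" using C[OF step_path_in_skorokhod_space[of 0 "\<lambda>_. 0"]] by linarith
    define Y where "Y n \<omega> = step_path n (\<lambda>k. s n k \<omega>)" for n \<omega>
    define X where "X K n \<omega> = step_path K (\<lambda>i. mart n (n * i div K) \<omega>)" for K n \<omega>
    \<comment> \<open>Differences from the starting value, because the functional below sees
      increments only; \<open>B 0 = 0\<close> holds almost surely.\<close>
    define Z where "Z K \<omega> = step_path K (\<lambda>i. B' K i \<omega> - B' K 0 \<omega>)" for K \<omega>
    have FY[measurable]: "(\<lambda>\<omega>. F (Y n \<omega>)) \<in> borel_measurable P" for n
      unfolding Y_def by (rule measurable_compose[OF measurable_step_path[OF s] Fm])
    have FX[measurable]: "(\<lambda>\<omega>. F (X K n \<omega>)) \<in> borel_measurable P" for K n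
      unfolding X_def by (rule measurable_compose[OF measurable_step_path[OF mart] Fm])
    have FZ[measurable]: "(\<lambda>\<omega>. F (Z K \<omega>)) \<in> borel_measurable Q" for K
      unfolding Z_def by (rule measurable_compose[OF measurable_step_path Fm]) measurable
    have YXZ: "Y n \<omega> \<in> skorokhod_space" "X K n \<omega> \<in> skorokhod_space" "Z K \<omega>' \<in> skorokhod_space" for K n \<omega> \<omega>'
      unfolding Y_def X_def Z_def by (rule step_path_in_skorokhod_space)+
    have Zconv: "(\<lambda>K. \<integral>\<omega>. F (Z K \<omega>) \<partial>Q) \<longlonglongrightarrow> (\<integral>\<omega>. F (sample_path B \<omega>) \<partial>Q)"
    proof (rule integral_dominated_convergence[where w = "\<lambda>_. C"])
      show "AE \<omega> in Q. (\<lambda>K. F (Z K \<omega>)) \<longlonglongrightarrow> F (sample_path B \<omega>)"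
        using B0 AE_space
      proof eventually_elim
        case (elim \<omega>)
        have Z: "Z K \<omega> = step_path K (\<lambda>i. B' K i \<omega>)" for K using elim by (simp add: Z_def B'_def)
        have "(\<lambda>K. F (Z K \<omega>) - F (sample_path B \<omega>)) \<longlonglongrightarrow> 0"
        proof (rule Lim_null_comparison)
          show "\<forall>\<^sub>F K in sequentially. norm (F (Z K \<omega>) - F (sample_path B \<omega>)) \<le>
              L * skorokhod_dist (step_path K (\<lambda>i. B' K i \<omega>)) (sample_path B \<omega>)"
            unfolding Z[symmetric] real_norm_def
            by (intro always_eventually allI lip[OF YXZ(3) Zin[OF elim(2)]])
          show "(\<lambda>K. L * skorokhod_dist (step_path K (\<lambda>i. B' K i \<omega>)) (sample_path B \<omega>)) \<longlonglongrightarrow> 0"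
            using tendsto_mult_right_zero[OF Zlim[OF elim(2)]] .
        qed
        then show ?case by (rule LIM_zero_cancel)
      qed
    qed (use C YXZ measurable_compose[OF Zm Fm] in auto)
    have XZ: "(\<lambda>n. \<integral>\<omega>. F (X K n \<omega>) \<partial>P) \<longlonglongrightarrow> (\<integral>\<omega>. F (Z K \<omega>) \<partial>Q)" if K: "K \<ge> 1" for K
    proof -
      \<comment> \<open>As a function of the increments: partial sums are Lipschitz in them with
        constant 1 for the sum of absolute values, so \<open>tensor_convergence\<close>
        applies.\<close>
      define G where "G u = F (step_path K (\<lambda>i. \<Sum>j<i. u j))" for u :: "nat \<Rightarrow> real"
      have "(\<lambda>n. \<integral>\<omega>. G (\<lambda>j. mart n (n * Suc j div K) \<omega> - mart n (n * j div K) \<omega>) \<partial>P) \<longlonglongrightarrow>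
          (\<integral>\<omega>. G (\<lambda>j. B' K (Suc j) \<omega> - B' K j \<omega>) \<partial>Q)"
      proof (rule tensor_convergence[OF P Q, where K = K and C = C and L = L and G = G
          and x = "\<lambda>n \<omega> j. mart n (n * Suc j div K) \<omega> - mart n (n * j div K) \<omega>"
          and y = "\<lambda>\<omega> j. B' K (Suc j) \<omega> - B' K j \<omega>"])
        fix \<phi> :: "nat \<Rightarrow> real \<Rightarrow> real" assume \<phi>: "\<And>i. continuous_on UNIV (\<phi> i)" "\<And>i z. \<bar>\<phi> i z\<bar> \<le> 1"
        have "(\<Prod>i<K. \<phi> i (B (real (Suc i) / real K) \<omega> - B (real i / real K) \<omega>)) =
            (\<Prod>i<K. \<phi> i (B' K (Suc i) \<omega> - B' K i \<omega>))" for \<omega>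
          by (rule prod.cong) (auto simp: B'_def)
        moreover note fdd[of K \<phi>, OF K \<phi>]
        ultimately show "(\<lambda>n. \<integral>\<omega>. (\<Prod>i<K. \<phi> i (mart n (n * Suc i div K) \<omega> - mart n (n * i div K) \<omega>)) \<partial>P) \<longlonglongrightarrow>
            (\<integral>\<omega>. (\<Prod>i<K. \<phi> i (B' K (Suc i) \<omega> - B' K i \<omega>)) \<partial>Q)"
          by (simp only:)
      next
        show "\<bar>G u\<bar> \<le> C" for u unfolding G_def by (intro C step_path_in_skorokhod_space)
      next
        fix u v :: "nat \<Rightarrow> real"
        have "\<bar>G u - G v\<bar> \<le> L * skorokhod_dist (step_path K (\<lambda>i. \<Sum>j<i. u j)) (step_path K (\<lambda>i. \<Sum>j<i. v j))"
          unfolding G_def by (intro lip step_path_in_skorokhod_space)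
        also have "\<dots> \<le> L * (\<Sum>j<K. \<bar>u j - v j\<bar>)"
        proof (intro mult_left_mono skorokhod_dist_step_path_le L)
          fix i assume "i \<le> K"
          have "\<bar>(\<Sum>j<i. u j) - (\<Sum>j<i. v j)\<bar> \<le> (\<Sum>j<i. \<bar>u j - v j\<bar>)"
            unfolding sum_subtractf[symmetric] by (rule sum_abs)
          also have "\<dots> \<le> (\<Sum>j<K. \<bar>u j - v j\<bar>)"
            using \<open>i \<le> K\<close> by (intro sum_mono2) auto
          finally show "\<bar>(\<Sum>j<i. u j) - (\<Sum>j<i. v j)\<bar> \<le> (\<Sum>j<K. \<bar>u j - v j\<bar>)" .
        qed
        finally show "\<bar>G u - G v\<bar> \<le> L * (\<Sum>j<K. \<bar>u j - v j\<bar>)" .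
      next
        have "(\<lambda>u :: nat \<Rightarrow> real. \<Sum>j<i. u j) \<in> borel_measurable borel" for i
          by (intro borel_measurable_sum measurable_product_coordinates)
        then show "G \<in> borel_measurable borel"
          unfolding G_def by (rule measurable_compose[OF measurable_step_path Fm])
      qed (use L in auto)
      moreover have "G (\<lambda>j. mart n (n * Suc j div K) \<omega> - mart n (n * j div K) \<omega>) = F (X K n \<omega>)" for n \<omega>
      proof -
        have "(\<Sum>j<i. mart n (n * Suc j div K) \<omega> - mart n (n * j div K) \<omega>) =
            mart n (n * i div K) \<omega> - mart n (n * 0 div K) \<omega>" for i
          by (rule sum_lessThan_telescope)
        then show ?thesis unfolding G_def X_def by (simp only:) (simp add: mart_0)
      qed
      moreover have "G (\<lambda>j. B' K (Suc j) \<omega> - B' K j \<omega>) = F (Z K \<omega>)" for \<omega>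
      proof -
        have "(\<Sum>j<i. B' K (Suc j) \<omega> - B' K j \<omega>) = B' K i \<omega> - B' K 0 \<omega>" for i
          by (rule sum_lessThan_telescope)
        then show ?thesis unfolding G_def Z_def by (simp only:)
      qed
      ultimately show ?thesis by simp
    qed
    define bad1 where "bad1 K e n = {\<omega> \<in> space P. \<exists>i<K. \<exists>k\<in>{n * i div K..n * Suc i div K}. e < \<bar>mart n k \<omega>
        - mart n (n * i div K) \<omega>\<bar>}" for K e n
    define bad2 where "bad2 e n = {\<omega> \<in> space P. \<exists>k\<le>n. e < \<bar>s n k \<omega> - mart n k \<omega>\<bar>}" for e n
    have bad1m[measurable]: "bad1 K e n \<in> sets P" for K e n unfolding bad1_def by measurable
    have bad2m[measurable]: "bad2 e n \<in> sets P" for e n unfolding bad2_def by measurable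
    have close: "skorokhod_dist (Y n \<omega>) (X K n \<omega>) \<le> 2 * e"
      if K: "K \<ge> 1" and e: "e > 0" and \<omega>: "\<omega> \<in> space P" "\<omega> \<notin> bad1 K e n" "\<omega> \<notin> bad2 e n" for K n e \<omega>
    proof (rule skorokhod_dist_le_uniform[OF YXZ(1,2)])
      fix t :: real assume t: "t \<in> {0..1}"
      define k where "k = nat \<lfloor>real n * t\<rfloor>"
      define i where "i = nat \<lfloor>real K * t\<rfloor>"
      have k: "k \<le> n" and i: "i \<le> K" unfolding k_def i_def using nat_floor_mult_le[OF t] by auto
      have 1: "\<bar>s n k \<omega> - mart n k \<omega>\<bar> \<le> e" using \<omega>(1,3) k by (auto simp: bad2_def not_less)
      have 2: "\<bar>mart n k \<omega> - mart n (n * i div K) \<omega>\<bar> \<le> e"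
      \<comment> \<open>Time \<open>t\<close> lies in block \<open>i\<close> and the floors are
        ordered accordingly, so \<open>k\<close> is one of the indices watched by
        \<open>bad1\<close>. The value \<open>i = K\<close> occurs only for \<open>t = 1\<close>,
        where both indices equal \<open>n\<close>.\<close>
      proof (cases "i < K")
        case True
        have i_eq: "real i = of_int \<lfloor>real K * t\<rfloor>" using t by (simp add: i_def)
        have "real i \<le> real K * t" "real K * t < real (Suc i)"
          unfolding of_nat_Suc i_eq by linarith+
        then have it: "real i / real K \<le> t" "t < real (Suc i) / real K"
          using K by (auto simp: field_simps)
        have "real (n * i div K) \<le> real (n * i) / real K" by (rule of_nat_div_le_of_nat)
        also have "\<dots> \<le> real n * t" using it(1) by (simp add: mult_left_mono[of "real i / real K" t "real
            n"] times_divide_eq_right[symmetric] del: times_divide_eq_right)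
        finally have "n * i div K \<le> k" unfolding k_def by (simp add: le_nat_floor)
        moreover have "k \<le> n * Suc i div K"
        proof -
          have "real k \<le> real n * t" unfolding k_def using t by simp
          also have "\<dots> \<le> real n * (real (Suc i) / real K)" using it(2) by (intro mult_left_mono) auto
          finally have "real k * real K \<le> real n * real (Suc i)" using K by (simp add: field_simps)
          then have "k * K \<le> n * Suc i" by (metis of_nat_le_iff of_nat_mult)
          then show ?thesis using K by (simp add: less_eq_div_iff_mult_less_eq)
        qed
        ultimately have "k \<in> {n * i div K..n * Suc i div K}" by simp
        then show ?thesis using \<omega>(1,2) True unfolding bad1_def
            by (metis (mono_tags, lifting) mem_Collect_eq not_less)
      next
        case False
        then have "i = K" using i by simp
        moreover have "real i \<le> real K * t" using t by (simp add: i_def)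
        ultimately have "real K \<le> real K * t" by simp
        then have "t = 1" using K t by simp
        then have "k = n" by (simp add: k_def)
        then show ?thesis using \<open>i = K\<close> K e by simp
      qed
      show "\<bar>Y n \<omega> t - X K n \<omega> t\<bar> \<le> 2 * e"
      proof -
        have "Y n \<omega> t = s n k \<omega>" "X K n \<omega> t = mart n (n * i div K) \<omega>"
          using t by (simp_all add: Y_def X_def step_path_def k_def i_def)
        then show ?thesis using 1 2 by linarith
      qed
    qed
    have diff: "\<bar>(\<integral>\<omega>. F (Y n \<omega>) \<partial>P) - (\<integral>\<omega>. F (X K n \<omega>) \<partial>P)\<bar> \<le> L * (2 * e) +
        2 * C * (measure P (bad1 K e n) + measure P (bad2 e n))"
      if K: "K \<ge> 1" and e: "e > 0" for K n e
    proof -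
      have i: "integrable P (\<lambda>\<omega>. F (Y n \<omega>))" "integrable P (\<lambda>\<omega>. F (X K n \<omega>))"
        using C YXZ by (auto intro!: P.integrable_const_bound[of _ C])
      have ind: "integrable P (indicator (bad1 K e n) :: _ \<Rightarrow> real)" "integrable P (indicator (bad2 e n) ::
          _ \<Rightarrow> real)"
        by (auto simp: P.emeasure_eq_measure)
      have "\<bar>(\<integral>\<omega>. F (Y n \<omega>) \<partial>P) - (\<integral>\<omega>. F (X K n \<omega>) \<partial>P)\<bar> \<le> (\<integral>\<omega>. \<bar>F (Y n \<omega>) - F (X K n \<omega>)\<bar> \<partial>P)"
        unfolding Bochner_Integration.integral_diff[OF i, symmetric] by (rule integral_abs_bound)
      also have "\<dots> \<le> (\<integral>\<omega>. L * (2 * e) + 2 * C * (indicator (bad1 K e n) \<omega> + indicator (bad2 e n) \<omega>) \<partial>P)"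
      proof (rule integral_mono)
        fix \<omega> assume \<omega>: "\<omega> \<in> space P"
        show "\<bar>F (Y n \<omega>) - F (X K n \<omega>)\<bar> \<le> L * (2 * e) + 2 * C * (indicator (bad1 K e n) \<omega> +
            indicator (bad2 e n) \<omega>)"
        proof (cases "\<omega> \<in> bad1 K e n \<or> \<omega> \<in> bad2 e n")
          case True
          have "\<bar>F (Y n \<omega>) - F (X K n \<omega>)\<bar> \<le> 2 * C" using C[OF YXZ(1)[of n \<omega>]] C[OF YXZ(2)[of K n \<omega>]]
              by linarith
          also have "\<dots> \<le> 2 * C * (indicator (bad1 K e n) \<omega> + indicator (bad2 e n) \<omega>)"
            using True C0 by (auto simp: indicator_def)
          finally show ?thesis using L e by (simp add: add_increasing)
        next
          case False
          have "\<bar>F (Y n \<omega>) - F (X K n \<omega>)\<bar> \<le> L * skorokhod_dist (Y n \<omega>) (X K n \<omega>)" by (intro lip YXZ)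
          also have "\<dots> \<le> L * (2 * e)" using close[OF K e \<omega>] False L by (intro mult_left_mono) auto
          finally show ?thesis using False by simp
        qed
      next
        show "integrable P (\<lambda>\<omega>. \<bar>F (Y n \<omega>) - F (X K n \<omega>)\<bar>)"
          by (intro integrable_abs Bochner_Integration.integrable_diff i)
        show "integrable P (\<lambda>\<omega>. L * (2 * e) + 2 * C * (indicator (bad1 K e n) \<omega> + indicator (bad2 e n) \<omega>))"
          by (intro Bochner_Integration.integrable_add integrable_mult_right P.integrable_const ind)
      qed
      also have "\<dots> = L * (2 * e) + 2 * C * (measure P (bad1 K e n) + measure P (bad2 e n))"
        using ind by (simp add: P.prob_space)
      finally show ?thesis .
    qed
    show "(\<lambda>n. \<integral>\<omega>. F (step_path n (\<lambda>k. s n k \<omega>)) \<partial>P) \<longlonglongrightarrow> (\<integral>\<omega>. F (sample_path B \<omega>) \<partial>Q)"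
    proof (rule tendstoI)
      fix r :: real assume r: "r > 0"
      \<comment> \<open>The distance and the exceptional events may cost \<open>r / 4\<close> each;
        the two limits below contribute \<open>r / 8\<close> each.\<close>
      define e where "e = r / (8 * (L + 1))"
      define \<eta> where "\<eta> = r / (16 * (C + 1))"
      have e: "e > 0" "L * (2 * e) \<le> r / 4"
        using r L by (auto simp: e_def divide_simps)
      have \<eta>: "\<eta> > 0" "2 * C * (\<eta> + \<eta>) \<le> r / 4"
        using r C0 by (auto simp: \<eta>_def divide_simps)
      obtain K0 where K0: "\<And>K. K \<ge> K0 \<Longrightarrow> \<forall>\<^sub>F n in sequentially. measure P (bad1 K e n) < \<eta>"
        using osc[OF e(1) \<eta>(1)] unfolding bad1_def by blast
      have "\<forall>\<^sub>F K in sequentially. dist (\<integral>\<omega>. F (Z K \<omega>) \<partial>Q) (\<integral>\<omega>. F (sample_path B \<omega>) \<partial>Q) < r / 8"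
        using Zconv r by (intro tendstoD) auto
      then obtain K1 where K1: "\<And>K. K \<ge> K1 \<Longrightarrow> dist (\<integral>\<omega>. F (Z K \<omega>) \<partial>Q) (\<integral>\<omega>. F (sample_path B \<omega>) \<partial>Q) < r / 8"
        unfolding eventually_sequentially by blast
      define K where "K = Suc (max K0 K1)"
      have K: "K \<ge> 1" "K \<ge> K0" "K \<ge> K1" by (auto simp: K_def)
      have "\<forall>\<^sub>F n in sequentially. dist (\<integral>\<omega>. F (X K n \<omega>) \<partial>P) (\<integral>\<omega>. F (Z K \<omega>) \<partial>Q) < r / 8"
        using XZ[OF K(1)] r by (intro tendstoD) auto
      moreover have "\<forall>\<^sub>F n in sequentially. measure P (bad2 e n) < \<eta>"
        using rem[OF e(1)] \<eta>(1) unfolding bad2_def by (rule order_tendstoD(2))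
      ultimately show "\<forall>\<^sub>F n in sequentially. dist (\<integral>\<omega>. F (step_path n (\<lambda>k. s n k \<omega>)) \<partial>P) (\<integral>\<omega>. F
          (sample_path B \<omega>) \<partial>Q) < r"
        using K0[OF K(2)]
      proof eventually_elim
        case (elim n)
        have "2 * C * (measure P (bad1 K e n) + measure P (bad2 e n)) \<le> 2 * C * (\<eta> + \<eta>)"
          using elim C0 by (intro mult_left_mono add_mono) auto
        then show ?case using diff[OF K(1) e(1), of n] e(2) \<eta>(2) elim(1) K1[OF K(3)] r
          unfolding dist_real_def Y_def by linarith
      qed
    qed
  qed
qed

section \<open>Martingale approximation for the Gaussian autoregressive chain\<close>

text \<open>Chosen once from \<open>integral_hermite_step_power2\<close>, so that it depends on
  \<open>d\<close> alone and can be shared by all rows.\<close>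

definition variance_const :: "nat \<Rightarrow> real" where
  "variance_const d = (SOME C. C \<ge> 0 \<and> (\<forall>a b w A. a\<^sup>2 + b\<^sup>2 = 1 \<longrightarrow> 0 \<le> a \<longrightarrow> a \<le> 1 \<longrightarrow> 0 \<le> b \<longrightarrow> b \<le>
      1 \<longrightarrow> (\<forall>q\<le>d. \<bar>w q\<bar> \<le> A) \<longrightarrow>
     (\<exists>v. (\<forall>x. (\<integral>e. (hermite_step a b d w x e)\<^sup>2 \<partial>gaussian) = hermite_sum (2 * d) v x) \<and>
        (\<forall>r\<le>2 * d. \<bar>v r\<bar> \<le> C * (b * A)\<^sup>2) \<and> v 0 = (\<Sum>q\<le>d. (w q)\<^sup>2 * fact q * (1 - a ^ (2 * q))))))"

lemma variance_const_nonneg: "variance_const d \<ge> 0"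
  and integral_hermite_step_power2_const:
    "\<lbrakk>a\<^sup>2 + b\<^sup>2 = 1; 0 \<le> a; a \<le> 1; 0 \<le> b; b \<le> 1; \<And>q. q \<le> d \<Longrightarrow> \<bar>w q\<bar> \<le> A\<rbrakk> \<Longrightarrow>
     \<exists>v. (\<forall>x. (\<integral>e. (hermite_step a b d w x e)\<^sup>2 \<partial>gaussian) = hermite_sum (2 * d) v x) \<and>
        (\<forall>r\<le>2 * d. \<bar>v r\<bar> \<le> variance_const d * (b * A)\<^sup>2) \<and>
        v 0 = (\<Sum>q\<le>d. (w q)\<^sup>2 * fact q * (1 - a ^ (2 * q)))"
  using someI_ex[OF integral_hermite_step_power2[of d]] unfolding variance_const_def[of d, symmetric]
      by blast+

definition hermite_moment :: "nat \<Rightarrow> nat \<Rightarrow> real" where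
  "hermite_moment d r = (\<integral>x. hermite_abs d x ^ r \<partial>gaussian)"

lemma hermite_moment_ge_1: "1 \<le> hermite_moment d r"
proof -
  have "(\<integral>x. 1 \<partial>gaussian) \<le> hermite_moment d r"
    unfolding hermite_moment_def
    by (intro integral_mono integrable_hermite_abs_power one_le_power hermite_abs_ge_1) simp
  then show ?thesis by (simp add: gaussian.prob_space[simplified])
qed

lemma hermite_abs_mono: "d \<le> d' \<Longrightarrow> hermite_abs d x \<le> hermite_abs d' x"
  unfolding hermite_abs_def by (intro sum_mono2) auto

lemma integrable_hermite_step: "a\<^sup>2 + b\<^sup>2 = 1 \<Longrightarrow> integrable gaussian (hermite_step a b d w x)"
  by (simp add: hermite_step_sum_eq integrable_hermite_sum)

lemma integrable_hermite_step_power2: "a\<^sup>2 + b\<^sup>2 = 1 \<Longrightarrow> integrable gaussian (\<lambda>z. (hermite_step a b d w x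
    z)\<^sup>2)"
  by (simp add: hermite_step_sum_eq integrable_hermite_sum_power2)

text \<open>The chain is normalised to the standard normal stationary law, which is why
  \<open>a\<^sup>2 + b\<^sup>2 = 1\<close>; the innovations enter from index 1 on. \<open>F\<close>
  is an abstract filtration whose essential property is that the next innovation is independent of
  the past.\<close>

locale gaussian_chain = prob_space M for M :: "'a measure" +
  fixes F :: "nat \<Rightarrow> 'a measure" and \<xi> e :: "nat \<Rightarrow> 'a \<Rightarrow> real" and a b :: real
  assumes ab: "a\<^sup>2 + b\<^sup>2 = 1" and a: "0 \<le> a" "a < 1" and b: "0 < b"
    and F_sub: "subalgebra M (F k)" and F_Suc: "subalgebra (F (Suc k)) (F k)"
    and \<xi>_F: "\<xi> k \<in> borel_measurable (F k)" and e_F: "e (Suc k) \<in> borel_measurable (F (Suc k))"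
    and indep: "indep_set (sets (F k)) (sets (vimage_algebra (space M) (e (Suc k)) borel))"
    and e_distr: "distributed M lborel (e (Suc k)) std_normal_density"
    and \<xi>_distr: "distributed M lborel (\<xi> k) std_normal_density"
    and \<xi>_Suc: "\<omega> \<in> space M \<Longrightarrow> \<xi> (Suc k) \<omega> = a * \<xi> k \<omega> + b * e (Suc k) \<omega>"
begin

lemma b_le_1: "b \<le> 1"
proof -
  have "b\<^sup>2 \<le> 1\<^sup>2" using ab zero_le_power2[of a] unfolding power_one by linarith
  then show ?thesis by (rule power2_le_imp_le) simp
qed

lemma F_mono: "k \<le> l \<Longrightarrow> subalgebra (F l) (F k)"
proof (induction l rule: dec_induct)
  case base
  then show ?case by (simp add: subalgebra_def)
next
  case (step l)
  then show ?case using F_Suc[of l] by (auto simp: subalgebra_def)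
qed

lemma F_measurable_mono: "f \<in> F k \<rightarrow>\<^sub>M N \<Longrightarrow> k \<le> l \<Longrightarrow> f \<in> F l \<rightarrow>\<^sub>M N"
  using measurable_from_subalg[OF F_mono] by blast

lemma F_measurable_M: "f \<in> F k \<rightarrow>\<^sub>M N \<Longrightarrow> f \<in> M \<rightarrow>\<^sub>M N"
  using measurable_from_subalg[OF F_sub] by blast

lemma \<xi>_M[measurable]: "\<xi> k \<in> borel_measurable M" and e_M[measurable]: "e (Suc k) \<in> borel_measurable M"
  using F_measurable_M[OF \<xi>_F] F_measurable_M[OF e_F] by auto

lemma distr_\<xi>: "distr M borel (\<xi> k) = gaussian" and distr_e: "distr M borel (e (Suc k)) = gaussian"
  using distributed_distr_eq_density[OF \<xi>_distr] distributed_distr_eq_density[OF e_distr]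
  by (auto cong: distr_cong)

lemma indep_var_F:
  assumes U: "U \<in> F k \<rightarrow>\<^sub>M S"
  shows "indep_var S U borel (e (Suc k))"
  unfolding indep_var_eq
proof (intro conjI)
  show "random_variable S U" using F_measurable_M[OF U] .
  show "indep_set (sigma_sets (space M) {U -` A \<inter> space M |A. A \<in> sets S})
     (sigma_sets (space M) {e (Suc k) -` A \<inter> space M |A. A \<in> sets borel})"
    unfolding indep_set_def
  proof (rule indep_sets_mono_sets[OF indep[of k, unfolded indep_set_def]])
    have sp: "space (F k) = space M" using F_sub[of k] by (simp add: subalgebra_def)
    have "{U -` A \<inter> space M |A. A \<in> sets S} \<subseteq> sets (F k)"
      using measurable_sets[OF U] sp by auto
    then have 1: "sigma_sets (space M) {U -` A \<inter> space M |A. A \<in> sets S} \<subseteq> sets (F k)"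
      using sets.sigma_sets_subset[of _ "F k"] sp by simp
    have 2: "sigma_sets (space M) {e (Suc k) -` A \<inter> space M |A. A \<in> sets borel} \<subseteq> sets (vimage_algebra
        (space M) (e (Suc k)) borel)"
      unfolding vimage_algebra_def by (subst sets_measure_of) auto
    show "(case i of True \<Rightarrow> sigma_sets (space M) {U -` A \<inter> space M |A. A \<in> sets S}
         | False \<Rightarrow> sigma_sets (space M) {e (Suc k) -` A \<inter> space M |A. A \<in> sets borel})
         \<subseteq> (case i of True \<Rightarrow> sets (F k) | False \<Rightarrow> sets (vimage_algebra (space M) (e (Suc k)) borel))" for i
      using 1 2 by (auto split: bool.split)
  qed
qed simp

text \<open>Conditional expectation given the past in the form of Fubini's theorem: the joint law of
  a past variable and the next innovation is a product, so the innovation can be integrated out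
  first.\<close>

lemma integral_step:
  fixes h :: "'s \<times> real \<Rightarrow> 'c :: {banach, second_countable_topology}"
  assumes U: "U \<in> F k \<rightarrow>\<^sub>M S" and h[measurable]: "h \<in> borel_measurable (S \<Otimes>\<^sub>M borel)"
    and int: "integrable M (\<lambda>\<omega>. h (U \<omega>, e (Suc k) \<omega>))"
  shows "(\<integral>\<omega>. h (U \<omega>, e (Suc k) \<omega>) \<partial>M) = (\<integral>\<omega>. (\<integral>z. h (U \<omega>, z) \<partial>gaussian) \<partial>M)"
proof -
  have [measurable]: "U \<in> M \<rightarrow>\<^sub>M S" using F_measurable_M[OF U] .
  interpret U: prob_space "distr M S U" by (rule prob_space_distr) simp
  interpret P: pair_sigma_finite "distr M S U" gaussian ..
  have D: "distr M (S \<Otimes>\<^sub>M borel) (\<lambda>\<omega>. (U \<omega>, e (Suc k) \<omega>)) = distr M S U \<Otimes>\<^sub>M gaussian"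
  proof (rule pair_measure_eqI[symmetric])
    show "sigma_finite_measure (distr M S U)" "sigma_finite_measure gaussian" by unfold_locales
    show "sets (distr M S U \<Otimes>\<^sub>M gaussian) = sets (distr M (S \<Otimes>\<^sub>M borel) (\<lambda>\<omega>. (U \<omega>, e (Suc k) \<omega>)))"
      unfolding sets_distr by (rule sets_pair_measure_cong) auto
    fix A B assume "A \<in> sets (distr M S U)" "B \<in> sets gaussian"
    then have AB[measurable]: "A \<in> sets S" "B \<in> sets borel" by auto
    have sp: "space (F k) = space M" using F_sub[of k] by (simp add: subalgebra_def)
    have "U -` A \<inter> space M \<in> sets (F k)" using measurable_sets[OF U AB(1)] sp by simp
    moreover have "e (Suc k) -` B \<inter> space M \<in> sets (vimage_algebra (space M) (e (Suc k)) borel)"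
      by (rule in_vimage_algebra) (rule AB)
    ultimately have "prob ((U -` A \<inter> space M) \<inter> (e (Suc k) -` B \<inter> space M)) =
        prob (U -` A \<inter> space M) * prob (e (Suc k) -` B \<inter> space M)"
      by (rule indep_setD[OF indep])
    moreover have "(\<lambda>\<omega>. (U \<omega>, e (Suc k) \<omega>)) -` (A \<times> B) \<inter> space M =
        (U -` A \<inter> space M) \<inter> (e (Suc k) -` B \<inter> space M)"
      by auto
    moreover have "emeasure gaussian B = prob (e (Suc k) -` B \<inter> space M)"
      unfolding distr_e[of k, symmetric] by (subst emeasure_distr) (auto simp: emeasure_eq_measure)
    ultimately show "emeasure (distr M S U) A * emeasure gaussian B =
        emeasure (distr M (S \<Otimes>\<^sub>M borel) (\<lambda>\<omega>. (U \<omega>, e (Suc k) \<omega>))) (A \<times> B)"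
      by (simp add: emeasure_distr emeasure_eq_measure ennreal_mult'')
  qed
  have "(\<integral>\<omega>. h (U \<omega>, e (Suc k) \<omega>) \<partial>M) = (\<integral>p. h p \<partial>(distr M S U \<Otimes>\<^sub>M gaussian))"
    unfolding D[symmetric] by (subst integral_distr) auto
  also have "\<dots> = (\<integral>x. (\<integral>z. h (x, z) \<partial>gaussian) \<partial>distr M S U)"
  proof (rule P.integral_fst'[symmetric])
    show "integrable (distr M S U \<Otimes>\<^sub>M gaussian) h"
      unfolding D[symmetric] using int by (subst integrable_distr_eq) auto
  qed
  also have "\<dots> = (\<integral>\<omega>. (\<integral>z. h (U \<omega>, z) \<partial>gaussian) \<partial>M)"
  proof (rule integral_distr)
    have "(\<lambda>x. \<integral>z. h (x, z) \<partial>gaussian) \<in> borel_measurable S"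
    proof (rule gaussian.borel_measurable_lebesgue_integral)
      show "(\<lambda>(x, y). h (x, y)) \<in> borel_measurable (S \<Otimes>\<^sub>M gaussian)"
        using h by (simp cong: measurable_cong_sets sets_pair_measure_cong)
    qed
    then show "(\<lambda>x. \<integral>z. h (x, z) \<partial>gaussian) \<in> borel_measurable S" .
  qed simp
  finally show ?thesis .
qed

text \<open>\<open>\<Phi>\<close> is any weight depending on the past. With \<open>scaleR\<close>
  one statement serves real weights and the complex ones of characteristic functions.\<close>

lemma integral_step_scaleR:
  fixes \<Phi> :: "'a \<Rightarrow> 'c :: {banach, second_countable_topology}"
  assumes \<Phi>: "\<Phi> \<in> borel_measurable (F k)" and Gi: "\<And>x. integrable gaussian (G x)"
    and G[measurable]: "case_prod G \<in> borel_measurable (borel \<Otimes>\<^sub>M borel)"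
    and int: "integrable M (\<lambda>\<omega>. G (\<xi> k \<omega>) (e (Suc k) \<omega>) *\<^sub>R \<Phi> \<omega>)"
  shows "(\<integral>\<omega>. G (\<xi> k \<omega>) (e (Suc k) \<omega>) *\<^sub>R \<Phi> \<omega> \<partial>M) = (\<integral>\<omega>. (\<integral>z. G (\<xi> k \<omega>) z \<partial>gaussian) *\<^sub>R \<Phi> \<omega> \<partial>M)"
proof -
  define h :: "('c \<times> real) \<times> real \<Rightarrow> 'c" where "h = (\<lambda>p. case_prod G (snd (fst p), snd p) *\<^sub>R fst (fst p))"
  have "(\<integral>\<omega>. h ((\<Phi> \<omega>, \<xi> k \<omega>), e (Suc k) \<omega>) \<partial>M) = (\<integral>\<omega>. (\<integral>z. h ((\<Phi> \<omega>, \<xi> k \<omega>), z) \<partial>gaussian) \<partial>M)"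
  proof (rule integral_step[of "\<lambda>\<omega>. (\<Phi> \<omega>, \<xi> k \<omega>)" k "borel \<Otimes>\<^sub>M borel"])
    show "(\<lambda>\<omega>. (\<Phi> \<omega>, \<xi> k \<omega>)) \<in> F k \<rightarrow>\<^sub>M borel \<Otimes>\<^sub>M borel" using \<Phi> \<xi>_F by measurable
    show "h \<in> borel_measurable ((borel \<Otimes>\<^sub>M borel) \<Otimes>\<^sub>M borel)" unfolding h_def by measurable
  qed (use int in \<open>simp add: h_def\<close>)
  then show ?thesis by (simp add: h_def Gi)
qed

text \<open>Envelope for anything built from the current state and the next innovation. The two
  factors are independent, hence the square in \<open>dominator_moment\<close>.\<close>

definition dominator :: "nat \<Rightarrow> nat \<Rightarrow> 'a \<Rightarrow> real" where
  "dominator d k \<omega> = hermite_abs d (\<xi> k \<omega>) * hermite_abs d (e (Suc k) \<omega>)"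

lemma dominator_measurable[measurable]: "dominator d k \<in> borel_measurable M"
  unfolding dominator_def[abs_def] by measurable

lemma dominator_ge_1: "1 \<le> dominator d k \<omega>"
  unfolding dominator_def using mult_mono[OF hermite_abs_ge_1 hermite_abs_ge_1, of d "\<xi> k \<omega>" d "e (Suc k)
      \<omega>"] hermite_abs_ge_1[of d "\<xi> k \<omega>"] by simp

lemma hermite_abs_moment:
  shows "integrable M (\<lambda>\<omega>. hermite_abs d (\<xi> k \<omega>) ^ r)" "(\<integral>\<omega>. hermite_abs d (\<xi> k \<omega>) ^ r \<partial>M) =
      hermite_moment d r"
proof -
  have "integrable (distr M borel (\<xi> k)) (\<lambda>x. hermite_abs d x ^ r)"
    unfolding distr_\<xi> by (rule integrable_hermite_abs_power)
  then show "integrable M (\<lambda>\<omega>. hermite_abs d (\<xi> k \<omega>) ^ r)" by (subst (asm) integrable_distr_eq) auto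
  have "(\<integral>\<omega>. hermite_abs d (\<xi> k \<omega>) ^ r \<partial>M) = (\<integral>x. hermite_abs d x ^ r \<partial>distr M borel (\<xi> k))"
    by (subst integral_distr) auto
  then show "(\<integral>\<omega>. hermite_abs d (\<xi> k \<omega>) ^ r \<partial>M) = hermite_moment d r"
    unfolding distr_\<xi> hermite_moment_def .
qed

lemma dominator_moment:
  shows "integrable M (\<lambda>\<omega>. dominator d k \<omega> ^ r)" "(\<integral>\<omega>. dominator d k \<omega> ^ r \<partial>M) = (hermite_moment d r)\<^sup>2"
proof -
  have "indep_var borel (\<xi> k) borel (e (Suc k))" by (rule indep_var_F[OF \<xi>_F])
  then have I: "indep_var borel ((\<lambda>x. hermite_abs d x ^ r) \<circ> \<xi> k) borel ((\<lambda>x. hermite_abs d x ^ r) \<circ> e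
      (Suc k))"
    by (rule indep_var_compose) measurable
  have "integrable (distr M borel (e (Suc k))) (\<lambda>x. hermite_abs d x ^ r)"
    unfolding distr_e by (rule integrable_hermite_abs_power)
  then have e1: "integrable M (\<lambda>\<omega>. hermite_abs d (e (Suc k) \<omega>) ^ r)"
      by (subst (asm) integrable_distr_eq) auto
  have "(\<integral>\<omega>. hermite_abs d (e (Suc k) \<omega>) ^ r \<partial>M) = (\<integral>x. hermite_abs d x ^ r \<partial>distr M borel (e (Suc k)))"
    by (subst integral_distr) auto
  then have e2: "(\<integral>\<omega>. hermite_abs d (e (Suc k) \<omega>) ^ r \<partial>M) = hermite_moment d r"
    unfolding distr_e hermite_moment_def .
  show "integrable M (\<lambda>\<omega>. dominator d k \<omega> ^ r)"
    using indep_var_integrable[OF I] hermite_abs_moment(1) e1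
    unfolding dominator_def power_mult_distrib comp_def by blast
  show "(\<integral>\<omega>. dominator d k \<omega> ^ r \<partial>M) = (hermite_moment d r)\<^sup>2"
    using indep_var_lebesgue_integral[OF I] hermite_abs_moment e1 e2
    unfolding dominator_def power_mult_distrib comp_def power2_eq_square by metis
qed

text \<open>The third power is the largest one that occurs: it comes from the cubic Taylor remainder
  of the exponential, and from a corrector times the quadratic remainder.\<close>

lemma integrable_dominated:
  fixes f :: "'a \<Rightarrow> 'c :: {banach, second_countable_topology}"
  assumes "f \<in> borel_measurable M" "\<And>\<omega>. \<omega> \<in> space M \<Longrightarrow> norm (f \<omega>) \<le> C * dominator d k \<omega> ^ 3"
  shows "integrable M f" "norm (\<integral>\<omega>. f \<omega> \<partial>M) \<le> C * (hermite_moment d 3)\<^sup>2"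
proof -
  have i: "integrable M (\<lambda>\<omega>. C * dominator d k \<omega> ^ 3)" using dominator_moment(1) by simp
  show f: "integrable M f"
    by (rule Bochner_Integration.integrable_bound[OF i assms(1)])
        (use assms(2) in \<open>auto intro!: AE_I2 intro: order_trans[OF _ abs_ge_self]\<close>)
  have "norm (\<integral>\<omega>. f \<omega> \<partial>M) \<le> (\<integral>\<omega>. C * dominator d k \<omega> ^ 3 \<partial>M)"
    by (rule order_trans[OF integral_norm_bound integral_mono]) (use f i assms(2) in auto)
  then show "norm (\<integral>\<omega>. f \<omega> \<partial>M) \<le> C * (hermite_moment d 3)\<^sup>2" by (simp add: dominator_moment(2))
qed

end

text \<open>\<open>\<kappa>\<^sup>2\<close> is the variance of one increment, and
  \<open>\<kappa>\<close> at the same time bounds the coefficients, so that an increment is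
  \<open>\<kappa>\<close> times a variable with moments bounded in terms of
  \<open>d\<close>.\<close>

locale gaussian_chain_martingale = gaussian_chain +
  fixes d :: nat and w :: "nat \<Rightarrow> real" and \<kappa> :: real
  assumes \<kappa>: "0 < \<kappa>" and w: "q \<le> d \<Longrightarrow> b * \<bar>w q\<bar> \<le> \<kappa>"
    and variance: "(\<Sum>q\<le>d. (w q)\<^sup>2 * fact q * (1 - a ^ (2 * q))) = \<kappa>\<^sup>2"
begin

section \<open>The martingale, its increments and their conditional variance\<close>

definition incr :: "nat \<Rightarrow> 'a \<Rightarrow> real" where
  "incr k \<omega> = hermite_step a b d w (\<xi> k \<omega>) (e (Suc k) \<omega>)"

definition mart :: "nat \<Rightarrow> 'a \<Rightarrow> real" where
  "mart k \<omega> = (\<Sum>l<k. incr l \<omega>)"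

text \<open>Order \<open>2 * d\<close> throughout, because conditional variances and their
  correctors have that order; the same envelope then serves the increments as well.\<close>

abbreviation "K \<equiv> step_const (2 * d)"
abbreviation "Dom \<equiv> dominator (2 * d)"
abbreviation "\<mu> \<equiv> (hermite_moment (2 * d) 3)\<^sup>2"

lemma incr_F: "incr k \<in> borel_measurable (F (Suc k))"
proof -
  have [measurable]: "\<xi> k \<in> borel_measurable (F (Suc k))" "e (Suc k) \<in> borel_measurable (F (Suc k))"
    using F_measurable_mono[OF \<xi>_F, of k "Suc k"] e_F by auto
  show ?thesis unfolding incr_def[abs_def] by measurable
qed

lemma mart_F: "mart k \<in> borel_measurable (F k)"
  unfolding mart_def[abs_def]
  by (intro borel_measurable_sum F_measurable_mono[OF incr_F]) auto

lemma incr_M[measurable]: "incr k \<in> borel_measurable M"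
    and mart_M[measurable]: "mart k \<in> borel_measurable M"
  using F_measurable_M[OF incr_F] F_measurable_M[OF mart_F] by auto

lemma K_pos: "0 < K" by (rule step_const_pos)

lemma hermite_step_dominated:
  assumes "d' \<le> 2 * d" "\<And>q. q \<le> d' \<Longrightarrow> \<bar>v q\<bar> \<le> A" "0 \<le> A"
  shows "\<bar>hermite_step a b d' v (\<xi> k \<omega>) (e (Suc k) \<omega>)\<bar> \<le> b * A * (K * Dom k \<omega>)"
proof -
  have "\<bar>hermite_step a b d' v (\<xi> k \<omega>) (e (Suc k) \<omega>)\<bar> \<le>
      b * A * (step_const d' * hermite_abs d' (\<xi> k \<omega>) * hermite_abs d' (e (Suc k) \<omega>))"
    using ab a b b_le_1 assms(2) by (intro hermite_step_bound) auto
  also have "\<dots> \<le> b * A * (K * hermite_abs (2 * d) (\<xi> k \<omega>) * hermite_abs (2 * d) (e (Suc k) \<omega>))"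
  proof (intro mult_left_mono mult_mono hermite_abs_mono assms)
    show "step_const d' \<le> K" unfolding step_const_def using assms(1)
      by (intro mult_mono power_increasing) auto
    show "0 \<le> b * A" using b assms by simp
  qed (use hermite_abs_ge_1 K_pos step_const_pos[of d'] in \<open>auto intro!: mult_nonneg_nonneg intro:
      order_trans[OF zero_le_one] less_imp_le\<close>)
  finally show ?thesis by (simp add: dominator_def mult.assoc)
qed

lemma incr_bound: "\<bar>incr k \<omega>\<bar> \<le> \<kappa> * (K * Dom k \<omega>)"
proof -
  \<comment> \<open>\<open>\<kappa> / b\<close> bounds the coefficients, and the factor
    \<open>b\<close> gained by a step cancels the denominator.\<close>
  have "\<bar>incr k \<omega>\<bar> \<le> b * (\<kappa> / b) * (K * Dom k \<omega>)"
    unfolding incr_def using w b \<kappa> by (intro hermite_step_dominated) (auto simp: field_simps)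
  then show ?thesis using b by simp
qed

lemma Dom_power: "i \<le> j \<Longrightarrow> Dom k \<omega> ^ i \<le> Dom k \<omega> ^ j"
  by (rule power_increasing[OF _ dominator_ge_1])

lemma Dom_ge_1: "1 \<le> Dom k \<omega>" by (rule dominator_ge_1)

text \<open>The martingale difference property, tested against weights of the past instead of being
  stated with conditional expectations.\<close>

lemma incr_orthogonal:
  fixes \<Phi> :: "'a \<Rightarrow> 'c :: {banach, second_countable_topology}"
  assumes "\<Phi> \<in> borel_measurable (F k)" "integrable M (\<lambda>\<omega>. incr k \<omega> *\<^sub>R \<Phi> \<omega>)"
  shows "(\<integral>\<omega>. incr k \<omega> *\<^sub>R \<Phi> \<omega> \<partial>M) = 0"
  using integral_step_scaleR[OF assms(1) integrable_hermite_step[OF ab, of d w] hermite_step_measurable]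
      assms(2)
  by (simp add: incr_def integral_hermite_step[OF ab])

text \<open>Hermite coefficients of the conditional variance of an increment given the current
  state; the one of order 0 is its mean.\<close>

definition cond_var :: "nat \<Rightarrow> real" where
  "cond_var = (SOME v. (\<forall>x. (\<integral>z. (hermite_step a b d w x z)\<^sup>2 \<partial>gaussian) = hermite_sum (2 * d) v x) \<and>
        (\<forall>r\<le>2 * d. \<bar>v r\<bar> \<le> variance_const d * \<kappa>\<^sup>2) \<and> v 0 = \<kappa>\<^sup>2)"

lemma cond_var:
  "(\<integral>z. (hermite_step a b d w x z)\<^sup>2 \<partial>gaussian) = hermite_sum (2 * d) cond_var x"
  "r \<le> 2 * d \<Longrightarrow> \<bar>cond_var r\<bar> \<le> variance_const d * \<kappa>\<^sup>2" "cond_var 0 = \<kappa>\<^sup>2"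
proof -
  have "\<exists>v. (\<forall>x. (\<integral>z. (hermite_step a b d w x z)\<^sup>2 \<partial>gaussian) = hermite_sum (2 * d) v x) \<and>
        (\<forall>r\<le>2 * d. \<bar>v r\<bar> \<le> variance_const d * (b * (\<kappa> / b))\<^sup>2) \<and> v 0 =
            (\<Sum>q\<le>d. (w q)\<^sup>2 * fact q * (1 - a ^ (2 * q)))"
    using ab a b b_le_1 w by (intro integral_hermite_step_power2_const) (auto simp: field_simps)
  then have "\<exists>v. (\<forall>x. (\<integral>z. (hermite_step a b d w x z)\<^sup>2 \<partial>gaussian) = hermite_sum (2 * d) v x) \<and>
        (\<forall>r\<le>2 * d. \<bar>v r\<bar> \<le> variance_const d * \<kappa>\<^sup>2) \<and> v 0 = \<kappa>\<^sup>2"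
    using b unfolding variance by simp
  from someI_ex[OF this] show
    "(\<integral>z. (hermite_step a b d w x z)\<^sup>2 \<partial>gaussian) = hermite_sum (2 * d) cond_var x"
    "r \<le> 2 * d \<Longrightarrow> \<bar>cond_var r\<bar> \<le> variance_const d * \<kappa>\<^sup>2" "cond_var 0 = \<kappa>\<^sup>2"
    unfolding cond_var_def[symmetric] by blast+
qed

lemma integral_incr_power2:
  fixes \<Phi> :: "'a \<Rightarrow> 'c :: {banach, second_countable_topology}"
  assumes \<Phi>: "\<Phi> \<in> borel_measurable (F k)" and int: "integrable M (\<lambda>\<omega>. (incr k \<omega>)\<^sup>2 *\<^sub>R \<Phi> \<omega>)"
  shows "(\<integral>\<omega>. (incr k \<omega>)\<^sup>2 *\<^sub>R \<Phi> \<omega> \<partial>M) = (\<integral>\<omega>. hermite_sum (2 * d) cond_var (\<xi> k \<omega>) *\<^sub>R \<Phi> \<omega> \<partial>M)"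
proof -
  have "case_prod (\<lambda>x z. (hermite_step a b d w x z)\<^sup>2) \<in> borel_measurable (borel \<Otimes>\<^sub>M borel)" by measurable
  from integral_step_scaleR[OF \<Phi> integrable_hermite_step_power2[OF ab] this] int show ?thesis
      by (simp add: incr_def cond_var(1))
qed

lemma integrable_incr_power2: "integrable M (\<lambda>\<omega>. (incr k \<omega>)\<^sup>2)"
proof (rule integrable_dominated(1))
  fix \<omega>
  have "(incr k \<omega>)\<^sup>2 \<le> (\<kappa> * (K * Dom k \<omega>))\<^sup>2"
    using power_mono[OF incr_bound abs_ge_zero, of k \<omega> 2] by simp
  also have "\<dots> = (\<kappa> * K)\<^sup>2 * Dom k \<omega> ^ 2" by (simp add: power_mult_distrib)
  also have "\<dots> \<le> (\<kappa> * K)\<^sup>2 * Dom k \<omega> ^ 3" by (intro mult_left_mono Dom_power) auto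
  finally show "norm ((incr k \<omega>)\<^sup>2) \<le> (\<kappa> * K)\<^sup>2 * Dom k \<omega> ^ 3" by simp
qed measurable

lemma expectation_incr_power2: "(\<integral>\<omega>. (incr k \<omega>)\<^sup>2 \<partial>M) = \<kappa>\<^sup>2"
proof -
  have "(\<integral>\<omega>. (incr k \<omega>)\<^sup>2 *\<^sub>R 1 \<partial>M) = (\<integral>\<omega>. hermite_sum (2 * d) cond_var (\<xi> k \<omega>) *\<^sub>R (1 :: real) \<partial>M)"
    by (rule integral_incr_power2) (use integrable_incr_power2 in auto)
  also have "\<dots> = (\<integral>x. hermite_sum (2 * d) cond_var x \<partial>distr M borel (\<xi> k))"
    by (subst integral_distr) auto
  also have "\<dots> = \<kappa>\<^sup>2" unfolding distr_\<xi> integral_hermite_sum cond_var(3) ..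
  finally show ?thesis by simp
qed

lemma mart_diff_moment:
  "integrable M (\<lambda>\<omega>. (mart (s + k) \<omega> - mart s \<omega>)\<^sup>2) \<and> (\<integral>\<omega>. (mart (s + k) \<omega> - mart s \<omega>)\<^sup>2 \<partial>M) = real k * \<kappa>\<^sup>2"
proof (induction k)
  case (Suc k)
  let ?D = "\<lambda>\<omega>. mart (s + k) \<omega> - mart s \<omega>"
  have D: "?D \<in> borel_measurable (F (s + k))"
    using mart_F[of "s + k"] F_measurable_mono[OF mart_F, of s "s + k"] by simp
  have i: "integrable M (\<lambda>\<omega>. incr (s + k) \<omega> *\<^sub>R ?D \<omega>)"
  proof (rule Bochner_Integration.integrable_bound)
    show "integrable M (\<lambda>\<omega>. (incr (s + k) \<omega>)\<^sup>2 + (?D \<omega>)\<^sup>2)"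
      using Suc integrable_incr_power2 by simp
    have "\<bar>x * y\<bar> \<le> x\<^sup>2 + y\<^sup>2" for x y :: real
      using sum_squares_bound[of "\<bar>x\<bar>" "\<bar>y\<bar>"] mult_nonneg_nonneg[OF abs_ge_zero[of x] abs_ge_zero[of y]]
      unfolding abs_mult power2_abs by linarith
    then show "AE \<omega> in M. norm (incr (s + k) \<omega> *\<^sub>R ?D \<omega>) \<le> norm ((incr (s + k) \<omega>)\<^sup>2 + (?D \<omega>)\<^sup>2)"
      by (auto intro!: AE_I2)
  qed measurable
  have eq: "(mart (s + Suc k) \<omega> - mart s \<omega>)\<^sup>2 = (?D \<omega>)\<^sup>2 + 2 * (incr (s + k) \<omega> *\<^sub>R ?D \<omega>) + (incr (s +
      k) \<omega>)\<^sup>2" for \<omega>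
    by (simp add: mart_def power2_eq_square algebra_simps)
  have "(\<integral>\<omega>. (mart (s + Suc k) \<omega> - mart s \<omega>)\<^sup>2 \<partial>M) =
      (\<integral>\<omega>. (?D \<omega>)\<^sup>2 \<partial>M) + 2 * (\<integral>\<omega>. incr (s + k) \<omega> *\<^sub>R ?D \<omega> \<partial>M) + (\<integral>\<omega>. (incr (s + k) \<omega>)\<^sup>2 \<partial>M)"
    unfolding eq using Suc i integrable_incr_power2 by simp
  also have "\<dots> = real (Suc k) * \<kappa>\<^sup>2"
    using Suc incr_orthogonal[OF D i] by (simp add: expectation_incr_power2 algebra_simps)
  finally show ?case using Suc i integrable_incr_power2 unfolding eq by simp
qed simp

lemma mart_diff_power2:
  assumes "s \<le> t"
  shows "integrable M (\<lambda>\<omega>. (mart t \<omega> - mart s \<omega>)\<^sup>2)" "(\<integral>\<omega>. (mart t \<omega> - mart s \<omega>)\<^sup>2 \<partial>M) = real (t - s) * \<kappa>\<^sup>2"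
  using mart_diff_moment[of s "t - s"] assms by auto

lemma integrable_mart: "integrable M (mart k)"
  using square_integrable_imp_integrable[of "mart k"] mart_diff_moment[of 0 k] by (simp add: mart_def[of 0])

end

text \<open>Each difference of consecutive \<open>J\<close> may be as large as \<open>2 * A\<close>,
  so summing absolute values would cost a factor \<open>t - s\<close>. Summation by parts against
  increasing weights leaves a bound free of the number of terms.\<close>

lemma Abel_summation_bound:
  fixes c :: "nat \<Rightarrow> real" and J :: "nat \<Rightarrow> complex"
  assumes st: "s \<le> t" and c: "\<And>l. 0 \<le> c l" "\<And>l. c l \<le> c (Suc l)" and J: "\<And>l. s \<le> l \<Longrightarrow> cmod (J l) \<le> A"
  shows "cmod (\<Sum>l=s..<t. of_real (c (Suc l)) * (J l - J (Suc l))) \<le> 2 * c t * A"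
proof -
  \<comment> \<open>Strengthened by the boundary term: with it the sum grows by
    \<open>(c (Suc t) - c t) * J t\<close> in each step, and the bounds \<open>c t * A\<close> add
    up exactly.\<close>
  have "cmod ((\<Sum>l=s..<t. of_real (c (Suc l)) * (J l - J (Suc l))) + of_real (c t) * J t) \<le> c t * A"
    using st
  proof (induction t rule: dec_induct)
    case base
    then show ?case using c(1)[of s] J[of s] by (simp add: norm_mult mult_left_mono)
  next
    case (step t)
    have "(\<Sum>l=s..<Suc t. of_real (c (Suc l)) * (J l - J (Suc l))) + of_real (c (Suc t)) * J (Suc t) =
        ((\<Sum>l=s..<t. of_real (c (Suc l)) * (J l - J (Suc l))) + of_real (c t) * J t) +
            of_real (c (Suc t) - c t) * J t"
      using step by (simp add: algebra_simps)
    also have "cmod \<dots> \<le> c t * A + (c (Suc t) - c t) * A"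
    proof (rule norm_triangle_mono[OF step.IH])
      show "cmod (complex_of_real (c (Suc t) - c t) * J t) \<le> (c (Suc t) - c t) * A"
        unfolding norm_mult norm_of_real using c(2)[of t] J[of t] step by (intro mult_mono) auto
    qed
    finally show ?case by (simp add: algebra_simps)
  qed
  moreover have "cmod (of_real (c t) * J t) \<le> c t * A"
    using c(1)[of t] J[of t] st by (simp add: norm_mult mult_left_mono)
  moreover have "cmod (\<Sum>l=s..<t. of_real (c (Suc l)) * (J l - J (Suc l))) \<le>
      cmod ((\<Sum>l=s..<t. of_real (c (Suc l)) * (J l - J (Suc l))) + of_real (c t) * J t) +
          cmod (of_real (c t) * J t)"
    using norm_triangle_ineq4[of "(\<Sum>l=s..<t. of_real (c (Suc l)) * (J l - J (Suc l))) +
        of_real (c t) * J t" "of_real (c t) * J t"]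
    by (simp only: add_diff_cancel_right')
  ultimately show ?thesis by linarith
qed

section \<open>Poisson equation and characteristic functions of the increments\<close>

context gaussian_chain_martingale begin

text \<open>Solution of the Poisson equation \<open>g - P g = V - \<kappa>\<^sup>2\<close>, where
  \<open>P\<close> is the transition operator and \<open>V\<close> the conditional variance:
  \<open>P\<close> is diagonal in the Hermite basis with eigenvalues \<open>a ^ r\<close>. The
  constant mode has eigenvalue 1 and is the mean already split off.\<close>

definition corrector :: "nat \<Rightarrow> real" where
  "corrector r = (if r = 0 then 0 else cond_var r / (1 - a ^ r))"

text \<open>\<open>1 - a\<close> is the spectral gap, a lower bound for \<open>1 - a ^ r\<close>
  with \<open>r >= 1\<close>.\<close>

definition corrector_bound :: real where
  "corrector_bound = variance_const d * \<kappa>\<^sup>2 / (1 - a)"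

lemma corrector_bound_nonneg: "0 \<le> corrector_bound"
  unfolding corrector_bound_def using a variance_const_nonneg by simp

lemma corrector_bound:
  assumes "r \<le> 2 * d" shows "\<bar>corrector r\<bar> \<le> corrector_bound"
proof (cases "r = 0")
  case False
  then have "a ^ r \<le> a ^ 1" using a by (intro power_decreasing) auto
  then have r: "1 - a \<le> 1 - a ^ r" by simp
  have "\<bar>corrector r\<bar> = \<bar>cond_var r\<bar> / (1 - a ^ r)"
    using False r a by (simp add: corrector_def abs_divide)
  also have "\<dots> \<le> corrector_bound"
    unfolding corrector_bound_def using cond_var(2)[OF assms] r a by (intro frac_le) auto
  finally show ?thesis .
qed (simp add: corrector_def corrector_bound_nonneg)

lemma Poisson_equation:
  "hermite_sum (2 * d) cond_var x =
   \<kappa>\<^sup>2 + hermite_sum (2 * d) corrector x - hermite_sum (2 * d) (\<lambda>r. a ^ r * corrector r) x"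
proof -
  have "cond_var r * hermite r x = (if r = 0 then \<kappa>\<^sup>2 else 0) +
      corrector r * hermite r x - a ^ r * corrector r * hermite r x" for r
  proof (cases "r = 0")
    case False
    then have "a ^ r \<le> a ^ 1" using a by (intro power_decreasing) auto
    then have "1 - a ^ r \<noteq> 0" using a by simp
    then have *: "cond_var r = corrector r - a ^ r * corrector r"
      using False by (simp add: corrector_def divide_simps) (simp add: algebra_simps)
    show ?thesis using False by (subst *) (simp add: left_diff_distrib)
  qed (simp add: corrector_def cond_var(3))
  then have "hermite_sum (2 * d) cond_var x = (\<Sum>r\<le>2 * d. (if r = 0 then \<kappa>\<^sup>2 else 0) +
      corrector r * hermite r x - a ^ r * corrector r * hermite r x)"
    unfolding hermite_sum_def by simp
  then show ?thesis unfolding hermite_sum_def by (simp add: sum.distrib sum_subtractf)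
qed

lemma hermite_sum_dominated:
  assumes "\<And>q. q \<le> 2 * d \<Longrightarrow> \<bar>v q\<bar> \<le> A"
  shows "\<bar>hermite_sum (2 * d) v (\<xi> k \<omega>)\<bar> \<le> A * Dom k \<omega>"
proof -
  have A: "0 \<le> A" using assms[of 0] by simp
  have "\<bar>hermite_sum (2 * d) v (\<xi> k \<omega>)\<bar> \<le> A * hermite_abs (2 * d) (\<xi> k \<omega>)"
    by (rule hermite_sum_bound) (use assms in auto)
  also have "\<dots> \<le> A * Dom k \<omega>"
    unfolding dominator_def using A hermite_abs_ge_1[of "2 * d" "\<xi> k \<omega>"] hermite_abs_ge_1[of "2 * d" "e
        (Suc k) \<omega>"]
    by (intro mult_left_mono) (auto simp: mult_left_le_one_le mult_le_cancel_left1)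
  finally show ?thesis .
qed

text \<open>In this order: the cubic Taylor remainder of the exponential, the gap between
  \<open>1 - \<theta>\<close> and \<open>exp (- \<theta>)\<close> for
  \<open>\<theta> = u\<^sup>2 * \<kappa>\<^sup>2 / 2\<close>, and the price of moving the corrector
  from one time to the next.\<close>

definition step_error :: "real \<Rightarrow> real" where
  "step_error u = \<bar>u\<bar> ^ 3 * (\<kappa> * K) ^ 3 * \<mu> / 6 + (u\<^sup>2 * \<kappa>\<^sup>2 / 2)\<^sup>2 / 2 +
     u\<^sup>2 / 2 * (u\<^sup>2 / 2 * (\<kappa> * K)\<^sup>2 * corrector_bound * \<mu> + \<bar>u\<bar> * (\<kappa> * K) * (b * corrector_bound * K) * \<mu>)"

text \<open>Taylor expansion leaves the conditional variance
  \<open>V = \<kappa>\<^sup>2 + g - P g\<close> times the weight. The part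
  \<open>\<kappa>\<^sup>2\<close> yields the Gaussian factor. The rest is written as
  \<open>g\<close> at time \<open>l\<close> under the weight \<open>\<Phi>\<close> minus
  \<open>g\<close> at time \<open>Suc l\<close> under the weight updated by
  \<open>iexp (u * incr l \<omega>)\<close>, a form that telescopes over \<open>l\<close>.\<close>

lemma char_step:
  fixes \<Phi> :: "'a \<Rightarrow> complex" and u :: real
  assumes \<Phi>: "\<Phi> \<in> borel_measurable (F l)" and \<Phi>1: "\<And>\<omega>. cmod (\<Phi> \<omega>) \<le> 1"
  shows "cmod ((\<integral>\<omega>. iexp (u * incr l \<omega>) * \<Phi> \<omega> \<partial>M) - of_real (exp (- (u\<^sup>2 * \<kappa>\<^sup>2 / 2))) * (\<integral>\<omega>. \<Phi> \<omega> \<partial>M) +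
     of_real (u\<^sup>2 / 2) * ((\<integral>\<omega>. of_real (hermite_sum (2 * d) corrector (\<xi> l \<omega>)) * \<Phi> \<omega> \<partial>M) -
       (\<integral>\<omega>. of_real (hermite_sum (2 * d) corrector (\<xi> (Suc l) \<omega>)) * (iexp (u * incr l \<omega>) * \<Phi> \<omega>) \<partial>M))) \<le>
           step_error u"
proof -
  define \<theta> where "\<theta> = u\<^sup>2 * \<kappa>\<^sup>2 / 2"
  define g where "g \<omega> = hermite_sum (2 * d) corrector (\<xi> l \<omega>)" for \<omega>
  define g' where "g' \<omega> = hermite_sum (2 * d) corrector (\<xi> (Suc l) \<omega>)" for \<omega>
  define Pg where "Pg \<omega> = hermite_sum (2 * d) (\<lambda>r. a ^ r * corrector r) (\<xi> l \<omega>)" for \<omega>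
  define gs where "gs \<omega> = hermite_step a b (2 * d) corrector (\<xi> l \<omega>) (e (Suc l) \<omega>)" for \<omega>
  define V where "V \<omega> = hermite_sum (2 * d) cond_var (\<xi> l \<omega>)" for \<omega>
  define D where "D \<omega> = incr l \<omega>" for \<omega>
  have \<Phi>m[measurable]: "\<Phi> \<in> borel_measurable M" using F_measurable_M[OF \<Phi>] .
  have [measurable]: "g \<in> borel_measurable M" "g' \<in> borel_measurable M" "Pg \<in> borel_measurable M" "gs \<in>
      borel_measurable M"
      "V \<in> borel_measurable M" "D \<in> borel_measurable M"
    unfolding g_def[abs_def] g'_def[abs_def] Pg_def[abs_def] gs_def[abs_def] V_def[abs_def] D_def[abs_def]
        by measurable
  let ?I = "\<lambda>\<omega>. iexp (u * D \<omega>)"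
  let ?A = corrector_bound
  note A0 = corrector_bound_nonneg
  have Dom13: "Dom l \<omega> \<le> Dom l \<omega> ^ 3" and Dom23: "Dom l \<omega> ^ 2 \<le> Dom l \<omega> ^ 3" for \<omega>
    using Dom_power[of 1 3 l \<omega>] Dom_power[of 2 3 l \<omega>] by auto
  have Dom0: "0 \<le> Dom l \<omega>" for \<omega> using Dom_ge_1[of l \<omega>] by linarith
  have Db: "\<bar>D \<omega>\<bar> \<le> \<kappa> * K * Dom l \<omega>" for \<omega> using incr_bound[of l \<omega>] by (simp add: D_def mult.assoc)
  have gb: "\<bar>g \<omega>\<bar> \<le> ?A * Dom l \<omega>" for \<omega> unfolding g_def by (rule hermite_sum_dominated[OF corrector_bound])
  have Pgb: "\<bar>Pg \<omega>\<bar> \<le> ?A * Dom l \<omega>" for \<omega> unfolding Pg_def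
  proof (rule hermite_sum_dominated)
    fix q assume q: "q \<le> 2 * d"
    have "\<bar>a ^ q * corrector q\<bar> \<le> 1 * ?A"
      unfolding abs_mult using a q by (intro mult_mono corrector_bound) (auto simp: power_le_one)
    then show "\<bar>a ^ q * corrector q\<bar> \<le> ?A" by simp
  qed
  have gsb: "\<bar>gs \<omega>\<bar> \<le> b * ?A * K * Dom l \<omega>" for \<omega>
    unfolding gs_def using hermite_step_dominated[OF order_refl corrector_bound A0, where k = l and \<omega> = \<omega>]
        by (simp add: mult.assoc)
  have \<kappa>K: "0 < \<kappa> * K" using \<kappa> K_pos by simp
  have D2b: "(D \<omega>)\<^sup>2 \<le> (\<kappa> * K)\<^sup>2 * Dom l \<omega> ^ 2" for \<omega>
    using power_mono[OF Db[of \<omega>] abs_ge_zero, of 2] by (simp add: power_mult_distrib)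
  \<comment> \<open>The corrector at the next time is its conditional mean \<open>Pg\<close> plus
    the centred step \<open>gs\<close>.\<close>
  have g'_eq: "g' \<omega> = Pg \<omega> + gs \<omega>" if "\<omega> \<in> space M" for \<omega>
    unfolding g'_def Pg_def gs_def hermite_step_def \<xi>_Suc[OF that] by simp
  have V_eq: "V \<omega> = \<kappa>\<^sup>2 + g \<omega> - Pg \<omega>" for \<omega>
    unfolding V_def g_def Pg_def by (rule Poisson_equation)
  have e1: "cmod (?I \<omega> - 1) \<le> \<bar>u\<bar> * (\<kappa> * K * Dom l \<omega>)" for \<omega>
  proof -
    have "cmod (?I \<omega> - 1) \<le> \<bar>u * D \<omega>\<bar>" using iexp_approx1[of "u * D \<omega>" 0] by simp
    also have "\<dots> \<le> \<bar>u\<bar> * (\<kappa> * K * Dom l \<omega>)" unfolding abs_mult by (intro mult_left_mono Db) auto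
    finally show ?thesis .
  qed
  have e2: "cmod (?I \<omega> - 1 - \<i> * of_real (u * D \<omega>)) \<le> u\<^sup>2 / 2 * ((\<kappa> * K)\<^sup>2 * Dom l \<omega> ^ 2)" for \<omega>
  proof -
    have "cmod (?I \<omega> - 1 - \<i> * of_real (u * D \<omega>)) \<le> \<bar>u * D \<omega>\<bar>\<^sup>2 / 2"
      using iexp_approx1[of "u * D \<omega>" 1] by (simp add: numeral_2_eq_2 diff_diff_eq)
    also have "\<dots> = u\<^sup>2 / 2 * (D \<omega>)\<^sup>2" by (simp add: power_mult_distrib)
    also have "\<dots> \<le> u\<^sup>2 / 2 * ((\<kappa> * K)\<^sup>2 * Dom l \<omega> ^ 2)" by (intro mult_left_mono D2b) auto
    finally show ?thesis .
  qed
  have e3: "cmod (?I \<omega> - 1 - \<i> * of_real (u * D \<omega>) + of_real (u\<^sup>2 / 2 * (D \<omega>)\<^sup>2)) \<le>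
      \<bar>u\<bar> ^ 3 * (\<kappa> * K) ^ 3 / 6 * Dom l \<omega> ^ 3" for \<omega>
  proof -
    have "?I \<omega> - 1 - \<i> * of_real (u * D \<omega>) + of_real (u\<^sup>2 / 2 * (D \<omega>)\<^sup>2) =
        ?I \<omega> - (\<Sum>k\<le>2. (\<i> * of_real (u * D \<omega>)) ^ k / fact k)"
      by (simp add: numeral_2_eq_2 power2_eq_square algebra_simps)
    then have "cmod (?I \<omega> - 1 - \<i> * of_real (u * D \<omega>) + of_real (u\<^sup>2 / 2 * (D \<omega>)\<^sup>2)) \<le>
        \<bar>u * D \<omega>\<bar> ^ Suc 2 / fact (Suc 2)"
      using iexp_approx1[of "u * D \<omega>" 2] by (simp only:)
    also have "\<dots> = \<bar>u * D \<omega>\<bar> ^ 3 / 6" by (simp add: eval_nat_numeral)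
    also have "\<dots> = \<bar>u\<bar> ^ 3 / 6 * \<bar>D \<omega>\<bar> ^ 3" by (simp add: abs_mult power_mult_distrib)
    also have "\<dots> \<le> \<bar>u\<bar> ^ 3 / 6 * (\<kappa> * K * Dom l \<omega>) ^ 3" by (intro mult_left_mono power_mono Db) auto
    finally show ?thesis by (simp add: power_mult_distrib)
  qed
  have dom: "norm (z * \<Phi> \<omega>) \<le> C * Dom l \<omega> ^ 3" if "norm z \<le> C * Dom l \<omega> ^ 3" for z C \<omega>
    using mult_mono[OF that \<Phi>1[of \<omega>]] that by (simp add: norm_mult order_trans[OF norm_ge_zero])
  have up: "x \<le> C * Dom l \<omega> ^ 3" if "x \<le> C * Dom l \<omega>" "0 \<le> C" for x C \<omega>
    using that Dom13[of \<omega>] by (meson mult_left_mono order_trans)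
  have up2: "x \<le> C * Dom l \<omega> ^ 3" if "x \<le> C * Dom l \<omega> ^ 2" "0 \<le> C" for x C \<omega>
    using that Dom23[of \<omega>] by (meson mult_left_mono order_trans)
  \<comment> \<open>\<open>f2\<close>, \<open>f5\<close> and \<open>f7\<close> are a centred step
    times a weight of the past and integrate to 0. \<open>f1\<close>, \<open>f4\<close> and
    \<open>f6\<close> are the errors: \<open>Pg\<close> needs the quadratic remainder, while
    \<open>gs\<close> already carries a factor \<open>b\<close> and is content with the linear
    one.\<close>
  define f1 where "f1 \<omega> = (?I \<omega> - 1 - \<i> * of_real (u * D \<omega>) + of_real (u\<^sup>2 / 2 * (D \<omega>)\<^sup>2)) * \<Phi> \<omega>" for \<omega>
  define f2 where "f2 \<omega> = of_real (D \<omega>) * \<Phi> \<omega>" for \<omega>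
  define f3 where "f3 \<omega> = of_real ((D \<omega>)\<^sup>2) * \<Phi> \<omega>" for \<omega>
  define fg where "fg \<omega> = of_real (g \<omega>) * \<Phi> \<omega>" for \<omega>
  define fP where "fP \<omega> = of_real (Pg \<omega>) * \<Phi> \<omega>" for \<omega>
  define f4 where "f4 \<omega> = of_real (Pg \<omega>) * (?I \<omega> - 1 - \<i> * of_real (u * D \<omega>)) * \<Phi> \<omega>" for \<omega>
  define f5 where "f5 \<omega> = of_real (D \<omega>) * (of_real (Pg \<omega>) * \<Phi> \<omega>)" for \<omega>
  define f6 where "f6 \<omega> = of_real (gs \<omega>) * (?I \<omega> - 1) * \<Phi> \<omega>" for \<omega>
  define f7 where "f7 \<omega> = of_real (gs \<omega>) * \<Phi> \<omega>" for \<omega>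
  have m[measurable]: "f1 \<in> borel_measurable M" "f2 \<in> borel_measurable M" "f3 \<in> borel_measurable M" "fg \<in>
      borel_measurable M"
     "fP \<in> borel_measurable M" "f4 \<in> borel_measurable M" "f5 \<in> borel_measurable M" "f6 \<in> borel_measurable
         M" "f7 \<in> borel_measurable M"
    unfolding f1_def[abs_def] f2_def[abs_def] f3_def[abs_def] fg_def[abs_def] fP_def[abs_def]
        f4_def[abs_def] f5_def[abs_def] f6_def[abs_def] f7_def[abs_def]
    by measurable
  have b1: "norm (f1 \<omega>) \<le> (\<bar>u\<bar> ^ 3 * (\<kappa> * K) ^ 3 / 6) * Dom l \<omega> ^ 3" for \<omega>
    unfolding f1_def by (rule dom[OF e3])
  have b2: "norm (f2 \<omega>) \<le> (\<kappa> * K) * Dom l \<omega> ^ 3" for \<omega>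
    unfolding f2_def by (rule dom[OF up]) (use Db \<kappa>K in auto)
  have b3: "norm (f3 \<omega>) \<le> (\<kappa> * K)\<^sup>2 * Dom l \<omega> ^ 3" for \<omega>
    unfolding f3_def by (rule dom[OF up2]) (simp_all only: norm_of_real abs_power2 D2b zero_le_power2)
  have bg: "norm (fg \<omega>) \<le> ?A * Dom l \<omega> ^ 3" for \<omega>
    unfolding fg_def by (rule dom[OF up]) (use gb A0 in auto)
  have bP: "norm (fP \<omega>) \<le> ?A * Dom l \<omega> ^ 3" for \<omega>
    unfolding fP_def by (rule dom[OF up]) (use Pgb A0 in auto)
  have b4: "norm (f4 \<omega>) \<le> (u\<^sup>2 / 2 * (\<kappa> * K)\<^sup>2 * ?A) * Dom l \<omega> ^ 3" for \<omega>
    unfolding f4_def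
  proof (rule dom)
    have "norm (of_real (Pg \<omega>) * (?I \<omega> - 1 - \<i> * of_real (u * D \<omega>))) \<le>
        (?A * Dom l \<omega>) * (u\<^sup>2 / 2 * ((\<kappa> * K)\<^sup>2 * Dom l \<omega> ^ 2))"
      unfolding norm_mult norm_of_real using A0 Dom0 by (intro mult_mono Pgb e2) auto
    also have "\<dots> = (u\<^sup>2 / 2 * (\<kappa> * K)\<^sup>2 * ?A) * Dom l \<omega> ^ 3" by (simp add: power3_eq_cube power2_eq_square)
    finally show "norm (of_real (Pg \<omega>) * (?I \<omega> - 1 - \<i> * of_real (u * D \<omega>))) \<le>
        (u\<^sup>2 / 2 * (\<kappa> * K)\<^sup>2 * ?A) * Dom l \<omega> ^ 3" .
  qed
  have b5: "norm (f5 \<omega>) \<le> (\<kappa> * K * ?A) * Dom l \<omega> ^ 3" for \<omega>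
    unfolding f5_def mult.assoc[symmetric]
  proof (rule dom[OF up2])
    have "norm (of_real (D \<omega>) * of_real (Pg \<omega>) :: complex) \<le> (\<kappa> * K * Dom l \<omega>) * (?A * Dom l \<omega>)"
      unfolding norm_mult norm_of_real using \<kappa>K Dom0 by (intro mult_mono Pgb Db) auto
    then show "norm (of_real (D \<omega>) * of_real (Pg \<omega>) :: complex) \<le> (\<kappa> * K * ?A) * Dom l \<omega> ^ 2"
        by (simp add: power2_eq_square mult_ac)
  qed (use \<kappa>K A0 in simp)
  have b6: "norm (f6 \<omega>) \<le> (\<bar>u\<bar> * (\<kappa> * K) * (b * ?A * K)) * Dom l \<omega> ^ 3" for \<omega>
    unfolding f6_def
  proof (rule dom[OF up2])
    have "norm (of_real (gs \<omega>) * (?I \<omega> - 1)) \<le> (b * ?A * K * Dom l \<omega>) * (\<bar>u\<bar> * (\<kappa> * K * Dom l \<omega>))"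
      unfolding norm_mult norm_of_real using A0 b K_pos Dom0 by (intro mult_mono gsb e1) auto
    then show "norm (of_real (gs \<omega>) * (?I \<omega> - 1)) \<le> (\<bar>u\<bar> * (\<kappa> * K) * (b * ?A * K)) * Dom l \<omega> ^ 2"
        by (simp add: power2_eq_square mult_ac)
  qed (use \<kappa>K A0 b K_pos in simp)
  have b7: "norm (f7 \<omega>) \<le> (b * ?A * K) * Dom l \<omega> ^ 3" for \<omega>
    unfolding f7_def by (rule dom[OF up]) (use gsb A0 b K_pos in auto)
  note i1 = integrable_dominated(1)[OF m(1) b1] and i2 = integrable_dominated(1)[OF m(2) b2] and i3 =
      integrable_dominated(1)[OF m(3) b3]
    and ig = integrable_dominated(1)[OF m(4) bg] and iP = integrable_dominated(1)[OF m(5) bP] and i4 =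
        integrable_dominated(1)[OF m(6) b4]
    and i5 = integrable_dominated(1)[OF m(7) b5] and i6 = integrable_dominated(1)[OF m(8) b6] and i7 =
        integrable_dominated(1)[OF m(9) b7]
  have i\<Phi>: "integrable M \<Phi>" by (rule integrable_const_bound[of _ 1]) (use \<Phi>1 in auto)
  have \<Phi>P: "(\<lambda>\<omega>. of_real (Pg \<omega>) * \<Phi> \<omega>) \<in> borel_measurable (F l)"
  proof -
    have "Pg \<in> borel_measurable (F l)" unfolding Pg_def[abs_def]
      by (rule measurable_compose[OF \<xi>_F hermite_sum_measurable])
    then show ?thesis using \<Phi> by measurable
  qed
  have z2: "(\<integral>\<omega>. f2 \<omega> \<partial>M) = 0"
    using incr_orthogonal[OF \<Phi>] i2 by (simp add: f2_def[abs_def] D_def scaleR_conv_of_real)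
  have z5: "(\<integral>\<omega>. f5 \<omega> \<partial>M) = 0"
    using incr_orthogonal[OF \<Phi>P] i5 by (simp add: f5_def[abs_def] D_def scaleR_conv_of_real)
  have z7: "(\<integral>\<omega>. f7 \<omega> \<partial>M) = 0"
    using integral_step_scaleR[OF \<Phi> integrable_hermite_step[OF ab, of "2 * d" corrector]
        hermite_step_measurable] i7
    by (simp add: f7_def[abs_def] gs_def scaleR_conv_of_real integral_hermite_step[OF ab])
  have z3: "(\<integral>\<omega>. f3 \<omega> \<partial>M) = of_real (\<kappa>\<^sup>2) * (\<integral>\<omega>. \<Phi> \<omega> \<partial>M) + (\<integral>\<omega>. fg \<omega> \<partial>M) - (\<integral>\<omega>. fP \<omega> \<partial>M)"
  proof -
    have "(\<integral>\<omega>. f3 \<omega> \<partial>M) = (\<integral>\<omega>. V \<omega> *\<^sub>R \<Phi> \<omega> \<partial>M)"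
      using integral_incr_power2[OF \<Phi>] i3 by (simp add: f3_def[abs_def] D_def V_def scaleR_conv_of_real)
    also have "\<dots> = (\<integral>\<omega>. of_real (\<kappa>\<^sup>2) * \<Phi> \<omega> + fg \<omega> - fP \<omega> \<partial>M)"
      unfolding V_eq fg_def fP_def by (simp add: scaleR_conv_of_real algebra_simps)
    also have "\<dots> = of_real (\<kappa>\<^sup>2) * (\<integral>\<omega>. \<Phi> \<omega> \<partial>M) + (\<integral>\<omega>. fg \<omega> \<partial>M) - (\<integral>\<omega>. fP \<omega> \<partial>M)"
      using i\<Phi> ig iP by simp
    finally show ?thesis .
  qed
  have "(\<integral>\<omega>. ?I \<omega> * \<Phi> \<omega> \<partial>M) = (\<integral>\<omega>. f1 \<omega> + \<i> * of_real u * f2 \<omega> - of_real (u\<^sup>2 / 2) * f3 \<omega> + \<Phi> \<omega> \<partial>M)"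
    by (intro Bochner_Integration.integral_cong refl) (simp add: f1_def f2_def f3_def algebra_simps)
  also have "\<dots> = (\<integral>\<omega>. f1 \<omega> \<partial>M) - of_real (u\<^sup>2 / 2) * (\<integral>\<omega>. f3 \<omega> \<partial>M) + (\<integral>\<omega>. \<Phi> \<omega> \<partial>M)"
    using i1 i2 i3 i\<Phi> by (simp add: z2)
  finally have E1: "(\<integral>\<omega>. ?I \<omega> * \<Phi> \<omega> \<partial>M) = (\<integral>\<omega>. f1 \<omega> \<partial>M) - of_real (u\<^sup>2 / 2) * (\<integral>\<omega>. f3 \<omega> \<partial>M) +
      (\<integral>\<omega>. \<Phi> \<omega> \<partial>M)" .
  have "(\<integral>\<omega>. of_real (g' \<omega>) * (?I \<omega> * \<Phi> \<omega>) \<partial>M) = (\<integral>\<omega>. fP \<omega> + \<i> * of_real u * f5 \<omega> + f4 \<omega> + f7 \<omega> + f6 \<omega> \<partial>M)"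
    by (intro Bochner_Integration.integral_cong refl) (simp add: g'_eq fP_def f4_def f5_def f6_def f7_def
        algebra_simps)
  also have "\<dots> = (\<integral>\<omega>. fP \<omega> \<partial>M) + (\<integral>\<omega>. f4 \<omega> \<partial>M) + (\<integral>\<omega>. f6 \<omega> \<partial>M)"
    using iP i4 i5 i6 i7 by (simp add: z5 z7)
  finally have E2: "(\<integral>\<omega>. of_real (g' \<omega>) * (?I \<omega> * \<Phi> \<omega>) \<partial>M) = (\<integral>\<omega>. fP \<omega> \<partial>M) + (\<integral>\<omega>. f4 \<omega> \<partial>M) +
      (\<integral>\<omega>. f6 \<omega> \<partial>M)" .
  have "(\<integral>\<omega>. ?I \<omega> * \<Phi> \<omega> \<partial>M) - of_real (exp (- \<theta>)) * (\<integral>\<omega>. \<Phi> \<omega> \<partial>M) +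
      of_real (u\<^sup>2 / 2) * ((\<integral>\<omega>. fg \<omega> \<partial>M) - (\<integral>\<omega>. of_real (g' \<omega>) * (?I \<omega> * \<Phi> \<omega>) \<partial>M)) =
      (\<integral>\<omega>. f1 \<omega> \<partial>M) + of_real (1 - \<theta> - exp (- \<theta>)) * (\<integral>\<omega>. \<Phi> \<omega> \<partial>M) - of_real (u\<^sup>2 / 2) * ((\<integral>\<omega>. f4 \<omega> \<partial>M) +
          (\<integral>\<omega>. f6 \<omega> \<partial>M))"
  proof -
    define r :: complex where "r = of_real (u\<^sup>2 / 2)"
    have \<theta>r: "of_real \<theta> = r * of_real (\<kappa>\<^sup>2)" by (simp add: \<theta>_def r_def)
    show ?thesis unfolding E1 E2 z3 of_real_diff of_real_1 \<theta>r r_def[symmetric] by (simp add: algebra_simps)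
  qed
  also have "cmod \<dots> \<le> step_error u"
  proof -
    have "0 \<le> \<theta>" by (simp add: \<theta>_def)
    \<comment> \<open>From the quadratic lower bound for \<open>exp \<theta>\<close>, since the two
      quadratics multiply to \<open>1 + \<theta> ^ 4 / 4\<close>.\<close>
    have "exp (- \<theta>) \<le> 1 - \<theta> + \<theta>\<^sup>2 / 2"
    proof -
      have "(1 - \<theta> + \<theta>\<^sup>2 / 2) * (1 + \<theta> + \<theta>\<^sup>2 / 2) = 1 + (\<theta>\<^sup>2)\<^sup>2 / 4"
        by (simp add: power2_eq_square algebra_simps)
      then have "1 \<le> (1 - \<theta> + \<theta>\<^sup>2 / 2) * (1 + \<theta> + \<theta>\<^sup>2 / 2)" by simp
      also have "\<dots> \<le> (1 - \<theta> + \<theta>\<^sup>2 / 2) * exp \<theta>"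
      proof (rule mult_left_mono[OF exp_lower_Taylor_quadratic[OF \<open>0 \<le> \<theta>\<close>]])
        have "0 \<le> (1 - \<theta>)\<^sup>2" by simp
        then show "0 \<le> 1 - \<theta> + \<theta>\<^sup>2 / 2" by (simp add: power2_diff)
      qed
      finally show ?thesis by (simp add: exp_minus inverse_eq_divide pos_divide_le_eq)
    qed
    moreover have "1 - \<theta> \<le> exp (- \<theta>)" using exp_ge_add_one_self[of "- \<theta>"] by simp
    ultimately have t: "cmod (of_real (1 - \<theta> - exp (- \<theta>))) \<le> \<theta>\<^sup>2 / 2" unfolding norm_of_real by simp
    have "cmod (\<integral>\<omega>. \<Phi> \<omega> \<partial>M) \<le> (\<integral>\<omega>. 1 \<partial>M)"
      by (rule order_trans[OF integral_norm_bound integral_mono]) (use i\<Phi> \<Phi>1 in auto)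
    then have "cmod (\<integral>\<omega>. \<Phi> \<omega> \<partial>M) \<le> 1" by (simp add: prob_space)
    then have a2: "cmod (of_real (1 - \<theta> - exp (- \<theta>)) * (\<integral>\<omega>. \<Phi> \<omega> \<partial>M)) \<le> \<theta>\<^sup>2 / 2 * 1"
      unfolding norm_mult by (intro mult_mono t) auto
    have a1: "cmod (\<integral>\<omega>. f1 \<omega> \<partial>M) \<le> \<bar>u\<bar> ^ 3 * (\<kappa> * K) ^ 3 * \<mu> / 6"
      using integrable_dominated(2)[OF m(1) b1] by (simp only: times_divide_eq_left)
    have "cmod (of_real (u\<^sup>2 / 2) * ((\<integral>\<omega>. f4 \<omega> \<partial>M) + (\<integral>\<omega>. f6 \<omega> \<partial>M))) =
        u\<^sup>2 / 2 * cmod ((\<integral>\<omega>. f4 \<omega> \<partial>M) + (\<integral>\<omega>. f6 \<omega> \<partial>M))"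
      by (simp only: norm_mult norm_of_real) simp
    also have "\<dots> \<le> u\<^sup>2 / 2 * (u\<^sup>2 / 2 * (\<kappa> * K)\<^sup>2 * ?A * \<mu> + \<bar>u\<bar> * (\<kappa> * K) * (b * ?A * K) * \<mu>)"
      by (intro mult_left_mono norm_triangle_mono integrable_dominated(2)[OF m(6) b4]
          integrable_dominated(2)[OF m(8) b6]) simp
    finally have a3: "cmod (of_real (u\<^sup>2 / 2) * ((\<integral>\<omega>. f4 \<omega> \<partial>M) + (\<integral>\<omega>. f6 \<omega> \<partial>M))) \<le>
        u\<^sup>2 / 2 * (u\<^sup>2 / 2 * (\<kappa> * K)\<^sup>2 * ?A * \<mu> + \<bar>u\<bar> * (\<kappa> * K) * (b * ?A * K) * \<mu>)" .
    have tri: "cmod (x + y - z) \<le> cmod x + cmod y + cmod z" for x y z :: complex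
      by (meson add_right_mono norm_triangle_ineq norm_triangle_ineq4 order_trans)
    show ?thesis
      by (rule order_trans[OF tri]) (use a1 a2 a3 in \<open>unfold step_error_def \<theta>_def[symmetric], linarith\<close>)
  qed
  finally show ?thesis unfolding fg_def g_def g'_def D_def \<theta>_def by simp
qed

text \<open>The second summand is the boundary cost of the telescoping corrector; it is independent
  of the number \<open>N\<close> of steps.\<close>

definition char_error :: "nat \<Rightarrow> real \<Rightarrow> real" where
  "char_error N u = real N * step_error u + u\<^sup>2 * corrector_bound * \<mu>"

text \<open>The one-step comparison is iterated with discount \<open>exp (- \<theta>)\<close>.
  Carrying along a weight \<open>W\<close> of the past at time \<open>s\<close> is what later yields
  asymptotic independence of consecutive blocks.\<close>

lemma char_bound:
  fixes W :: "'a \<Rightarrow> real" and u :: real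
  assumes st: "s \<le> t" and W: "W \<in> borel_measurable (F s)" and W1: "\<And>\<omega>. \<bar>W \<omega>\<bar> \<le> 1"
  shows "cmod ((\<integral>\<omega>. of_real (W \<omega>) * iexp (u * (mart t \<omega> - mart s \<omega>)) \<partial>M) -
      of_real (exp (- (u\<^sup>2 * (real (t - s) * \<kappa>\<^sup>2) / 2))) * (\<integral>\<omega>. of_real (W \<omega>) \<partial>M)) \<le> char_error (t - s) u"
proof -
  define \<theta> where "\<theta> = u\<^sup>2 * \<kappa>\<^sup>2 / 2"
  have \<theta>: "0 \<le> \<theta>" by (simp add: \<theta>_def)
  define \<Phi> where "\<Phi> l \<omega> = of_real (W \<omega>) * iexp (u * (mart l \<omega> - mart s \<omega>))" for l \<omega>
  \<comment> \<open>Discount factors from time \<open>l\<close> to \<open>t\<close>: increasing in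
    \<open>l\<close>, as required by \<open>Abel_summation_bound\<close>.\<close>
  define c where "c l = exp (- \<theta> * (real t - real l))" for l
  define E where "E l = (\<integral>\<omega>. \<Phi> l \<omega> \<partial>M)" for l
  define J where "J l = (\<integral>\<omega>. of_real (hermite_sum (2 * d) corrector (\<xi> l \<omega>)) * \<Phi> l \<omega> \<partial>M)" for l
  have \<Phi>F: "\<Phi> l \<in> borel_measurable (F l)" if "s \<le> l" for l
  proof -
    have [measurable]: "W \<in> borel_measurable (F l)" "mart s \<in> borel_measurable (F l)" "mart l \<in>
        borel_measurable (F l)"
      using F_measurable_mono[OF W that] F_measurable_mono[OF mart_F that] mart_F by auto
    show ?thesis unfolding \<Phi>_def[abs_def] by measurable
  qed
  have \<Phi>1: "cmod (\<Phi> l \<omega>) \<le> 1" for l \<omega> unfolding \<Phi>_def by (simp add: norm_mult W1)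
  have \<Phi>_Suc: "\<Phi> (Suc l) \<omega> = iexp (u * incr l \<omega>) * \<Phi> l \<omega>" for l \<omega>
    unfolding \<Phi>_def mart_def by (simp add: exp_add[symmetric] algebra_simps)
  have c: "0 \<le> c l" "c l \<le> c (Suc l)" "c l = c (Suc l) * exp (- \<theta>)" for l
    unfolding c_def using \<theta> by (auto simp: exp_add[symmetric] algebra_simps)
  have c_le: "c l \<le> 1" if "l \<le> t" for l unfolding c_def using \<theta> that by simp
  have step: "cmod (E (Suc l) - of_real (exp (- \<theta>)) * E l + of_real (u\<^sup>2 / 2) * (J l - J (Suc l))) \<le>
      step_error u" if "s \<le> l" for l
    using char_step[OF \<Phi>F[OF that] \<Phi>1, of u] unfolding E_def J_def \<Phi>_Suc \<theta>_def .
  have Jb: "cmod (J l) \<le> corrector_bound * \<mu>" if "s \<le> l" for l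
    unfolding J_def
  proof (rule integrable_dominated(2)[of _ _ _ l])
    show "(\<lambda>\<omega>. of_real (hermite_sum (2 * d) corrector (\<xi> l \<omega>)) * \<Phi> l \<omega>) \<in> borel_measurable M"
      using F_measurable_M[OF \<Phi>F[OF that]] by measurable
    fix \<omega>
    have "cmod (of_real (hermite_sum (2 * d) corrector (\<xi> l \<omega>)) * \<Phi> l \<omega>) \<le> (corrector_bound * Dom l \<omega>) * 1"
      unfolding norm_mult norm_of_real using corrector_bound_nonneg Dom_ge_1[of l \<omega>]
      by (intro mult_mono hermite_sum_dominated corrector_bound \<Phi>1) auto
    also have "\<dots> \<le> corrector_bound * Dom l \<omega> ^ 3"
      using corrector_bound_nonneg Dom_power[of 1 3 l \<omega>] by (simp add: mult_left_mono)
    finally show "cmod (of_real (hermite_sum (2 * d) corrector (\<xi> l \<omega>)) * \<Phi> l \<omega>) \<le>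
        corrector_bound * Dom l \<omega> ^ 3" .
  qed
  define S1 where "S1 = (\<Sum>l=s..<t. of_real (c (Suc l)) * (E (Suc l) - of_real (exp (- \<theta>)) * E l +
      of_real (u\<^sup>2 / 2) * (J l - J (Suc l))))"
  define S2 where "S2 = (\<Sum>l=s..<t. of_real (c (Suc l)) * (J l - J (Suc l)))"
  have "E t - of_real (c s) * E s = of_real (c t) * E t - of_real (c s) * E s" by (simp add: c_def)
  also have "\<dots> = (\<Sum>l=s..<t. of_real (c (Suc l)) * E (Suc l) - of_real (c l) * E l)"
    using st by (rule sum_Suc_diff'[symmetric])
  also have "\<dots> = S1 - of_real (u\<^sup>2 / 2) * S2"
    unfolding S1_def S2_def sum_distrib_left sum_subtractf[symmetric]
  proof (intro sum.cong refl)
    fix l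
    show "of_real (c (Suc l)) * E (Suc l) - of_real (c l) * E l =
        of_real (c (Suc l)) * (E (Suc l) - of_real (exp (- \<theta>)) * E l +
            of_real (u\<^sup>2 / 2) * (J l - J (Suc l))) -
        of_real (u\<^sup>2 / 2) * (of_real (c (Suc l)) * (J l - J (Suc l)))"
      unfolding c(3)[of l] of_real_mult by (simp only: algebra_simps)
  qed
  finally have eq: "E t - of_real (c s) * E s = S1 - of_real (u\<^sup>2 / 2) * S2" .
  have "cmod S1 \<le> (\<Sum>l=s..<t. 1 * step_error u)"
    unfolding S1_def
  proof (rule order_trans[OF norm_sum sum_mono])
    fix l assume l: "l \<in> {s..<t}"
    show "cmod (of_real (c (Suc l)) * (E (Suc l) - of_real (exp (- \<theta>)) * E l +
        of_real (u\<^sup>2 / 2) * (J l - J (Suc l)))) \<le> 1 * step_error u"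
      unfolding norm_mult using l c(1)[of "Suc l"] c_le[of "Suc l"] by (intro mult_mono step) auto
  qed
  then have "cmod S1 \<le> real (t - s) * step_error u" by simp
  moreover have "cmod S2 \<le> 2 * c t * (corrector_bound * \<mu>)"
    unfolding S2_def by (rule Abel_summation_bound[OF st, where c = c and J = J, OF c(1) c(2) Jb])
  then have "cmod (of_real (u\<^sup>2 / 2) * S2) \<le> u\<^sup>2 / 2 * (2 * 1 * (corrector_bound * \<mu>))"
    unfolding norm_mult norm_of_real by (intro mult_mono) (auto simp: c_def)
  moreover have "cmod (S1 - of_real (u\<^sup>2 / 2) * S2) \<le> cmod S1 + cmod (of_real (u\<^sup>2 / 2) * S2)"
    by (rule norm_triangle_ineq4)
  ultimately have "cmod (E t - of_real (c s) * E s) \<le> char_error (t - s) u"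
    unfolding eq char_error_def by linarith
  moreover have "c s = exp (- (u\<^sup>2 * (real (t - s) * \<kappa>\<^sup>2) / 2))"
    using st by (simp add: c_def \<theta>_def of_nat_diff algebra_simps)
  ultimately show ?thesis unfolding E_def \<Phi>_def by simp
qed

section \<open>Maximal inequality for the martingale\<close>

lemma mart_future_orthogonal:
  assumes kt: "k \<le> t" and \<Psi>: "\<Psi> \<in> borel_measurable (F k)" and \<Psi>1: "\<And>\<omega>. \<bar>\<Psi> \<omega>\<bar> \<le> (1 :: real)"
  shows "integrable M (\<lambda>\<omega>. (mart t \<omega> - mart k \<omega>) * \<Psi> \<omega>) \<and> (\<integral>\<omega>. (mart t \<omega> - mart k \<omega>) * \<Psi> \<omega> \<partial>M) = 0"
  using kt
proof (induction t rule: dec_induct)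
  case (step t)
  have \<Psi>t: "\<Psi> \<in> borel_measurable (F t)" using F_measurable_mono[OF \<Psi>] step by simp
  have [measurable]: "\<Psi> \<in> borel_measurable M" using F_measurable_M[OF \<Psi>] .
  have i: "integrable M (\<lambda>\<omega>. incr t \<omega> *\<^sub>R \<Psi> \<omega>)"
  proof (rule integrable_dominated(1))
    fix \<omega>
    have "\<bar>incr t \<omega>\<bar> * \<bar>\<Psi> \<omega>\<bar> \<le> \<kappa> * (K * Dom t \<omega>) * 1" using \<kappa> K_pos Dom_ge_1[of t \<omega>]
        by (intro mult_mono incr_bound \<Psi>1) auto
    also have "\<dots> \<le> \<kappa> * K * Dom t \<omega> ^ 3" using \<kappa> K_pos Dom_power[of 1 3 t \<omega>] by simp
    finally show "norm (incr t \<omega> *\<^sub>R \<Psi> \<omega>) \<le> \<kappa> * K * Dom t \<omega> ^ 3" by (simp add: abs_mult)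
  qed measurable
  have eq: "(mart (Suc t) \<omega> - mart k \<omega>) * \<Psi> \<omega> = (mart t \<omega> - mart k \<omega>) * \<Psi> \<omega> + incr t \<omega> *\<^sub>R \<Psi> \<omega>" for \<omega>
    by (simp add: mart_def algebra_simps)
  show ?case unfolding eq using step.IH i incr_orthogonal[OF \<Psi>t i] by simp
qed simp

text \<open>Doob's inequality bounds the running maximum by the tail of the endpoint, which is cut at a level \<open>R\<close>:
  the part below is controlled by the limit law, the part above by the variance.\<close>

lemma maximal_inequality:
  assumes st: "s \<le> t" and \<rho>: "0 < \<rho>" and R: "0 < R"
  shows "\<rho> * prob {\<omega> \<in> space M. \<exists>k\<in>{s..t}. 2 * \<rho> < \<bar>mart k \<omega> - mart s \<omega>\<bar>} \<le>
     (\<integral>\<omega>. min ((mart t \<omega> - mart s \<omega>) ^ 4 / \<rho> ^ 3) R \<partial>M) + real (t - s) * \<kappa>\<^sup>2 / R"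
proof -
  define X where "X \<omega> = mart t \<omega> - mart s \<omega>" for \<omega>
  \<comment> \<open>First passage at time \<open>k\<close>: these events are disjoint and belong to
    the past at \<open>k\<close>.\<close>
  define A where "A k = {\<omega> \<in> space M. 2 * \<rho> < \<bar>mart k \<omega> - mart s \<omega>\<bar> \<and> (\<forall>j\<in>{s..<k}. \<bar>mart j \<omega> - mart s \<omega>\<bar> \<le>
      2 * \<rho>)}" for k
  have AF: "A k \<in> sets (F k)" if "s \<le> k" for k
  proof -
    have sp: "space (F k) = space M" using F_sub[of k] by (simp add: subalgebra_def)
    have [measurable]: "mart s \<in> borel_measurable (F k)" "mart k \<in> borel_measurable (F k)"
        using F_measurable_mono[OF mart_F that] mart_F by auto
    have "{\<omega> \<in> space (F k). \<forall>j\<in>{s..<k}. \<bar>mart j \<omega> - mart s \<omega>\<bar> \<le> 2 * \<rho>} \<in> sets (F k)"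
    proof (rule sets.sets_Collect_finite_All)
      fix j assume "j \<in> {s..<k}"
      then have [measurable]: "mart j \<in> borel_measurable (F k)" using F_measurable_mono[OF mart_F, of j k]
          by auto
      show "{\<omega> \<in> space (F k). \<bar>mart j \<omega> - mart s \<omega>\<bar> \<le> 2 * \<rho>} \<in> sets (F k)" by measurable
    qed simp
    moreover have "{\<omega> \<in> space (F k). 2 * \<rho> < \<bar>mart k \<omega> - mart s \<omega>\<bar>} \<in> sets (F k)" by measurable
    ultimately have "{\<omega> \<in> space (F k). 2 * \<rho> < \<bar>mart k \<omega> - mart s \<omega>\<bar>} \<inter> {\<omega> \<in> space (F k). \<forall>j\<in>{s..<k}.
        \<bar>mart j \<omega> - mart s \<omega>\<bar> \<le> 2 * \<rho>} \<in> sets (F k)"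
      by (rule sets.Int[rotated])
    moreover have "A k = {\<omega> \<in> space (F k). 2 * \<rho> < \<bar>mart k \<omega> - mart s \<omega>\<bar>} \<inter> {\<omega> \<in> space (F k). \<forall>j\<in>{s..<k}.
        \<bar>mart j \<omega> - mart s \<omega>\<bar> \<le> 2 * \<rho>}"
      unfolding A_def sp by blast
    ultimately show ?thesis by (simp only:)
  qed
  have AM[measurable]: "A k \<in> sets M" if "s \<le> k" for k
    using AF[OF that] F_sub[of k] by (auto simp: subalgebra_def)
  have Xi: "integrable M X" "integrable M (\<lambda>\<omega>. (X \<omega>)\<^sup>2)"
    using integrable_mart mart_diff_power2(1)[OF st] by (auto simp: X_def[abs_def])
  have [measurable]: "X \<in> borel_measurable M" unfolding X_def[abs_def] by measurable
  define p where "p = (\<Sum>k=s..t. prob (A k))"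
  define S where "S \<omega> = (\<Sum>k=s..t. indicator (A k) \<omega> :: real)" for \<omega>
  have Sm[measurable]: "S \<in> borel_measurable M"
    unfolding S_def[abs_def] by (intro borel_measurable_sum borel_measurable_indicator AM) auto
  have S01: "S \<omega> = 0 \<or> S \<omega> = 1" for \<omega>
  proof (cases "\<exists>k\<in>{s..t}. \<omega> \<in> A k")
    case True
    then obtain k where k: "k \<in> {s..t}" "\<omega> \<in> A k" by blast
    have "\<omega> \<notin> A j" if "j \<in> {s..t}" "j \<noteq> k" for j
    proof
      assume j: "\<omega> \<in> A j"
      consider "j < k" | "k < j" using \<open>j \<noteq> k\<close> by linarith
      then show False
      proof cases
        case 1
        then have "\<bar>mart j \<omega> - mart s \<omega>\<bar> \<le> 2 * \<rho>" using k(2) that by (auto simp: A_def)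
        then show False using j by (auto simp: A_def)
      next
        case 2
        then have "\<bar>mart k \<omega> - mart s \<omega>\<bar> \<le> 2 * \<rho>" using j k by (auto simp: A_def)
        then show False using k by (auto simp: A_def)
      qed
    qed
    then have "S \<omega> = (\<Sum>j\<in>{s..t}. if j = k then 1 else 0)"
      unfolding S_def using k by (intro sum.cong) (auto simp: indicator_def)
    then show ?thesis using k by simp
  next
    case False
    then show ?thesis by (simp add: S_def)
  qed
  have S1: "\<bar>S \<omega>\<bar> \<le> 1" for \<omega> using S01[of \<omega>] by auto
  have Si: "integrable M S" by (rule integrable_const_bound[of _ 1]) (use S1 in auto)
  have ES: "(\<integral>\<omega>. S \<omega> \<partial>M) = p"
    unfolding S_def p_def using AM
    by (subst Bochner_Integration.integral_sum) (auto simp: emeasure_eq_measure)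
  have XSi: "integrable M (\<lambda>\<omega>. \<bar>X \<omega>\<bar> * S \<omega>)"
    by (rule Bochner_Integration.integrable_bound[OF Xi(1)])
        (use S1 in \<open>auto intro!: AE_I2 simp: abs_mult mult_left_le\<close>)
  have Ak: "2 * \<rho> * prob (A k) \<le> (\<integral>\<omega>. \<bar>X \<omega>\<bar> * indicator (A k) \<omega> \<partial>M)" if k: "k \<in> {s..t}" for k
  proof -
    \<comment> \<open>The sign at the passage time turns the increment from \<open>s\<close> into
      its absolute value; by orthogonality of the future, \<open>mart k\<close> may be replaced by
      \<open>mart t\<close>.\<close>
    define \<Psi> where "\<Psi> \<omega> = sgn (mart k \<omega> - mart s \<omega>) * indicator (A k) \<omega>" for \<omega>
    have \<Psi>F: "\<Psi> \<in> borel_measurable (F k)"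
    proof -
      have [measurable]: "mart s \<in> borel_measurable (F k)" "mart k \<in> borel_measurable (F k)" "A k \<in> sets
          (F k)"
        using F_measurable_mono[OF mart_F, of s k] mart_F AF k by auto
      show ?thesis unfolding \<Psi>_def[abs_def] by measurable
    qed
    have \<Psi>1: "\<bar>\<Psi> \<omega>\<bar> \<le> 1" for \<omega> unfolding \<Psi>_def by (auto simp: indicator_def sgn_real_def)
    have kt: "k \<le> t" and sk: "s \<le> k" using k by auto
    have [measurable]: "A k \<in> sets M" by (rule AM[OF sk])
    have [measurable]: "\<Psi> \<in> borel_measurable M" using F_measurable_M[OF \<Psi>F] .
    have o: "integrable M (\<lambda>\<omega>. (mart t \<omega> - mart k \<omega>) * \<Psi> \<omega>)" "(\<integral>\<omega>. (mart t \<omega> - mart k \<omega>) * \<Psi> \<omega> \<partial>M) = 0"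
      using mart_future_orthogonal[OF kt \<Psi>F \<Psi>1] by auto
    have ik: "integrable M (\<lambda>\<omega>. (mart k \<omega> - mart s \<omega>) * \<Psi> \<omega>)"
    proof (rule Bochner_Integration.integrable_bound[of _ "\<lambda>\<omega>. mart k \<omega> - mart s \<omega>"])
      show "AE \<omega> in M. norm ((mart k \<omega> - mart s \<omega>) * \<Psi> \<omega>) \<le> norm (mart k \<omega> - mart s \<omega>)"
        using \<Psi>1 by (intro AE_I2) (simp add: abs_mult mult_left_le)
    qed (use integrable_mart in auto)
    have Xki: "integrable M (\<lambda>\<omega>. \<bar>X \<omega>\<bar> * indicator (A k) \<omega>)"
      by (rule Bochner_Integration.integrable_bound[OF Xi(1)]) (auto simp: indicator_def)
    have "2 * \<rho> * prob (A k) = (\<integral>\<omega>. 2 * \<rho> * indicator (A k) \<omega> \<partial>M)" by simp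
    also have "\<dots> \<le> (\<integral>\<omega>. (mart k \<omega> - mart s \<omega>) * \<Psi> \<omega> \<partial>M)"
    proof (rule integral_mono)
      show "integrable M (\<lambda>\<omega>. 2 * \<rho> * indicator (A k) \<omega>)" by (simp add: emeasure_eq_measure)
      fix \<omega>
      have "x * sgn x = \<bar>x\<bar>" for x :: real by (simp add: abs_sgn)
      then have "(mart k \<omega> - mart s \<omega>) * \<Psi> \<omega> = \<bar>mart k \<omega> - mart s \<omega>\<bar> * indicator (A k) \<omega>"
        unfolding \<Psi>_def by (metis mult.assoc)
      then show "2 * \<rho> * indicator (A k) \<omega> \<le> (mart k \<omega> - mart s \<omega>) * \<Psi> \<omega>"
        by (auto simp: indicator_def A_def)
    qed (rule ik)
    also have "\<dots> = (\<integral>\<omega>. X \<omega> * \<Psi> \<omega> \<partial>M)"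
    proof -
      have "X \<omega> * \<Psi> \<omega> = (mart t \<omega> - mart k \<omega>) * \<Psi> \<omega> + (mart k \<omega> - mart s \<omega>) * \<Psi> \<omega>" for \<omega>
        by (simp add: X_def algebra_simps)
      then show ?thesis using o ik by simp
    qed
    also have "\<dots> \<le> (\<integral>\<omega>. \<bar>X \<omega>\<bar> * indicator (A k) \<omega> \<partial>M)"
    proof (rule integral_mono)
      show "integrable M (\<lambda>\<omega>. X \<omega> * \<Psi> \<omega>)"
        by (rule Bochner_Integration.integrable_bound[OF Xi(1)])
            (use \<Psi>1 in \<open>auto intro!: AE_I2 simp: abs_mult mult_left_le\<close>)
      fix \<omega>
      show "X \<omega> * \<Psi> \<omega> \<le> \<bar>X \<omega>\<bar> * indicator (A k) \<omega>"
        unfolding \<Psi>_def by (auto simp: indicator_def sgn_real_def)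
    qed (rule Xki)
    finally show ?thesis .
  qed
  have "2 * \<rho> * p \<le> (\<Sum>k=s..t. \<integral>\<omega>. \<bar>X \<omega>\<bar> * indicator (A k) \<omega> \<partial>M)"
    unfolding p_def sum_distrib_left by (rule sum_mono) (rule Ak)
  also have "\<dots> = (\<integral>\<omega>. \<bar>X \<omega>\<bar> * S \<omega> \<partial>M)"
    unfolding S_def sum_distrib_left
  proof (rule Bochner_Integration.integral_sum[symmetric])
    fix k assume "k \<in> {s..t}"
    then have [measurable]: "A k \<in> sets M" by (intro AM) auto
    show "integrable M (\<lambda>\<omega>. \<bar>X \<omega>\<bar> * indicator (A k) \<omega>)"
      by (rule Bochner_Integration.integrable_bound[OF Xi(1)]) (auto simp: indicator_def)
  qed
  \<comment> \<open>Pointwise split of the absolute value of \<open>X\<close> at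
    \<open>\<rho>\<close> and \<open>R\<close>. Below \<open>\<rho>\<close> the term
    \<open>\<rho> * S\<close> suffices, and it consumes only half of the left side because the
    threshold is \<open>2 * \<rho>\<close>. In between the fourth power is used, above
    \<open>R\<close> the square.\<close>
  also have "\<dots> \<le> (\<integral>\<omega>. min (X \<omega> ^ 4 / \<rho> ^ 3) R + (X \<omega>)\<^sup>2 / R + \<rho> * S \<omega> \<partial>M)"
  proof (rule integral_mono[OF XSi])
    have "integrable M (\<lambda>\<omega>. min (X \<omega> ^ 4 / \<rho> ^ 3) R)"
      by (rule integrable_const_bound[of _ R]) (use R \<rho> in auto)
    then show "integrable M (\<lambda>\<omega>. min (X \<omega> ^ 4 / \<rho> ^ 3) R + (X \<omega>)\<^sup>2 / R + \<rho> * S \<omega>)" using Xi Si by simp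
    fix \<omega>
    have n: "0 \<le> min (X \<omega> ^ 4 / \<rho> ^ 3) R" "0 \<le> (X \<omega>)\<^sup>2 / R" using R \<rho> by auto
    consider "S \<omega> = 0" | "S \<omega> = 1" "\<bar>X \<omega>\<bar> \<le> \<rho>" | "S \<omega> = 1" "\<bar>X \<omega>\<bar> > \<rho>" "\<bar>X \<omega>\<bar> \<le> R" | "S \<omega> = 1" "\<bar>X \<omega>\<bar> > R"
      using S01[of \<omega>] by linarith
    then show "\<bar>X \<omega>\<bar> * S \<omega> \<le> min (X \<omega> ^ 4 / \<rho> ^ 3) R + (X \<omega>)\<^sup>2 / R + \<rho> * S \<omega>"
    proof cases
      case 2
      then show ?thesis using n \<rho> unfolding 2(1) by linarith
    next
      case 3
      have "\<bar>X \<omega>\<bar> * \<rho> ^ 3 \<le> \<bar>X \<omega>\<bar> * \<bar>X \<omega>\<bar> ^ 3"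
        using 3 \<rho> by (intro mult_left_mono power_mono) auto
      also have "\<dots> = X \<omega> ^ 4" by (simp add: power_numeral_reduce abs_mult[symmetric])
      finally have "\<bar>X \<omega>\<bar> \<le> X \<omega> ^ 4 / \<rho> ^ 3" using \<rho> by (simp add: pos_le_divide_eq)
      then have "\<bar>X \<omega>\<bar> \<le> min (X \<omega> ^ 4 / \<rho> ^ 3) R" using 3 by simp
      then show ?thesis using n \<rho> unfolding 3(1) by linarith
    next
      case 4
      have "\<bar>X \<omega>\<bar> * R \<le> \<bar>X \<omega>\<bar> * \<bar>X \<omega>\<bar>" using 4 by (intro mult_left_mono) auto
      then have "\<bar>X \<omega>\<bar> \<le> (X \<omega>)\<^sup>2 / R" using R by (simp add: pos_le_divide_eq power2_eq_square)
      then show ?thesis using n \<rho> unfolding 4(1) by linarith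
    qed (use n \<rho> in auto)
  qed
  also have "\<dots> = (\<integral>\<omega>. min (X \<omega> ^ 4 / \<rho> ^ 3) R \<partial>M) + real (t - s) * \<kappa>\<^sup>2 / R + \<rho> * p"
  proof -
    have "integrable M (\<lambda>\<omega>. min (X \<omega> ^ 4 / \<rho> ^ 3) R)"
      by (rule integrable_const_bound[of _ R]) (use R \<rho> in auto)
    moreover have "(\<integral>\<omega>. (X \<omega>)\<^sup>2 \<partial>M) = real (t - s) * \<kappa>\<^sup>2" unfolding X_def
        by (rule mart_diff_power2(2)[OF st])
    ultimately show ?thesis using Xi Si ES by simp
  qed
  finally have *: "\<rho> * p \<le> (\<integral>\<omega>. min (X \<omega> ^ 4 / \<rho> ^ 3) R \<partial>M) + real (t - s) * \<kappa>\<^sup>2 / R" by simp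
  have "{\<omega> \<in> space M. \<exists>k\<in>{s..t}. 2 * \<rho> < \<bar>mart k \<omega> - mart s \<omega>\<bar>} \<subseteq> (\<Union>k\<in>{s..t}. A k)"
  proof
    fix \<omega> assume "\<omega> \<in> {\<omega> \<in> space M. \<exists>k\<in>{s..t}. 2 * \<rho> < \<bar>mart k \<omega> - mart s \<omega>\<bar>}"
    then obtain k0 where k0: "\<omega> \<in> space M" "s \<le> k0" "k0 \<le> t" "2 * \<rho> < \<bar>mart k0 \<omega> - mart s \<omega>\<bar>" by auto
    define k where "k = (LEAST k. s \<le> k \<and> 2 * \<rho> < \<bar>mart k \<omega> - mart s \<omega>\<bar>)"
    have k: "s \<le> k \<and> 2 * \<rho> < \<bar>mart k \<omega> - mart s \<omega>\<bar>"
      unfolding k_def by (rule LeastI[of _ k0]) (use k0 in simp)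
    have "k \<le> k0" unfolding k_def by (rule Least_le) (use k0 in simp)
    then have kt: "k \<in> {s..t}" using k k0 by simp
    have "\<bar>mart j \<omega> - mart s \<omega>\<bar> \<le> 2 * \<rho>" if "j \<in> {s..<k}" for j
    proof -
      have "j < k" "s \<le> j" using that by auto
      from not_less_Least[OF this(1)[unfolded k_def]] this(2) show ?thesis by linarith
    qed
    then have "\<omega> \<in> A k" using k k0(1) unfolding A_def by blast
    then show "\<omega> \<in> (\<Union>k\<in>{s..t}. A k)" using kt by blast
  qed
  then have "prob {\<omega> \<in> space M. \<exists>k\<in>{s..t}. 2 * \<rho> < \<bar>mart k \<omega> - mart s \<omega>\<bar>} \<le> prob (\<Union>k\<in>{s..t}. A k)"
  proof (rule finite_measure_mono)
    show "(\<Union>k\<in>{s..t}. A k) \<in> sets M" by (rule sets.finite_UN[OF finite_atLeastAtMost]) (rule AM, simp)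
  qed
  also have "\<dots> \<le> p" unfolding p_def
  proof (rule finite_measure_subadditive_finite[OF finite_atLeastAtMost])
    show "A ` {s..t} \<subseteq> sets M" by (rule image_subsetI) (rule AM, simp)
  qed
  finally have "prob {\<omega> \<in> space M. \<exists>k\<in>{s..t}. 2 * \<rho> < \<bar>mart k \<omega> - mart s \<omega>\<bar>} \<le> p" .
  from mult_left_mono[OF this, of \<rho>] \<rho> *
  show ?thesis unfolding X_def by linarith
qed

end

section \<open>Arrays of chains\<close>

context gaussian_chain_martingale begin

lemma step_error_nonneg: "0 \<le> step_error u"
  unfolding step_error_def using \<kappa> K_pos b corrector_bound_nonneg
      by (intro add_nonneg_nonneg mult_nonneg_nonneg) auto

lemma char_error_mono: "N \<le> N' \<Longrightarrow> char_error N u \<le> char_error N' u"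
  unfolding char_error_def using step_error_nonneg by (intro add_right_mono mult_right_mono) auto

text \<open>Since \<open>b\<^sup>2 = (1 - a) * (1 + a)\<close>, \<open>b\<close> is of the order of
  the square root of the gap. This keeps the term with \<open>b * corrector_bound\<close> small:
  \<open>\<kappa> * b / (1 - a)\<close> is controlled by the square root of
  \<open>\<kappa>\<^sup>2 / (1 - a)\<close>.\<close>

lemma b_over_gap: "b / (1 - a) \<le> sqrt (2 / (1 - a))"
proof -
  have "b\<^sup>2 = (1 - a) * (1 + a)" using ab by (simp add: power2_eq_square algebra_simps)
  also have "\<dots> \<le> (1 - a) * 2" using a by (intro mult_left_mono) auto
  finally have "b\<^sup>2 / (1 - a)\<^sup>2 \<le> (1 - a) * 2 / (1 - a)\<^sup>2" by (rule divide_right_mono) simp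
  also have "\<dots> = 2 / (1 - a)"
  proof -
    have "x * 2 / x\<^sup>2 = 2 / x" if "x \<noteq> 0" for x :: real using that by (simp add: power2_eq_square)
    then show ?thesis using a by (metis less_irrefl right_minus_eq)
  qed
  finally show ?thesis by (intro real_le_rsqrt) (simp add: power_divide)
qed

text \<open>The row enters only through \<open>n * \<kappa>\<^sup>2\<close>, \<open>\<kappa>\<close>
  and \<open>\<kappa>\<^sup>2 / (1 - a)\<close>; all other factors depend on \<open>d\<close> and
  \<open>u\<close>.\<close>

lemma char_error_le:
  "char_error n u \<le> (real n * \<kappa>\<^sup>2) * (\<bar>u\<bar> ^ 3 * K ^ 3 * \<mu> / 6 * \<kappa> + u ^ 4 / 8 * \<kappa>\<^sup>2 +
      u ^ 4 / 4 * K\<^sup>2 * \<mu> * variance_const d * (\<kappa>\<^sup>2 / (1 - a)) +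
      u\<^sup>2 / 2 * \<bar>u\<bar> * K\<^sup>2 * \<mu> * variance_const d * sqrt (2 * (\<kappa>\<^sup>2 / (1 - a)))) +
      u\<^sup>2 * variance_const d * \<mu> * (\<kappa>\<^sup>2 / (1 - a))"
proof -
  have "\<kappa> * (b / (1 - a)) \<le> \<kappa> * sqrt (2 / (1 - a))" using \<kappa> by (intro mult_left_mono b_over_gap) auto
  also have "\<dots> = sqrt (2 * (\<kappa>\<^sup>2 / (1 - a)))"
    using \<kappa> by (simp add: real_sqrt_mult real_sqrt_divide)
  finally have *: "\<kappa> * (b / (1 - a)) \<le> sqrt (2 * (\<kappa>\<^sup>2 / (1 - a)))" .
  have "char_error n u = (real n * \<kappa>\<^sup>2) * (\<bar>u\<bar> ^ 3 * K ^ 3 * \<mu> / 6 * \<kappa> + u ^ 4 / 8 * \<kappa>\<^sup>2 +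
      u ^ 4 / 4 * K\<^sup>2 * \<mu> * variance_const d * (\<kappa>\<^sup>2 / (1 - a)) +
      u\<^sup>2 / 2 * \<bar>u\<bar> * K\<^sup>2 * \<mu> * variance_const d * (\<kappa> * (b / (1 - a)))) +
      u\<^sup>2 * variance_const d * \<mu> * (\<kappa>\<^sup>2 / (1 - a))"
    unfolding char_error_def step_error_def corrector_bound_def
    by (simp add: power2_eq_square power3_eq_cube power4_eq_xxxx algebra_simps)
  also have "\<dots> \<le> (real n * \<kappa>\<^sup>2) * (\<bar>u\<bar> ^ 3 * K ^ 3 * \<mu> / 6 * \<kappa> + u ^ 4 / 8 * \<kappa>\<^sup>2 +
      u ^ 4 / 4 * K\<^sup>2 * \<mu> * variance_const d * (\<kappa>\<^sup>2 / (1 - a)) +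
      u\<^sup>2 / 2 * \<bar>u\<bar> * K\<^sup>2 * \<mu> * variance_const d * sqrt (2 * (\<kappa>\<^sup>2 / (1 - a)))) +
      u\<^sup>2 * variance_const d * \<mu> * (\<kappa>\<^sup>2 / (1 - a))"
    using * variance_const_nonneg by (intro add_right_mono mult_left_mono add_left_mono) auto
  finally show ?thesis .
qed

end

text \<open>Rows start at \<open>n0\<close> because the sum can be normalised only once its variance
  is known to be positive. Together with \<open>total_variance\<close>, \<open>mixing\<close> says
  that the relaxation time \<open>1 / (1 - a n)\<close> is small against \<open>n\<close>.\<close>

locale gaussian_chain_array = prob_space M for M :: "'a measure" +
  fixes F :: "nat \<Rightarrow> nat \<Rightarrow> 'a measure" and \<xi> :: "nat \<Rightarrow> nat \<Rightarrow> 'a \<Rightarrow> real" and e :: "nat \<Rightarrow> 'a \<Rightarrow> real"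
    and a b \<kappa> :: "nat \<Rightarrow> real" and d :: nat and w :: "nat \<Rightarrow> nat \<Rightarrow> real" and n0 :: nat
  assumes chain: "n0 \<le> n \<Longrightarrow> gaussian_chain_martingale M (F n) (\<xi> n) e (a n) (b n) d (w n) (\<kappa> n)"
    and total_variance: "(\<lambda>n. real n * (\<kappa> n)\<^sup>2) \<longlonglongrightarrow> 1"
    and mixing: "(\<lambda>n. (\<kappa> n)\<^sup>2 / (1 - a n)) \<longlonglongrightarrow> 0"
begin

text \<open>Zero below \<open>n0\<close>, which keeps measurability and the starting value valid in
  every row.\<close>

definition amart :: "nat \<Rightarrow> nat \<Rightarrow> 'a \<Rightarrow> real" where
  "amart n k \<omega> = (if n0 \<le> n then gaussian_chain_martingale.mart (\<xi> n) e (a n) (b n) d (w n) k \<omega> else 0)"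

lemma amart_M[measurable]: "amart n k \<in> borel_measurable M"
proof (cases "n0 \<le> n")
  case True
  then interpret gaussian_chain_martingale M "F n" "\<xi> n" e "a n" "b n" d "w n" "\<kappa> n" by (rule chain)
  have "amart n k = mart k" using True by (simp add: fun_eq_iff amart_def)
  then show ?thesis by simp
qed (simp add: amart_def[abs_def])

lemma amart_F: "n0 \<le> n \<Longrightarrow> k \<le> l \<Longrightarrow> amart n k \<in> borel_measurable (F n l)"
proof -
  assume n: "n0 \<le> n" and kl: "k \<le> l"
  interpret gaussian_chain_martingale M "F n" "\<xi> n" e "a n" "b n" d "w n" "\<kappa> n" by (rule chain[OF n])
  have "amart n k = mart k" using n by (simp add: fun_eq_iff amart_def)
  then show ?thesis using F_measurable_mono[OF mart_F kl] by simp
qed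

lemma amart_0: "amart n 0 \<omega> = 0"
proof (cases "n0 \<le> n")
  case True
  then interpret gaussian_chain_martingale M "F n" "\<xi> n" e "a n" "b n" d "w n" "\<kappa> n" by (rule chain)
  show ?thesis by (simp add: amart_def mart_def)
qed (simp add: amart_def)

lemma \<kappa>2_lim: "(\<lambda>n. (\<kappa> n)\<^sup>2) \<longlonglongrightarrow> 0"
proof -
  have "(\<lambda>n. (real n * (\<kappa> n)\<^sup>2) * (1 / real n)) \<longlonglongrightarrow> 1 * 0"
    by (intro tendsto_mult total_variance lim_1_over_n)
  moreover have "\<forall>\<^sub>F n in sequentially. (real n * (\<kappa> n)\<^sup>2) * (1 / real n) = (\<kappa> n)\<^sup>2"
    using eventually_gt_at_top[of 0] by eventually_elim simp
  ultimately show ?thesis by (simp add: tendsto_cong)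
qed

lemma \<kappa>_lim: "\<kappa> \<longlonglongrightarrow> 0"
proof -
  have "(\<lambda>n. sqrt ((\<kappa> n)\<^sup>2)) \<longlonglongrightarrow> sqrt 0" by (intro tendsto_real_sqrt \<kappa>2_lim)
  then show ?thesis by (simp add: tendsto_rabs_zero_iff)
qed

text \<open>Stated as a difference tending to 0, since the means of the weights \<open>W n\<close>
  need not converge.\<close>

lemma char_limit:
  assumes st: "\<And>n. s n \<le> t n" "\<And>n. t n \<le> n" and r: "(\<lambda>n. real (t n - s n) * (\<kappa> n)\<^sup>2) \<longlonglongrightarrow> r"
    and W: "\<And>n. n0 \<le> n \<Longrightarrow> W n \<in> borel_measurable (F n (s n))" and W1: "\<And>n \<omega>. \<bar>W n \<omega>\<bar> \<le> (1 :: real)"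
  shows "(\<lambda>n. (\<integral>\<omega>. of_real (W n \<omega>) * iexp (u * (amart n (t n) \<omega> - amart n (s n) \<omega>)) \<partial>M) -
      of_real (exp (- (u\<^sup>2 * r / 2))) * (\<integral>\<omega>. of_real (W n \<omega>) \<partial>M)) \<longlonglongrightarrow> (0 :: complex)"
proof -
  define E where "E n = (\<integral>\<omega>. of_real (W n \<omega>) * iexp (u * (amart n (t n) \<omega> - amart n (s n) \<omega>)) \<partial>M)" for n
  define w0 where "w0 n = (\<integral>\<omega>. of_real (W n \<omega>) \<partial>M :: complex)" for n
  define V where "V n = real (t n - s n) * (\<kappa> n)\<^sup>2" for n
  define K where "K = step_const (2 * d)"
  define \<mu> where "\<mu> = (hermite_moment (2 * d) 3)\<^sup>2"
  define err where "err n = (real n * (\<kappa> n)\<^sup>2) * (\<bar>u\<bar> ^ 3 * K ^ 3 * \<mu> / 6 * \<kappa> n + u ^ 4 / 8 * (\<kappa> n)\<^sup>2 +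
      u ^ 4 / 4 * K\<^sup>2 * \<mu> * variance_const d * ((\<kappa> n)\<^sup>2 / (1 - a n)) +
      u\<^sup>2 / 2 * \<bar>u\<bar> * K\<^sup>2 * \<mu> * variance_const d * sqrt (2 * ((\<kappa> n)\<^sup>2 / (1 - a n)))) +
      u\<^sup>2 * variance_const d * \<mu> * ((\<kappa> n)\<^sup>2 / (1 - a n))" for n
  have "err \<longlonglongrightarrow> 1 * (\<bar>u\<bar> ^ 3 * K ^ 3 * \<mu> / 6 * 0 + u ^ 4 / 8 * 0 +
      u ^ 4 / 4 * K\<^sup>2 * \<mu> * variance_const d * 0 +
      u\<^sup>2 / 2 * \<bar>u\<bar> * K\<^sup>2 * \<mu> * variance_const d * sqrt (2 * 0)) +
      u\<^sup>2 * variance_const d * \<mu> * 0"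
    unfolding err_def[abs_def]
    by (intro tendsto_intros total_variance mixing \<kappa>_lim \<kappa>2_lim)
  then have err: "err \<longlonglongrightarrow> 0" by simp
  have 1: "\<forall>\<^sub>F n in sequentially. norm (E n - of_real (exp (- (u\<^sup>2 * V n / 2))) * w0 n) \<le> err n"
    using eventually_ge_at_top[of n0]
  proof eventually_elim
    case (elim n)
    then interpret C: gaussian_chain_martingale M "F n" "\<xi> n" e "a n" "b n" d "w n" "\<kappa> n" by (rule chain)
    have m: "amart n k = C.mart k" for k using elim by (simp add: fun_eq_iff amart_def)
    have "norm (E n - of_real (exp (- (u\<^sup>2 * V n / 2))) * w0 n) \<le> C.char_error (t n - s n) u"
      unfolding E_def w0_def V_def m by (rule C.char_bound[OF st(1) W[OF elim] W1])
    also have "\<dots> \<le> C.char_error n u" using st(2)[of n] by (intro C.char_error_mono) auto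
    also have "\<dots> \<le> err n" unfolding err_def K_def \<mu>_def by (rule C.char_error_le)
    finally show ?case .
  qed
  have A: "(\<lambda>n. E n - of_real (exp (- (u\<^sup>2 * V n / 2))) * w0 n) \<longlonglongrightarrow> 0"
    by (rule Lim_null_comparison[OF 1 err])
  have "(\<lambda>n. exp (- (u\<^sup>2 * V n / 2)) - exp (- (u\<^sup>2 * r / 2))) \<longlonglongrightarrow>
      exp (- (u\<^sup>2 * r / 2)) - exp (- (u\<^sup>2 * r / 2))"
    using r unfolding V_def[symmetric] by (intro tendsto_intros) auto
  then have "(\<lambda>n. \<bar>exp (- (u\<^sup>2 * V n / 2)) - exp (- (u\<^sup>2 * r / 2))\<bar>) \<longlonglongrightarrow> 0"
    by (simp add: tendsto_rabs_zero_iff)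
  then have B: "(\<lambda>n. of_real (exp (- (u\<^sup>2 * V n / 2)) - exp (- (u\<^sup>2 * r / 2))) * w0 n) \<longlonglongrightarrow> 0"
  proof (rule Lim_null_comparison[rotated], intro always_eventually allI)
    fix n
    have "cmod (w0 n) \<le> (\<integral>\<omega>. cmod (of_real (W n \<omega>)) \<partial>M)" unfolding w0_def by (rule integral_norm_bound)
    also have "\<dots> \<le> 1"
    \<comment> \<open>Below \<open>n0\<close> nothing is known about the measurability of
      \<open>W n\<close>; a function that is not integrable has integral 0.\<close>
    proof (cases "integrable M (\<lambda>\<omega>. cmod (of_real (W n \<omega>)))")
      case True
      have "(\<integral>\<omega>. cmod (of_real (W n \<omega>)) \<partial>M) \<le> (\<integral>\<omega>. 1 \<partial>M)"
        by (rule integral_mono[OF True]) (use W1 in auto)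
      then show ?thesis by (simp add: prob_space)
    qed (simp add: not_integrable_integral_eq)
    finally have "cmod (w0 n) \<le> 1" .
    then show "norm (of_real (exp (- (u\<^sup>2 * V n / 2)) - exp (- (u\<^sup>2 * r / 2))) * w0 n) \<le>
        \<bar>exp (- (u\<^sup>2 * V n / 2)) - exp (- (u\<^sup>2 * r / 2))\<bar>"
      unfolding norm_mult norm_of_real by (intro mult_left_le) auto
  qed
  have "(\<lambda>n. (E n - of_real (exp (- (u\<^sup>2 * V n / 2))) * w0 n) +
      of_real (exp (- (u\<^sup>2 * V n / 2)) - exp (- (u\<^sup>2 * r / 2))) * w0 n) \<longlonglongrightarrow> 0 + 0"
    by (rule tendsto_add[OF A B])
  then show ?thesis unfolding E_def[symmetric] w0_def[symmetric] by (simp add: algebra_simps)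
qed

text \<open>Levy's continuity theorem is applied to the laws of the increments under the tilted measures with
  density proportional to \<open>2 + W\<close>; this yields asymptotic independence of the past.\<close>

lemma weighted_weak_limit:
  fixes \<phi> :: "real \<Rightarrow> real"
  assumes st: "\<And>n. s n \<le> t n" "\<And>n. t n \<le> n" and r: "(\<lambda>n. real (t n - s n) * (\<kappa> n)\<^sup>2) \<longlonglongrightarrow> r" "0 \<le> r"
    and W: "\<And>n. n0 \<le> n \<Longrightarrow> W n \<in> borel_measurable (F n (s n))" and WM: "\<And>n. W n \<in> borel_measurable M"
    and W1: "\<And>n \<omega>. \<bar>W n \<omega>\<bar> \<le> (1 :: real)"
    and \<phi>: "continuous_on UNIV \<phi>" "\<And>z. \<bar>\<phi> z\<bar> \<le> C"
  shows "(\<lambda>n. (\<integral>\<omega>. W n \<omega> * \<phi> (amart n (t n) \<omega> - amart n (s n) \<omega>) \<partial>M) -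
      (\<integral>\<omega>. W n \<omega> \<partial>M) * (\<integral>z. \<phi> (sqrt r * z) \<partial>gaussian)) \<longlonglongrightarrow> 0"
proof -
  define m where "m = (\<integral>z. \<phi> (sqrt r * z) \<partial>gaussian)"
  define X where "X n \<omega> = amart n (t n) \<omega> - amart n (s n) \<omega>" for n \<omega>
  have Xm[measurable]: "X n \<in> borel_measurable M" for n unfolding X_def[abs_def] by measurable
  have \<phi>m[measurable]: "\<phi> \<in> borel_measurable borel" by (rule borel_measurable_continuous_onI[OF \<phi>(1)])
  have gm: "(\<lambda>z. sqrt r * z) \<in> gaussian \<rightarrow>\<^sub>M borel" by simp
  \<comment> \<open>Generic in \<open>W\<close>, because it is applied to the weight 0 as well, that
    is to the laws without tilt.\<close>
  have tilt: "(\<lambda>n. (2 * (\<integral>\<omega>. \<phi> (X n \<omega>) \<partial>M) + (\<integral>\<omega>. W n \<omega> * \<phi> (X n \<omega>) \<partial>M)) / (2 + (\<integral>\<omega>. W n \<omega> \<partial>M))) \<longlonglongrightarrow> m"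
    if W: "\<And>n. n0 \<le> n \<Longrightarrow> W n \<in> borel_measurable (F n (s n))"
        and WM[measurable]: "\<And>n. W n \<in> borel_measurable M"
    and W1: "\<And>n \<omega>. \<bar>W n \<omega>\<bar> \<le> (1 :: real)" for W
  proof -
    have Wi: "integrable M (W n)" for n by (rule integrable_const_bound[of _ 1]) (use W1 in auto)
    have EW: "\<bar>\<integral>\<omega>. W n \<omega> \<partial>M\<bar> \<le> 1" for n
    proof -
      have "\<bar>\<integral>\<omega>. W n \<omega> \<partial>M\<bar> \<le> (\<integral>\<omega>. \<bar>W n \<omega>\<bar> \<partial>M)" by (rule integral_abs_bound)
      also have "\<dots> \<le> (\<integral>\<omega>. 1 \<partial>M)" by (rule integral_mono) (use Wi W1 in auto)
      finally show ?thesis by (simp add: prob_space)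
    qed
    \<comment> \<open>The summand 2 makes the density nonnegative and keeps its normalisation at
      least 1, as \<open>W\<close> is bounded by 1.\<close>
    define c where "c n = 2 + (\<integral>\<omega>. W n \<omega> \<partial>M)" for n
    have c: "1 \<le> c n" for n using EW[of n] unfolding c_def by linarith
    define p where "p n \<omega> = (2 + W n \<omega>) / c n" for n \<omega>
    have p0: "0 \<le> p n \<omega>" for n \<omega> unfolding p_def using c[of n] W1[of n \<omega>]
        by (intro divide_nonneg_nonneg) linarith+
    have pm[measurable]: "p n \<in> borel_measurable M" for n unfolding p_def[abs_def] by measurable
    have pi: "integrable M (p n)" "(\<integral>\<omega>. p n \<omega> \<partial>M) = 1" for n
      using Wi c[of n] by (auto simp: p_def[abs_def] prob_space c_def[symmetric])
    have P: "prob_space (density M (p n))" for n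
    proof (rule prob_spaceI)
      have "emeasure (density M (p n)) (space M) = (\<integral>\<^sup>+\<omega>. ennreal (p n \<omega>) \<partial>M)"
        by (subst emeasure_density) (auto intro!: nn_integral_cong)
      also have "\<dots> = ennreal (\<integral>\<omega>. p n \<omega> \<partial>M)" by (rule nn_integral_eq_integral) (use pi p0 in auto)
      finally show "emeasure (density M (p n)) (space (density M (p n))) = 1" by (simp add: pi)
    qed
    define \<nu> where "\<nu> n = distr (density M (p n)) borel (X n)" for n
    have \<nu>: "real_distribution (\<nu> n)" for n
      unfolding \<nu>_def using prob_space.real_distribution_distr[OF P] by simp
    have G: "real_distribution (distr gaussian borel (\<lambda>z. sqrt r * z))"
      using gaussian.real_distribution_distr[OF gm] .
    have int\<nu>: "(\<integral>x. h x \<partial>\<nu> n) = (\<integral>\<omega>. p n \<omega> *\<^sub>R h (X n \<omega>) \<partial>M)"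
      if [measurable]: "h \<in> borel_measurable borel" for h :: "real \<Rightarrow> 'c :: {banach,
          second_countable_topology}" and n
    proof -
      have "(\<integral>x. h x \<partial>\<nu> n) = (\<integral>\<omega>. h (X n \<omega>) \<partial>density M (p n))" unfolding \<nu>_def by (rule integral_distr) auto
      also have "\<dots> = (\<integral>\<omega>. p n \<omega> *\<^sub>R h (X n \<omega>) \<partial>M)" by (rule integral_density) (use p0 in auto)
      finally show ?thesis .
    qed
    have split: "(\<integral>\<omega>. p n \<omega> *\<^sub>R h (X n \<omega>) \<partial>M) = (2 * (\<integral>\<omega>. h (X n \<omega>) \<partial>M) +
        (\<integral>\<omega>. of_real (W n \<omega>) * h (X n \<omega>) \<partial>M)) / of_real (c n)"
      if [measurable]: "h \<in> borel_measurable borel" and hb: "\<And>x. norm (h x) \<le> D"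
          for h :: "real \<Rightarrow> 'c :: {banach, second_countable_topology, real_normed_field}" and n D
    proof -
      have i1: "integrable M (\<lambda>\<omega>. h (X n \<omega>))" by (rule integrable_const_bound[of _ D]) (use hb in auto)
      have i2: "integrable M (\<lambda>\<omega>. of_real (W n \<omega>) * h (X n \<omega>))"
      proof (rule integrable_const_bound[of _ "1 * D"])
        show "AE \<omega> in M. norm (of_real (W n \<omega>) * h (X n \<omega>)) \<le> 1 * D"
          unfolding norm_mult norm_of_real by (intro AE_I2 mult_mono W1 hb) auto
      qed measurable
      have "p n \<omega> *\<^sub>R h (X n \<omega>) = (2 * h (X n \<omega>) + of_real (W n \<omega>) * h (X n \<omega>)) / of_real (c n)" for \<omega>
        by (simp add: p_def scaleR_conv_of_real field_simps)
      then show ?thesis using i1 i2 by simp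
    qed
    have "weak_conv_m \<nu> (distr gaussian borel (\<lambda>z. sqrt r * z))"
    proof (rule levy_continuity[OF \<nu> G])
      fix u
      have iem[measurable]: "(\<lambda>x. iexp (u * x)) \<in> borel_measurable borel" by measurable
      define A where "A W n = (\<integral>\<omega>. of_real (W n \<omega>) * iexp (u * X n \<omega>) \<partial>M) - of_real (exp (- (u\<^sup>2 * r /
          2))) * (\<integral>\<omega>. of_real (W n \<omega>) \<partial>M)"
        for W :: "nat \<Rightarrow> 'a \<Rightarrow> real" and n
      have A1: "A (\<lambda>_ _. 1) \<longlonglongrightarrow> 0" unfolding A_def[abs_def] X_def by (rule char_limit[OF st r(1)]) auto
      have A2: "A W \<longlonglongrightarrow> 0" unfolding A_def[abs_def] X_def by (rule char_limit[OF st r(1) W W1])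
      have "char (\<nu> n) u = (2 * (\<integral>\<omega>. iexp (u * X n \<omega>) \<partial>M) +
          (\<integral>\<omega>. of_real (W n \<omega>) * iexp (u * X n \<omega>) \<partial>M)) / of_real (c n)" for n
        unfolding char_def int\<nu>[OF iem] by (rule split[OF iem, of 1]) simp
      also have "\<dots> n = of_real (exp (- (u\<^sup>2 * r / 2))) + (2 * A (\<lambda>_ _. 1) n + A W n) / of_real (c n)" for n
      proof -
        have gen: "(2 * x + y) / cc = z + (2 * (x - z) + (y - z * (cc - 2))) / cc" if "cc \<noteq> 0"
            for x y z cc :: complex
          using that by (simp add: field_simps)
        have "(\<integral>\<omega>. of_real (W n \<omega>) \<partial>M :: complex) = of_real (c n) - 2" by (simp add: c_def)
        moreover have "A (\<lambda>_ _. 1) n = (\<integral>\<omega>. iexp (u * X n \<omega>) \<partial>M) - of_real (exp (- (u\<^sup>2 * r / 2)))"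
          by (simp add: A_def prob_space)
        moreover have nz: "complex_of_real (c n) \<noteq> 0" using c[of n] by auto
        ultimately show ?thesis unfolding A_def[of W] by (simp only:) (rule gen[OF nz])
      qed
      finally have eq: "char (\<nu> n) u = of_real (exp (- (u\<^sup>2 * r / 2))) + (2 * A (\<lambda>_ _. 1) n +
          A W n) / of_real (c n)" for n .
      have "(\<lambda>n. 2 * A (\<lambda>_ _. 1) n + A W n) \<longlonglongrightarrow> 2 * 0 + 0" by (intro tendsto_intros A1 A2)
      then have "(\<lambda>n. norm (2 * A (\<lambda>_ _. 1) n + A W n)) \<longlonglongrightarrow> 0" by (simp add: tendsto_norm_zero_iff)
      then have "(\<lambda>n. (2 * A (\<lambda>_ _. 1) n + A W n) / of_real (c n)) \<longlonglongrightarrow> 0"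
      proof (rule Lim_null_comparison[rotated], intro always_eventually allI)
        fix n
        show "norm ((2 * A (\<lambda>_ _. 1) n + A W n) / of_real (c n)) \<le> norm (2 * A (\<lambda>_ _. 1) n + A W n)"
          using c[of n] by (simp add: norm_divide divide_le_eq mult_left_le mult_le_cancel_left1)
      qed
      then have "(\<lambda>n. char (\<nu> n) u) \<longlonglongrightarrow> of_real (exp (- (u\<^sup>2 * r / 2))) + 0"
        unfolding eq by (intro tendsto_add tendsto_const)
      moreover have "char (distr gaussian borel (\<lambda>z. sqrt r * z)) u = of_real (exp (- (u\<^sup>2 * r / 2)))"
      proof -
        have "char (distr gaussian borel (\<lambda>z. sqrt r * z)) u = char gaussian (u * sqrt r)"
          unfolding char_def by (subst integral_distr) (auto simp: mult.assoc)
        also have "\<dots> = of_real (exp (- (u\<^sup>2 * r / 2)))"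
          unfolding char_std_normal_distribution using r(2) by (simp add: power_mult_distrib)
        finally show ?thesis .
      qed
      ultimately show "(\<lambda>n. char (\<nu> n) u) \<longlonglongrightarrow> char (distr gaussian borel (\<lambda>z. sqrt r * z)) u" by simp
    qed
    then have "(\<lambda>n. \<integral>x. \<phi> x \<partial>\<nu> n) \<longlonglongrightarrow> (\<integral>x. \<phi> x \<partial>distr gaussian borel (\<lambda>z. sqrt r * z))"
      by (rule weak_conv_imp_integral_bdd_continuous_conv[OF \<nu> G])
        (use \<phi> in \<open>auto simp: continuous_on_eq_continuous_at\<close>)
    moreover have "(\<integral>x. \<phi> x \<partial>distr gaussian borel (\<lambda>z. sqrt r * z)) = m"
      unfolding m_def by (rule integral_distr) auto
    moreover have "(\<integral>x. \<phi> x \<partial>\<nu> n) = (2 * (\<integral>\<omega>. \<phi> (X n \<omega>) \<partial>M) + (\<integral>\<omega>. W n \<omega> * \<phi> (X n \<omega>) \<partial>M)) / c n" for n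
      unfolding int\<nu>[OF \<phi>m] using split[OF \<phi>m, of C] \<phi>(2) by simp
    ultimately show ?thesis unfolding c_def by simp
  qed
  have "(\<lambda>n. (2 * (\<integral>\<omega>. \<phi> (X n \<omega>) \<partial>M) + (\<integral>\<omega>. 0 * \<phi> (X n \<omega>) \<partial>M)) / (2 + (\<integral>\<omega>. 0 \<partial>M))) \<longlonglongrightarrow> m"
    by (rule tilt) auto
  then have B0: "(\<lambda>n. \<integral>\<omega>. \<phi> (X n \<omega>) \<partial>M) \<longlonglongrightarrow> m" by simp
  define f where "f n = (2 * (\<integral>\<omega>. \<phi> (X n \<omega>) \<partial>M) + (\<integral>\<omega>. W n \<omega> * \<phi> (X n \<omega>) \<partial>M)) / (2 + (\<integral>\<omega>. W n \<omega> \<partial>M))" for n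
  have f: "f \<longlonglongrightarrow> m" unfolding f_def[abs_def] by (rule tilt[OF W WM W1])
  have EW: "\<bar>\<integral>\<omega>. W n \<omega> \<partial>M\<bar> \<le> 1" for n
  proof -
    have "\<bar>\<integral>\<omega>. W n \<omega> \<partial>M\<bar> \<le> (\<integral>\<omega>. \<bar>W n \<omega>\<bar> \<partial>M)" by (rule integral_abs_bound)
    also have "\<dots> \<le> (\<integral>\<omega>. 1 \<partial>M)"
      by (rule integral_mono) (use W1 in \<open>auto intro!: integrable_abs integrable_const_bound[of _ 1] WM\<close>)
    finally show ?thesis by (simp add: prob_space)
  qed
  have "(\<lambda>n. 3 * \<bar>f n - m\<bar>) \<longlonglongrightarrow> 3 * \<bar>m - m\<bar>" by (intro tendsto_intros f)
  then have "(\<lambda>n. 3 * \<bar>f n - m\<bar>) \<longlonglongrightarrow> 0" by simp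
  then have "(\<lambda>n. (f n - m) * (2 + (\<integral>\<omega>. W n \<omega> \<partial>M))) \<longlonglongrightarrow> 0"
  proof (rule Lim_null_comparison[rotated], intro always_eventually allI)
    fix n
    have "\<bar>f n - m\<bar> * \<bar>2 + (\<integral>\<omega>. W n \<omega> \<partial>M)\<bar> \<le> \<bar>f n - m\<bar> * 3"
      using EW[of n] by (intro mult_left_mono) (auto simp: abs_le_iff)
    then show "norm ((f n - m) * (2 + (\<integral>\<omega>. W n \<omega> \<partial>M))) \<le> 3 * \<bar>f n - m\<bar>" by (simp add: abs_mult)
  qed
  \<comment> \<open>Removing the tilt: after subtraction of twice the limit \<open>B0\<close> for
    the untilted laws, only the integral against \<open>W\<close> is left.\<close>
  then have "(\<lambda>n. (f n - m) * (2 + (\<integral>\<omega>. W n \<omega> \<partial>M)) - 2 * ((\<integral>\<omega>. \<phi> (X n \<omega>) \<partial>M) - m)) \<longlonglongrightarrow> 0 - 2 * (m - m)"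
    by (intro tendsto_intros B0)
  moreover have "(f n - m) * (2 + (\<integral>\<omega>. W n \<omega> \<partial>M)) - 2 * ((\<integral>\<omega>. \<phi> (X n \<omega>) \<partial>M) - m) =
      (\<integral>\<omega>. W n \<omega> * \<phi> (X n \<omega>) \<partial>M) - (\<integral>\<omega>. W n \<omega> \<partial>M) * m" for n
  proof -
    have "2 + (\<integral>\<omega>. W n \<omega> \<partial>M) \<noteq> 0" using EW[of n] by linarith
    then have "f n * (2 + (\<integral>\<omega>. W n \<omega> \<partial>M)) = 2 * (\<integral>\<omega>. \<phi> (X n \<omega>) \<partial>M) + (\<integral>\<omega>. W n \<omega> * \<phi> (X n \<omega>) \<partial>M)"
      by (simp add: f_def)
    then show ?thesis by (simp add: algebra_simps)
  qed
  ultimately show ?thesis unfolding X_def m_def by simp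
qed

section \<open>Consecutive blocks: joint law and oscillation\<close>

lemma block_variance:
  assumes K: "K \<ge> 1"
  shows "(\<lambda>n. real (n * Suc i div K - n * i div K) * (\<kappa> n)\<^sup>2) \<longlonglongrightarrow> 1 / real K"
proof -
  have fl: "(\<lambda>n. real (n * j div K) / real n) \<longlonglongrightarrow> real j / real K" for j
  proof -
    have "(\<lambda>n. real (n * j div K) / real n - real j / real K) \<longlonglongrightarrow> 0"
    proof (rule Lim_null_comparison[OF _ lim_1_over_n])
      show "\<forall>\<^sub>F n in sequentially. norm (real (n * j div K) / real n - real j / real K) \<le> 1 / real n"
        using eventually_gt_at_top[of 0]
      proof eventually_elim
        case (elim n)
        have "real (n * j div K) \<le> real (n * j) / real K" by (rule of_nat_div_le_of_nat)
        moreover have "real (n * j) / real K \<le> real (n * j div K) + 1"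
        proof -
          have "n * j \<le> (n * j div K + 1) * K" using dividend_less_div_times[of K "n * j"] K by simp
          then have "real (n * j) \<le> (real (n * j div K) + 1) * real K"
              by (metis of_nat_1 of_nat_add of_nat_le_iff of_nat_mult)
          then show ?thesis using K by (simp add: divide_le_eq)
        qed
        ultimately have "\<bar>real (n * j div K) - real (n * j) / real K\<bar> \<le> 1" by linarith
        then have "\<bar>real (n * j div K) - real (n * j) / real K\<bar> / real n \<le> 1 / real n"
            by (rule divide_right_mono) simp
        moreover have "real (n * j div K) / real n - real j / real K =
            (real (n * j div K) - real (n * j) / real K) / real n"
          using elim by (simp add: diff_divide_distrib)
        ultimately show ?case by (simp add: abs_divide)
      qed
    qed
    then show ?thesis by (rule LIM_zero_cancel)
  qed
  have "(\<lambda>n. (real (n * Suc i div K) / real n - real (n * i div K) / real n) * (real n * (\<kappa> n)\<^sup>2)) \<longlonglongrightarrow>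
      (real (Suc i) / real K - real i / real K) * 1"
    by (intro tendsto_mult tendsto_diff fl total_variance)
  moreover have "(real (Suc i) / real K - real i / real K) * 1 = 1 / real K"
      by (simp add: diff_divide_distrib[symmetric])
  moreover have "\<forall>\<^sub>F n in sequentially. (real (n * Suc i div K) / real n - real (n * i div K) / real n) *
      (real n * (\<kappa> n)\<^sup>2) =
      real (n * Suc i div K - n * i div K) * (\<kappa> n)\<^sup>2"
    using eventually_gt_at_top[of 0]
  proof eventually_elim
    case (elim n)
    have "n * i div K \<le> n * Suc i div K" by (intro div_le_mono) simp
    then show ?case using elim by (simp add: of_nat_diff diff_divide_distrib[symmetric] del: mult_Suc_right)
  qed
  ultimately show ?thesis by (simp only: tendsto_cong)
qed

lemma block_bounds: "i < K \<Longrightarrow> n * i div K \<le> n * Suc i div K" "i < K \<Longrightarrow> n * Suc i div K \<le> n" for K :: nat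
proof -
  assume "i < K"
  then have "n * Suc i div K \<le> n * K div K" by (intro div_le_mono mult_le_mono) auto
  then show "n * Suc i div K \<le> n" using \<open>i < K\<close> by simp
qed (intro div_le_mono, simp)

text \<open>Induction on the number of blocks: the product over the earlier blocks is a bounded
  weight known at the left end of the next one, so \<open>weighted_weak_limit\<close> splits off one
  factor.\<close>

lemma increments_limit:
  fixes \<phi> :: "nat \<Rightarrow> real \<Rightarrow> real"
  assumes K: "K \<ge> 1" and \<phi>: "\<And>i. continuous_on UNIV (\<phi> i)" "\<And>i z. \<bar>\<phi> i z\<bar> \<le> 1" and "j \<le> K"
  shows "(\<lambda>n. \<integral>\<omega>. (\<Prod>i<j. \<phi> i (amart n (n * Suc i div K) \<omega> - amart n (n * i div K) \<omega>)) \<partial>M) \<longlonglongrightarrow>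
     (\<Prod>i<j. \<integral>z. \<phi> i (sqrt (1 / real K) * z) \<partial>gaussian)"
  using \<open>j \<le> K\<close>
proof (induction j)
  case (Suc j)
  define W where "W n \<omega> = (\<Prod>i<j. \<phi> i (amart n (n * Suc i div K) \<omega> - amart n (n * i div K) \<omega>))" for n \<omega>
  have \<phi>m[measurable]: "\<phi> i \<in> borel_measurable borel" for i
      by (rule borel_measurable_continuous_onI[OF \<phi>(1)])
  have W1: "\<bar>W n \<omega>\<bar> \<le> 1" for n \<omega> unfolding W_def abs_prod by (intro prod_le_1) (use \<phi>(2) in auto)
  have WM: "W n \<in> borel_measurable M" for n unfolding W_def[abs_def] by measurable
  have WF: "W n \<in> borel_measurable (F n (n * j div K))" if "n0 \<le> n" for n
    unfolding W_def[abs_def]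
  proof (rule borel_measurable_prod)
    fix i assume "i \<in> {..<j}"
    then have "n * Suc i div K \<le> n * j div K" "n * i div K \<le> n * j div K"
        by (auto intro!: div_le_mono mult_le_mono simp del: mult_Suc_right)
    then have [measurable]: "amart n (n * Suc i div K) \<in> borel_measurable (F n (n * j div K))" "amart n (n
        * i div K) \<in> borel_measurable (F n (n * j div K))"
      using amart_F[OF that] by blast+
    show "(\<lambda>\<omega>. \<phi> i (amart n (n * Suc i div K) \<omega> - amart n (n * i div K) \<omega>)) \<in> borel_measurable (F n (n * j
        div K))" by measurable
  qed
  have IH: "(\<lambda>n. \<integral>\<omega>. W n \<omega> \<partial>M) \<longlonglongrightarrow> (\<Prod>i<j. \<integral>z. \<phi> i (sqrt (1 / real K) * z) \<partial>gaussian)"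
    unfolding W_def using Suc by simp
  have "(\<lambda>n. (\<integral>\<omega>. W n \<omega> * \<phi> j (amart n (n * Suc j div K) \<omega> - amart n (n * j div K) \<omega>) \<partial>M) -
      (\<integral>\<omega>. W n \<omega> \<partial>M) * (\<integral>z. \<phi> j (sqrt (1 / real K) * z) \<partial>gaussian)) \<longlonglongrightarrow> 0"
    by (rule weighted_weak_limit[OF _ _ block_variance[OF K] _ WF WM W1 \<phi>(1,2)])
      (use block_bounds[of j K] Suc.prems in auto)
  then have "(\<lambda>n. ((\<integral>\<omega>. W n \<omega> * \<phi> j (amart n (n * Suc j div K) \<omega> - amart n (n * j div K) \<omega>) \<partial>M) -
      (\<integral>\<omega>. W n \<omega> \<partial>M) * (\<integral>z. \<phi> j (sqrt (1 / real K) * z) \<partial>gaussian)) +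
      (\<integral>\<omega>. W n \<omega> \<partial>M) * (\<integral>z. \<phi> j (sqrt (1 / real K) * z) \<partial>gaussian)) \<longlonglongrightarrow>
      0 + (\<Prod>i<j. \<integral>z. \<phi> i (sqrt (1 / real K) * z) \<partial>gaussian) * (\<integral>z. \<phi> j (sqrt (1 / real K) * z) \<partial>gaussian)"
    by (intro tendsto_intros IH)
  then show ?case by (simp add: W_def)
qed (simp add: prob_space)

text \<open>One block contributes a probability of order \<open>1 / K\<^sup>2\<close>: the fourth
  moment of its Gaussian limit has that order, and cutting at level \<open>K\<close> leaves a
  variance term \<open>(1 / K) / K\<close>. Summation over \<open>K\<close> blocks gives order
  \<open>1 / K\<close>.\<close>

lemma oscillation_limit:
  assumes \<delta>: "\<delta> > 0" and \<eta>: "\<eta> > 0"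
  shows "\<exists>K0. \<forall>K\<ge>K0. \<forall>\<^sub>F n in sequentially.
    prob {\<omega> \<in> space M. \<exists>i<K. \<exists>k\<in>{n * i div K..n * Suc i div K}. \<delta> < \<bar>amart n k \<omega> - amart n (n * i div K)
        \<omega>\<bar>} < \<eta>"
proof -
  define \<rho> where "\<rho> = \<delta> / 2"
  have \<rho>: "0 < \<rho>" using \<delta> by (simp add: \<rho>_def)
  define m4 where "m4 = (\<integral>z. z ^ 4 \<partial>gaussian)"
  \<comment> \<open>The limiting bound for one block is \<open>c / K\<^sup>2\<close>, so
    \<open>K > c / \<eta>\<close> makes the sum over the blocks less than
    \<open>\<eta>\<close>.\<close>
  define c where "c = (m4 / \<rho> ^ 3 + 1) / \<rho>"
  obtain K1 :: nat where K1: "real K1 * \<eta> > c" using reals_Archimedean3[OF \<eta>] by blast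
  show ?thesis
  proof (intro exI allI impI)
    fix K assume "Suc K1 \<le> K"
    then have K: "1 \<le> K" "K1 \<le> K" by auto
    have Kp: "real K > 0" using K by simp
    \<comment> \<open>The truncation makes the function bounded, as weak convergence requires; its
      level is the \<open>R\<close> of \<open>maximal_inequality\<close>.\<close>
    define \<phi> where "\<phi> z = min (z ^ 4 / \<rho> ^ 3) (real K)" for z :: real
    have \<phi>: "continuous_on UNIV \<phi>" "\<bar>\<phi> z\<bar> \<le> real K" "0 \<le> \<phi> z" for z
      unfolding \<phi>_def using \<rho> by (auto intro!: continuous_intros)
    define U where "U n i = ((\<integral>\<omega>. \<phi> (amart n (n * Suc i div K) \<omega> - amart n (n * i div K) \<omega>) \<partial>M) +
       real (n * Suc i div K - n * i div K) * (\<kappa> n)\<^sup>2 / real K) / \<rho>" for n i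
    define u where "u = ((\<integral>z. \<phi> (sqrt (1 / real K) * z) \<partial>gaussian) + (1 / real K) / real K) / \<rho>"
    have Ulim: "(\<lambda>n. U n i) \<longlonglongrightarrow> u" if i: "i < K" for i
    proof -
      have "(\<lambda>n. (\<integral>\<omega>. 1 * \<phi> (amart n (n * Suc i div K) \<omega> - amart n (n * i div K) \<omega>) \<partial>M) -
          (\<integral>\<omega>. 1 \<partial>M) * (\<integral>z. \<phi> (sqrt (1 / real K) * z) \<partial>gaussian)) \<longlonglongrightarrow> 0"
        by (rule weighted_weak_limit[OF _ _ block_variance[OF K(1)] _ _ _ _ \<phi>(1,2)])
          (use block_bounds[OF i] in auto)
      then have "(\<lambda>n. (\<integral>\<omega>. \<phi> (amart n (n * Suc i div K) \<omega> - amart n (n * i div K) \<omega>) \<partial>M)) \<longlonglongrightarrow>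
          (\<integral>z. \<phi> (sqrt (1 / real K) * z) \<partial>gaussian)"
        by (simp add: prob_space LIM_zero_iff)
      then show ?thesis unfolding U_def u_def
        using \<rho> Kp by (intro tendsto_intros block_variance[OF K(1)]) auto
    qed
    have "(\<lambda>n. \<Sum>i<K. U n i) \<longlonglongrightarrow> (\<Sum>i<K. u)" by (intro tendsto_sum Ulim) auto
    moreover have "(\<Sum>i<K. u) < \<eta>"
    proof -
      have i4: "integrable gaussian (\<lambda>z. z ^ 4 :: real)" by (rule integrable_std_normal_distribution_moment)
      have "(\<integral>z. \<phi> (sqrt (1 / real K) * z) \<partial>gaussian) \<le> (\<integral>z. z ^ 4 / (\<rho> ^ 3 * (real K)\<^sup>2) \<partial>gaussian)"
      proof (rule integral_mono)
        have [measurable]: "\<phi> \<in> borel_measurable borel" by (rule borel_measurable_continuous_onI[OF \<phi>(1)])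
        show "integrable gaussian (\<lambda>z. \<phi> (sqrt (1 / real K) * z))"
          by (rule gaussian.integrable_const_bound[of _ "real K"]) (use \<phi>(2) in auto)
        show "integrable gaussian (\<lambda>z. z ^ 4 / (\<rho> ^ 3 * (real K)\<^sup>2))" using i4 by simp
        fix z :: real
        have "sqrt (1 / real K) ^ 4 = (1 / real K)\<^sup>2"
          using Kp by (simp add: power4_eq_xxxx power2_eq_square mult.assoc[symmetric])
        then show "\<phi> (sqrt (1 / real K) * z) \<le> z ^ 4 / (\<rho> ^ 3 * (real K)\<^sup>2)"
          unfolding \<phi>_def by (intro min.coboundedI1) (simp add: power_mult_distrib power_divide field_simps)
      qed
      also have "\<dots> = m4 / (\<rho> ^ 3 * (real K)\<^sup>2)" by (simp add: m4_def)
      finally have "u \<le> (m4 / (\<rho> ^ 3 * (real K)\<^sup>2) + (1 / real K) / real K) / \<rho>"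
        unfolding u_def using \<rho> by (intro divide_right_mono add_right_mono) auto
      also have "\<dots> = c / (real K)\<^sup>2" unfolding c_def using \<rho> Kp by (simp add: field_simps power2_eq_square)
      finally have "real K * u \<le> real K * (c / (real K)\<^sup>2)" by (intro mult_left_mono) auto
      then have "(\<Sum>i<K. u) \<le> real K * (c / (real K)\<^sup>2)" by simp
      also have "\<dots> = c / real K" using Kp by (simp add: power2_eq_square)
      also have "\<dots> < \<eta>"
      proof -
        have "real K1 * \<eta> \<le> real K * \<eta>" using K(2) \<eta> by simp
        then show ?thesis using K1 Kp by (simp add: divide_less_eq mult.commute)
      qed
      finally show ?thesis .
    qed
    ultimately have "\<forall>\<^sub>F n in sequentially. (\<Sum>i<K. U n i) < \<eta>" by (rule order_tendstoD(2))
    then show "\<forall>\<^sub>F n in sequentially.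
      prob {\<omega> \<in> space M. \<exists>i<K. \<exists>k\<in>{n * i div K..n * Suc i div K}. \<delta> < \<bar>amart n k \<omega> - amart n (n * i div K)
          \<omega>\<bar>} < \<eta>"
      using eventually_ge_at_top[of n0]
    proof eventually_elim
      case (elim n)
      then interpret C: gaussian_chain_martingale M "F n" "\<xi> n" e "a n" "b n" d "w n" "\<kappa> n" by (intro chain)
      have m: "amart n k = C.mart k" for k using elim by (simp add: fun_eq_iff amart_def)
      define A where "A i = {\<omega> \<in> space M. \<exists>k\<in>{n * i div K..n * Suc i div K}. 2 * \<rho> < \<bar>amart n k \<omega> - amart
          n (n * i div K) \<omega>\<bar>}" for i
      have Am: "A i \<in> sets M" for i unfolding A_def by measurable
      have "\<rho> * prob (A i) \<le> \<rho> * U n i" if "i < K" for i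
      proof -
        have "\<rho> * prob (A i) \<le> (\<integral>\<omega>. \<phi> (amart n (n * Suc i div K) \<omega> - amart n (n * i div K) \<omega>) \<partial>M) +
          real (n * Suc i div K - n * i div K) * (\<kappa> n)\<^sup>2 / real K"
          unfolding A_def m \<phi>_def by (rule C.maximal_inequality[OF block_bounds(1)[OF that] \<rho> Kp])
        then show ?thesis unfolding U_def using \<rho> by simp
      qed
      then have U: "prob (A i) \<le> U n i" if "i < K" for i using that \<rho> by simp
      have "{\<omega> \<in> space M. \<exists>i<K. \<exists>k\<in>{n * i div K..n * Suc i div K}. \<delta> < \<bar>amart n k \<omega> - amart n (n * i div
          K) \<omega>\<bar>} = (\<Union>i\<in>{..<K}. A i)"
        unfolding A_def \<rho>_def by auto
      also have "prob (\<Union>i\<in>{..<K}. A i) \<le> (\<Sum>i<K. prob (A i))"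
        by (rule finite_measure_subadditive_finite) (use Am in auto)
      also have "\<dots> \<le> (\<Sum>i<K. U n i)" by (intro sum_mono U) auto
      finally show ?case using elim by linarith
    qed
  qed
qed

end

text \<open>The limit found in \<open>increments_limit\<close>, here obtained from the independent
  normal increments of \<open>B\<close>.\<close>

lemma brownian_increments_expectation:
  fixes \<phi> :: "nat \<Rightarrow> real \<Rightarrow> real"
  assumes BM: "standard_brownian_motion Q B" and K: "K \<ge> 1"
    and \<phi>: "\<And>i. continuous_on UNIV (\<phi> i)" "\<And>i z. \<bar>\<phi> i z\<bar> \<le> 1"
  shows "(\<integral>\<omega>. (\<Prod>i<K. \<phi> i (B (real (Suc i) / real K) \<omega> - B (real i / real K) \<omega>)) \<partial>Q) =
    (\<Prod>i<K. \<integral>z. \<phi> i (sqrt (1 / real K) * z) \<partial>gaussian)"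
proof -
  interpret Q: prob_space Q using BM by (simp add: standard_brownian_motion_def)
  define X where "X i \<omega> = B (real (Suc i) / real K) \<omega> - B (real i / real K) \<omega>" for i \<omega>
  have \<phi>m[measurable]: "\<phi> i \<in> borel_measurable borel" for i
      by (rule borel_measurable_continuous_onI[OF \<phi>(1)])
  have Kp: "real K > 0" using K by simp
  have "\<forall>k (\<tau> :: nat \<Rightarrow> real). 0 \<le> \<tau> 0 \<and> (\<forall>i<k. \<tau> i < \<tau> (Suc i)) \<and> \<tau> k \<le> 1 \<longrightarrow>
        Q.indep_vars (\<lambda>_. borel) (\<lambda>i \<omega>. B (\<tau> (Suc i)) \<omega> - B (\<tau> i) \<omega>) {..<k}"
    using BM unfolding standard_brownian_motion_def by blast
  from this[rule_format, of "\<lambda>i. real i / real K" K]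
  have I: "Q.indep_vars (\<lambda>_. borel) X {..<K}"
    unfolding X_def[abs_def] using Kp by (simp add: divide_strict_right_mono)
  have Xm[measurable]: "X i \<in> borel_measurable Q" if "i < K" for i
    using I that unfolding Q.indep_vars_def by auto
  have "(\<integral>\<omega>. (\<Prod>i<K. \<phi> i (X i \<omega>)) \<partial>Q) = (\<Prod>i<K. \<integral>\<omega>. \<phi> i (X i \<omega>) \<partial>Q)"
  proof (rule Q.indep_vars_lebesgue_integral)
    show "Q.indep_vars (\<lambda>_. borel) (\<lambda>i \<omega>. \<phi> i (X i \<omega>)) {..<K}"
      by (rule Q.indep_vars_compose2[OF I]) measurable
    show "integrable Q (\<lambda>\<omega>. \<phi> i (X i \<omega>))" if "i \<in> {..<K}" for i
    proof (rule Q.integrable_const_bound[of _ 1])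
      have [measurable]: "X i \<in> borel_measurable Q" using that by (intro Xm) simp
      show "(\<lambda>\<omega>. \<phi> i (X i \<omega>)) \<in> borel_measurable Q" by measurable
    qed (use \<phi>(2) in auto)
  qed simp
  also have "\<dots> = (\<Prod>i<K. \<integral>z. \<phi> i (sqrt (1 / real K) * z) \<partial>gaussian)"
  proof (rule prod.cong[OF refl])
    fix i assume "i \<in> {..<K}"
    then have i: "i < K" by simp
    define \<sigma> where "\<sigma> = sqrt (1 / real K)"
    have \<sigma>: "\<sigma> > 0" using Kp by (simp add: \<sigma>_def)
    have "distributed Q lborel (X i) (normal_density 0 (sqrt (real (Suc i) / real K - real i / real K)))"
      using BM i Kp unfolding standard_brownian_motion_def X_def[abs_def]
      by (auto simp: divide_strict_right_mono simp del: of_nat_Suc)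
    moreover have "real (Suc i) / real K - real i / real K = 1 / real K"
        by (simp add: diff_divide_distrib[symmetric])
    ultimately have "distributed Q lborel (X i) (normal_density 0 \<sigma>)" by (simp add: \<sigma>_def)
    then have D: "distributed Q lborel (\<lambda>\<omega>. (X i \<omega> - 0) / \<sigma>) std_normal_density"
      using Q.normal_standard_normal_convert[OF \<sigma>] by blast
    have [measurable]: "X i \<in> borel_measurable Q" using i by (rule Xm)
    have G: "distr Q borel (\<lambda>\<omega>. X i \<omega> / \<sigma>) = gaussian"
      using distributed_distr_eq_density[OF D] by (simp cong: distr_cong)
    have "(\<integral>z. \<phi> i (\<sigma> * z) \<partial>gaussian) = (\<integral>\<omega>. \<phi> i (\<sigma> * (X i \<omega> / \<sigma>)) \<partial>Q)"
      unfolding G[symmetric] by (rule integral_distr) measurable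
    then show "(\<integral>\<omega>. \<phi> i (X i \<omega>) \<partial>Q) = (\<integral>z. \<phi> i (sqrt (1 / real K) * z) \<partial>gaussian)"
      using \<sigma> by (simp add: \<sigma>_def[symmetric])
  qed
  finally show ?thesis unfolding X_def .
qed

section \<open>Boundary terms\<close>

context gaussian_chain_martingale begin

text \<open>The transition operator applied to the Hermite sum with coefficients \<open>w\<close>,
  at time \<open>k\<close>; its increments are the telescoping part of the partial sums.\<close>

definition coboundary :: "nat \<Rightarrow> 'a \<Rightarrow> real" where
  "coboundary k \<omega> = hermite_sum d (\<lambda>q. a ^ q * w q) (\<xi> k \<omega>)"

lemma coboundary_M[measurable]: "coboundary k \<in> borel_measurable M"
  unfolding coboundary_def[abs_def] by measurable

text \<open>The summand is \<open>w - P w\<close> at time \<open>j\<close>, with \<open>P\<close>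
  the transition operator. Pairing \<open>w\<close> at time \<open>j\<close> with \<open>P w\<close>
  at time \<open>j - 1\<close> gives a martingale increment and leaves a telescoping sum of
  \<open>P w\<close>.\<close>

lemma martingale_decomposition:
  assumes "\<omega> \<in> space M"
  shows "(\<Sum>j=1..k. hermite_sum d (\<lambda>q. (1 - a ^ q) * w q) (\<xi> j \<omega>)) =
      mart k \<omega> - (coboundary k \<omega> - coboundary 0 \<omega>)"
proof (induction k)
  case (Suc k)
  have s: "hermite_sum d (\<lambda>q. (1 - a ^ q) * w q) x = hermite_sum d w x - hermite_sum d (\<lambda>q. a ^ q * w q)
      x" for x
    unfolding hermite_sum_def by (simp add: sum_subtractf[symmetric] algebra_simps)
  have "incr k \<omega> = hermite_sum d w (\<xi> (Suc k) \<omega>) - coboundary k \<omega>"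
    unfolding incr_def hermite_step_def coboundary_def \<xi>_Suc[OF assms] ..
  then show ?case using Suc by (simp add: mart_def s coboundary_def)
qed (simp add: mart_def)

lemma coboundary_bound: "\<bar>coboundary k \<omega>\<bar> \<le> \<kappa> / b * hermite_abs d (\<xi> k \<omega>)"
  unfolding coboundary_def
proof (rule hermite_sum_bound)
  fix q assume q: "q \<le> d"
  have "\<bar>a ^ q * w q\<bar> \<le> 1 * (\<kappa> / b)"
    unfolding abs_mult using a b w[OF q] by (intro mult_mono) (auto simp: power_le_one field_simps)
  then show "\<bar>a ^ q * w q\<bar> \<le> \<kappa> / b" by simp
qed

lemma coboundary_diff_power2:
  shows "integrable M (\<lambda>\<omega>. (coboundary k \<omega> - coboundary 0 \<omega>)\<^sup>2)"
    "(\<integral>\<omega>. (coboundary k \<omega> - coboundary 0 \<omega>)\<^sup>2 \<partial>M) \<le> 4 * hermite_moment d 2 * (\<kappa> / b)\<^sup>2"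
proof -
  define f where "f \<omega> = 2 * (\<kappa> / b)\<^sup>2 * (hermite_abs d (\<xi> k \<omega>) ^ 2 + hermite_abs d (\<xi> 0 \<omega>) ^ 2)" for \<omega>
  have f: "integrable M f" "(\<integral>\<omega>. f \<omega> \<partial>M) = 4 * hermite_moment d 2 * (\<kappa> / b)\<^sup>2"
    unfolding f_def[abs_def] using hermite_abs_moment[of d _ 2] by auto
  have le: "(coboundary k \<omega> - coboundary 0 \<omega>)\<^sup>2 \<le> f \<omega>" for \<omega>
  proof -
    have sq: "(coboundary j \<omega>)\<^sup>2 \<le> (\<kappa> / b)\<^sup>2 * hermite_abs d (\<xi> j \<omega>) ^ 2" for j
      using power_mono[OF coboundary_bound abs_ge_zero, of j \<omega> 2]
          by (simp only: power2_abs power_mult_distrib)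
    have "(x - y)\<^sup>2 \<le> 2 * (x\<^sup>2 + y\<^sup>2)" for x y :: real
      using zero_le_power2[of "x + y"] by (simp add: power2_eq_square algebra_simps)
    then have "(coboundary k \<omega> - coboundary 0 \<omega>)\<^sup>2 \<le> 2 * ((coboundary k \<omega>)\<^sup>2 + (coboundary 0 \<omega>)\<^sup>2)" .
    also have "\<dots> \<le> f \<omega>" using sq[of k] sq[of 0] unfolding f_def by (simp add: distrib_left)
    finally show ?thesis .
  qed
  show i: "integrable M (\<lambda>\<omega>. (coboundary k \<omega> - coboundary 0 \<omega>)\<^sup>2)"
    by (rule Bochner_Integration.integrable_bound[OF f(1)])
        (use le in \<open>auto intro!: AE_I2 intro: order_trans[OF _ abs_ge_self]\<close>)
  show "(\<integral>\<omega>. (coboundary k \<omega> - coboundary 0 \<omega>)\<^sup>2 \<partial>M) \<le> 4 * hermite_moment d 2 * (\<kappa> / b)\<^sup>2"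
    unfolding f(2)[symmetric] by (rule integral_mono[OF i f(1) le])
qed

text \<open>\<open>r\<close> bounds the second moment of the boundary terms relative to that of the
  martingale; the cross term is then of relative size at most \<open>2 * sqrt r\<close>.\<close>

lemma second_moment_partial_sum:
  assumes n: "n \<ge> 1"
  defines "r \<equiv> 4 * hermite_moment d 2 / (b\<^sup>2 * real n)"
  shows "\<bar>(\<integral>\<omega>. (\<Sum>j=1..n. hermite_sum d (\<lambda>q. (1 - a ^ q) * w q) (\<xi> j \<omega>))\<^sup>2 \<partial>M) - real n * \<kappa>\<^sup>2\<bar> \<le>
    real n * \<kappa>\<^sup>2 * (2 * sqrt r + r)"
proof -
  define R where "R \<omega> = coboundary n \<omega> - coboundary 0 \<omega>" for \<omega>
  define T where "T = real n * \<kappa>\<^sup>2"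
  have T: "T > 0" using n \<kappa> by (simp add: T_def)
  have r: "r > 0" using n b hermite_moment_ge_1[of d 2]
      by (auto simp: r_def intro!: divide_pos_pos mult_pos_pos)
  have Rm[measurable]: "R \<in> borel_measurable M" unfolding R_def[abs_def] by measurable
  have R2: "integrable M (\<lambda>\<omega>. (R \<omega>)\<^sup>2)" "(\<integral>\<omega>. (R \<omega>)\<^sup>2 \<partial>M) \<le> r * T"
  proof -
    show "integrable M (\<lambda>\<omega>. (R \<omega>)\<^sup>2)" unfolding R_def by (rule coboundary_diff_power2)
    have "r * T = 4 * hermite_moment d 2 * (\<kappa> / b)\<^sup>2" using n b by (simp add: r_def T_def power_divide)
    then show "(\<integral>\<omega>. (R \<omega>)\<^sup>2 \<partial>M) \<le> r * T" unfolding R_def using coboundary_diff_power2(2)[of n] by simp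
  qed
  have M2: "integrable M (\<lambda>\<omega>. (mart n \<omega>)\<^sup>2)" "(\<integral>\<omega>. (mart n \<omega>)\<^sup>2 \<partial>M) = T"
    using mart_diff_power2[of 0 n] by (auto simp: mart_def[of 0] T_def)
  \<comment> \<open>Weighted so that both summands contribute at most \<open>sqrt r\<close> times
    the martingale variance.\<close>
  have amgm: "\<bar>2 * x * y\<bar> \<le> sqrt r * x\<^sup>2 + y\<^sup>2 / sqrt r" for x y :: real
  proof -
    define q where "q = sqrt (sqrt r)"
    have q: "q > 0" "q\<^sup>2 = sqrt r" using r by (auto simp: q_def)
    have "0 \<le> (q * \<bar>x\<bar> - \<bar>y\<bar> / q)\<^sup>2" by simp
    also have "\<dots> = q\<^sup>2 * x\<^sup>2 + y\<^sup>2 / q\<^sup>2 - 2 * \<bar>x\<bar> * \<bar>y\<bar>"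
      using q(1) by (simp add: power2_diff power_mult_distrib power_divide)
    finally show ?thesis by (simp add: q(2) abs_mult)
  qed
  have xi: "integrable M (\<lambda>\<omega>. 2 * mart n \<omega> * R \<omega>)"
  proof (rule Bochner_Integration.integrable_bound)
    show "integrable M (\<lambda>\<omega>. sqrt r * (mart n \<omega>)\<^sup>2 + (R \<omega>)\<^sup>2 / sqrt r)" using M2 R2 by simp
    show "AE \<omega> in M. norm (2 * mart n \<omega> * R \<omega>) \<le> norm (sqrt r * (mart n \<omega>)\<^sup>2 + (R \<omega>)\<^sup>2 / sqrt r)"
      unfolding real_norm_def by (intro AE_I2 order_trans[OF amgm abs_ge_self])
  qed measurable
  have cross: "\<bar>\<integral>\<omega>. 2 * mart n \<omega> * R \<omega> \<partial>M\<bar> \<le> 2 * sqrt r * T"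
  proof -
    have "\<bar>\<integral>\<omega>. 2 * mart n \<omega> * R \<omega> \<partial>M\<bar> \<le> (\<integral>\<omega>. sqrt r * (mart n \<omega>)\<^sup>2 + (R \<omega>)\<^sup>2 / sqrt r \<partial>M)"
      by (rule order_trans[OF integral_abs_bound integral_mono]) (use xi M2 R2 amgm in auto)
    also have "\<dots> = sqrt r * T + (\<integral>\<omega>. (R \<omega>)\<^sup>2 \<partial>M) / sqrt r" using M2 R2 by simp
    also have "\<dots> \<le> sqrt r * T + r * T / sqrt r" using R2(2) r
        by (intro add_left_mono divide_right_mono) auto
    also have "r * T / sqrt r = sqrt r * T"
      using r by (simp add: real_div_sqrt times_divide_eq_left[symmetric] del: times_divide_eq_left)
    finally show ?thesis by (simp add: mult.commute)
  qed
  have "(\<integral>\<omega>. (\<Sum>j=1..n. hermite_sum d (\<lambda>q. (1 - a ^ q) * w q) (\<xi> j \<omega>))\<^sup>2 \<partial>M) =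
      (\<integral>\<omega>. (mart n \<omega>)\<^sup>2 - 2 * mart n \<omega> * R \<omega> + (R \<omega>)\<^sup>2 \<partial>M)"
  proof (rule Bochner_Integration.integral_cong[OF refl])
    fix \<omega> assume "\<omega> \<in> space M"
    from martingale_decomposition[OF this, of n]
    show "(\<Sum>j=1..n. hermite_sum d (\<lambda>q. (1 - a ^ q) * w q) (\<xi> j \<omega>))\<^sup>2 = (mart n \<omega>)\<^sup>2 - 2 * mart n \<omega> * R \<omega> +
        (R \<omega>)\<^sup>2"
      unfolding R_def[symmetric] by (simp only:) (simp add: power2_diff)
  qed
  also have "\<dots> = T - (\<integral>\<omega>. 2 * mart n \<omega> * R \<omega> \<partial>M) + (\<integral>\<omega>. (R \<omega>)\<^sup>2 \<partial>M)"
    using M2 R2 xi by simp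
  finally have eq: "(\<integral>\<omega>. (\<Sum>j=1..n. hermite_sum d (\<lambda>q. (1 - a ^ q) * w q) (\<xi> j \<omega>))\<^sup>2 \<partial>M) =
      T - (\<integral>\<omega>. 2 * mart n \<omega> * R \<omega> \<partial>M) + (\<integral>\<omega>. (R \<omega>)\<^sup>2 \<partial>M)" .
  have "0 \<le> (\<integral>\<omega>. (R \<omega>)\<^sup>2 \<partial>M)" by simp
  then have "\<bar>(\<integral>\<omega>. (\<Sum>j=1..n. hermite_sum d (\<lambda>q. (1 - a ^ q) * w q) (\<xi> j \<omega>))\<^sup>2 \<partial>M) - T\<bar> \<le> 2 * sqrt r * T +
      r * T"
    using cross R2(2) unfolding eq by linarith
  then show ?thesis by (simp add: T_def algebra_simps)
qed

text \<open>A union bound over all times costs a factor \<open>Suc n\<close>. The exponent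
  \<open>j\<close> stays free because all moments are finite; in the application
  \<open>\<kappa>\<^sup>2 / b\<^sup>2\<close> is bounded by a negative power of \<open>n\<close>, so
  a large \<open>j\<close> compensates that factor.\<close>

lemma coboundary_maximal_bound:
  assumes \<delta>: "\<delta> > 0"
  shows "prob {\<omega> \<in> space M. \<exists>k\<le>n. \<delta> < \<bar>coboundary k \<omega> - coboundary 0 \<omega>\<bar>} \<le>
    real (Suc n) * hermite_moment d (2 * j) * (4 / \<delta>\<^sup>2 * (\<kappa>\<^sup>2 / b\<^sup>2)) ^ j"
proof -
  \<comment> \<open>The level that the envelope must reach for \<open>coboundary\<close> to exceed
    \<open>\<delta> / 2\<close>.\<close>
  define c where "c = \<delta> * b / (2 * \<kappa>)"
  have c: "c > 0" using \<delta> b \<kappa> by (simp add: c_def)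
  define A where "A k = {\<omega> \<in> space M. c ^ (2 * j) \<le> hermite_abs d (\<xi> k \<omega>) ^ (2 * j)}" for k
  have Am: "A k \<in> sets M" for k unfolding A_def by measurable
  have PA: "prob (A k) \<le> hermite_moment d (2 * j) / c ^ (2 * j)" for k
    unfolding A_def hermite_abs_moment(2)[of d k, symmetric]
    by (rule integral_Markov_inequality_measure[of M _ "{}"]) (use hermite_abs_moment(1) c in auto)
  have "{\<omega> \<in> space M. \<exists>k\<le>n. \<delta> < \<bar>coboundary k \<omega> - coboundary 0 \<omega>\<bar>} \<subseteq> (\<Union>k\<in>{..n}. A k)"
  proof
    fix \<omega> assume "\<omega> \<in> {\<omega> \<in> space M. \<exists>k\<le>n. \<delta> < \<bar>coboundary k \<omega> - coboundary 0 \<omega>\<bar>}"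
    then obtain k where k: "\<omega> \<in> space M" "k \<le> n" "\<delta> < \<bar>coboundary k \<omega> - coboundary 0 \<omega>\<bar>" by auto
    then have "\<delta> / 2 < \<bar>coboundary k \<omega>\<bar> \<or> \<delta> / 2 < \<bar>coboundary 0 \<omega>\<bar>" by linarith
    then obtain l where l: "l \<le> n" "\<delta> / 2 < \<bar>coboundary l \<omega>\<bar>" using k(2) by blast
    have "\<delta> / 2 \<le> \<kappa> / b * hermite_abs d (\<xi> l \<omega>)" using l(2) coboundary_bound[of l \<omega>] by linarith
    then have "c \<le> hermite_abs d (\<xi> l \<omega>)" using b \<kappa> by (simp add: c_def field_simps)
    then have "c ^ (2 * j) \<le> hermite_abs d (\<xi> l \<omega>) ^ (2 * j)" using c by (intro power_mono) auto
    then show "\<omega> \<in> (\<Union>k\<in>{..n}. A k)" using k(1) l(1) by (auto simp: A_def)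
  qed
  then have "prob {\<omega> \<in> space M. \<exists>k\<le>n. \<delta> < \<bar>coboundary k \<omega> - coboundary 0 \<omega>\<bar>} \<le> prob (\<Union>k\<in>{..n}. A k)"
    by (rule finite_measure_mono) (rule sets.finite_UN, auto simp: Am)
  also have "\<dots> \<le> (\<Sum>k\<in>{..n}. prob (A k))" by (rule finite_measure_subadditive_finite) (auto simp: Am)
  also have "\<dots> \<le> (\<Sum>k\<in>{..n}. hermite_moment d (2 * j) / c ^ (2 * j))" by (intro sum_mono PA)
  also have "\<dots> = real (Suc n) * hermite_moment d (2 * j) * (1 / c\<^sup>2) ^ j"
    by (simp add: power_mult power_one_over divide_simps)
  also have "1 / c\<^sup>2 = 4 / \<delta>\<^sup>2 * (\<kappa>\<^sup>2 / b\<^sup>2)" by (simp add: c_def power_divide power_mult_distrib)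
  finally show ?thesis .
qed

lemma expectation_hermite_sum:
  shows "integrable M (\<lambda>\<omega>. hermite_sum d v (\<xi> k \<omega>))" "(\<integral>\<omega>. hermite_sum d v (\<xi> k \<omega>) \<partial>M) = v 0"
proof -
  have "integrable (distr M borel (\<xi> k)) (hermite_sum d v)" unfolding distr_\<xi>
      by (rule integrable_hermite_sum)
  then show "integrable M (\<lambda>\<omega>. hermite_sum d v (\<xi> k \<omega>))" by (subst (asm) integrable_distr_eq) auto
  have "(\<integral>\<omega>. hermite_sum d v (\<xi> k \<omega>) \<partial>M) = (\<integral>x. hermite_sum d v x \<partial>distr M borel (\<xi> k))"
    by (subst integral_distr) auto
  then show "(\<integral>\<omega>. hermite_sum d v (\<xi> k \<omega>) \<partial>M) = v 0" unfolding distr_\<xi> integral_hermite_sum .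
qed

end

section \<open>Autoregressive processes\<close>

context prob_space begin

text \<open>Generated by rectangles in the initial value and the first \<open>k\<close> innovations.
  Rectangles are stable under intersection, so independence can be checked on them. For
  \<open>k = 0\<close> the index set is empty and only the initial value remains.\<close>

definition natural_filtration :: "('a \<Rightarrow> real) \<Rightarrow> (nat \<Rightarrow> 'a \<Rightarrow> real) \<Rightarrow> nat \<Rightarrow> 'a measure" where
  "natural_filtration Y e k = sigma (space M)
     {Y -` A \<inter> (\<lambda>\<omega>. \<lambda>j\<in>{1..k}. e j \<omega>) -` C \<inter> space M | A C. A \<in> sets borel \<and>
         C \<in> sets (\<Pi>\<^sub>M j\<in>{1..k}. borel)}"

lemma natural_filtration:
  assumes Y: "Y \<in> borel_measurable M" and ind: "indep_vars (\<lambda>_. borel) e {1..}"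
    and Y_ind: "indep_set (sets (vimage_algebra (space M) Y borel))
        (sets (vimage_algebra (space M) (\<lambda>\<omega>. \<lambda>j\<in>{1..}. e j \<omega>) (\<Pi>\<^sub>M j\<in>{1..}. borel)))"
  shows natural_filtration_subalgebra: "subalgebra M (natural_filtration Y e k)"
    and natural_filtration_Suc: "subalgebra (natural_filtration Y e (Suc k)) (natural_filtration Y e k)"
    and natural_filtration_Y: "Y \<in> borel_measurable (natural_filtration Y e k)"
    and natural_filtration_e: "\<lbrakk>1 \<le> j; j \<le> k\<rbrakk> \<Longrightarrow> e j \<in> borel_measurable (natural_filtration Y e k)"
    and natural_filtration_indep:
      "indep_set (sets (natural_filtration Y e k)) (sets (vimage_algebra (space M) (e (Suc k)) borel))"
proof -
  define P where "P k \<omega> = (\<lambda>j\<in>{1..k}. e j \<omega>)" for k :: nat and \<omega>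
  define R where "R k = {Y -` A \<inter> P k -` C \<inter> space M | A C. A \<in> sets borel \<and>
      C \<in> sets (\<Pi>\<^sub>M j\<in>{1..k}. borel :: real measure)}" for k
  have comp: "(\<lambda>f. f j) -` A \<inter> space (\<Pi>\<^sub>M j\<in>I. borel :: real measure) \<in> sets (\<Pi>\<^sub>M j\<in>I. borel :: real
      measure)"
    if "j \<in> I" "A \<in> sets borel" for j :: nat and I A
  proof -
    have "(\<lambda>f. f j) \<in> (\<Pi>\<^sub>M j\<in>I. borel :: real measure) \<rightarrow>\<^sub>M borel"
      using measurable_component_singleton[OF that(1), of "\<lambda>_. borel"] .
    then show ?thesis using that(2) by (rule measurable_sets)
  qed
  have em: "e j \<in> borel_measurable M" if "1 \<le> j" for j using ind that unfolding indep_vars_def by auto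
  have Pm: "P k \<in> M \<rightarrow>\<^sub>M (\<Pi>\<^sub>M j\<in>{1..k}. borel)" for k
    unfolding P_def[abs_def] by (intro measurable_restrict em) auto
  have G: "natural_filtration Y e k = sigma (space M) (R k)" for k
    unfolding natural_filtration_def R_def P_def ..
  have RI: "Y -` A \<inter> P k -` C \<inter> space M \<in> R k" if "A \<in> sets borel" "C \<in> sets (\<Pi>\<^sub>M j\<in>{1..k}. borel :: real
      measure)" for A C k
    unfolding R_def using that by blast
  have RP: "R k \<subseteq> Pow (space M)" for k unfolding R_def by auto
  have sG: "sets (natural_filtration Y e k) = sigma_sets (space M) (R k)" for k
    unfolding G using RP by (rule sets_measure_of)
  have spG: "space (natural_filtration Y e k) = space M" for k
    unfolding G using RP by (rule space_measure_of)
  have RM: "R k \<subseteq> sets M" for k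
  proof
    fix x assume "x \<in> R k"
    then obtain A C where x: "x = Y -` A \<inter> P k -` C \<inter> space M" "A \<in> sets borel" "C \<in> sets (\<Pi>\<^sub>M j\<in>{1..k}.
        borel :: real measure)"
      unfolding R_def by blast
    have "(Y -` A \<inter> space M) \<inter> (P k -` C \<inter> space M) \<in> sets M"
      by (intro sets.Int measurable_sets[OF Y x(2)] measurable_sets[OF Pm x(3)])
    moreover have "x = (Y -` A \<inter> space M) \<inter> (P k -` C \<inter> space M)" using x by auto
    ultimately show "x \<in> sets M" by simp
  qed
  show "subalgebra M (natural_filtration Y e k)" for k
    unfolding subalgebra_def spG sG using sets.sigma_sets_subset[OF RM] by simp
  \<comment> \<open>A condition on the first \<open>k\<close> innovations is a condition on the
    first \<open>l\<close>.\<close>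
  have restr: "P k -` C \<inter> space M = P l -` ((\<lambda>f. restrict f {1..k}) -` C \<inter> space (\<Pi>\<^sub>M j\<in>{1..l}. borel ::
      real measure)) \<inter> space M"
    "(\<lambda>f. restrict f {1..k}) -` C \<inter> space (\<Pi>\<^sub>M j\<in>{1..l}. borel :: real measure) \<in> sets (\<Pi>\<^sub>M j\<in>{1..l}.
        borel :: real measure)"
    if "k \<le> l" "C \<in> sets (\<Pi>\<^sub>M j\<in>{1..k}. borel :: real measure)" for k l C
  proof -
    have "restrict (P l \<omega>) {1..k} = P k \<omega>" for \<omega> using that(1) by (auto simp: P_def fun_eq_iff)
    then show "P k -` C \<inter> space M = P l -` ((\<lambda>f. restrict f {1..k}) -` C \<inter> space (\<Pi>\<^sub>M j\<in>{1..l}. borel ::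
        real measure)) \<inter> space M"
      using measurable_space[OF Pm[of l]] by auto
    show "(\<lambda>f. restrict f {1..k}) -` C \<inter> space (\<Pi>\<^sub>M j\<in>{1..l}. borel :: real measure) \<in> sets (\<Pi>\<^sub>M j\<in>{1..l}.
        borel :: real measure)"
      by (rule measurable_sets[OF measurable_restrict_subset that(2)]) (use that(1) in auto)
  qed
  show "subalgebra (natural_filtration Y e (Suc k)) (natural_filtration Y e k)" for k
  proof -
    have "R k \<subseteq> R (Suc k)"
    proof
      fix x assume "x \<in> R k"
      then obtain A C where x: "x = Y -` A \<inter> P k -` C \<inter> space M" "A \<in> sets borel" "C \<in> sets (\<Pi>\<^sub>M j\<in>{1..k}.
          borel :: real measure)"
        unfolding R_def by blast
      define C' where "C' = (\<lambda>f. restrict f {1..k}) -` C \<inter> space (\<Pi>\<^sub>M j\<in>{1..Suc k}. borel :: real measure)"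
      have "P k -` C \<inter> space M = P (Suc k) -` C' \<inter> space M" "C' \<in> sets (\<Pi>\<^sub>M j\<in>{1..Suc k}. borel)"
        unfolding C'_def using restr[of k "Suc k" C] x(3) by auto
      moreover from this(1) have "x = Y -` A \<inter> P (Suc k) -` C' \<inter> space M" using x(1) by blast
      ultimately show "x \<in> R (Suc k)" using RI[OF x(2)] by simp
    qed
    then show ?thesis unfolding subalgebra_def spG sG using sigma_sets_subseteq by simp
  qed
  show "Y \<in> borel_measurable (natural_filtration Y e k)" for k
  proof (rule measurableI)
    fix A :: "real set" assume A: "A \<in> sets borel"
    have "Y -` A \<inter> space M = Y -` A \<inter> P k -` space (\<Pi>\<^sub>M j\<in>{1..k}. borel) \<inter> space M"
      using measurable_space[OF Pm[of k]] by auto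
    then have "Y -` A \<inter> space M \<in> R k" using RI[OF A sets.top] by simp
    then show "Y -` A \<inter> space (natural_filtration Y e k) \<in> sets (natural_filtration Y e k)"
      unfolding spG sG by (rule sigma_sets.Basic)
  qed simp
  show "e j \<in> borel_measurable (natural_filtration Y e k)" if j: "1 \<le> j" "j \<le> k" for j k
  proof (rule measurableI)
    fix A :: "real set" assume A: "A \<in> sets borel"
    define C where "C = (\<lambda>f. f j) -` A \<inter> space (\<Pi>\<^sub>M j\<in>{1..k}. borel :: real measure)"
    have C: "C \<in> sets (\<Pi>\<^sub>M j\<in>{1..k}. borel)"
      unfolding C_def by (rule comp[OF _ A]) (use j in auto)
    have Pj: "P k \<omega> j = e j \<omega>" for \<omega> using j by (simp add: P_def)
    have "\<omega> \<in> e j -` A \<inter> space M \<longleftrightarrow> \<omega> \<in> Y -` UNIV \<inter> P k -` C \<inter> space M" for \<omega>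
      using measurable_space[OF Pm[of k], of \<omega>] by (cases "\<omega> \<in> space M") (simp_all add: C_def Pj)
    then have "e j -` A \<inter> space M = Y -` UNIV \<inter> P k -` C \<inter> space M" by (rule set_eqI)
    then have "e j -` A \<inter> space M \<in> R k" using RI[OF _ C, of UNIV] by simp
    then show "e j -` A \<inter> space (natural_filtration Y e k) \<in> sets (natural_filtration Y e k)"
      unfolding spG sG by (rule sigma_sets.Basic)
  qed simp
  show "indep_set (sets (natural_filtration Y e k)) (sets (vimage_algebra (space M) (e (Suc k)) borel))"
      for k
  proof -
    define E where "E = {e (Suc k) -` B \<inter> space M | B. B \<in> sets borel}"
    have sE: "sets (vimage_algebra (space M) (e (Suc k)) borel) = sigma_sets (space M) E"
      unfolding vimage_algebra_def E_def by (rule sets_measure_of) auto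
    have "indep_set (sigma_sets (space M) (R k)) (sigma_sets (space M) E)"
    proof (rule indep_set_sigma_sets)
      show "Int_stable (R k)"
      proof (rule Int_stableI)
        fix x y assume "x \<in> R k" "y \<in> R k"
        then obtain A C A' C' where x: "x = Y -` A \<inter> P k -` C \<inter> space M" "A \<in> sets borel" "C \<in> sets (\<Pi>\<^sub>M
            j\<in>{1..k}. borel :: real measure)"
          and y: "y = Y -` A' \<inter> P k -` C' \<inter> space M" "A' \<in> sets borel" "C' \<in> sets (\<Pi>\<^sub>M j\<in>{1..k}. borel ::
              real measure)"
          unfolding R_def by blast
        have "x \<inter> y = Y -` (A \<inter> A') \<inter> P k -` (C \<inter> C') \<inter> space M" unfolding x(1) y(1) by auto
        then show "x \<inter> y \<in> R k" using RI[of "A \<inter> A'" "C \<inter> C'" k] x(2,3) y(2,3) by (simp only: sets.Int)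
      qed
      show "Int_stable E"
      proof (rule Int_stableI)
        fix x y assume "x \<in> E" "y \<in> E"
        then obtain A A' where x: "x = e (Suc k) -` A \<inter> space M" "A \<in> sets borel" and y: "y =
            e (Suc k) -` A' \<inter> space M" "A' \<in> sets borel"
          unfolding E_def by blast
        have "x \<inter> y = e (Suc k) -` (A \<inter> A') \<inter> space M" unfolding x(1) y(1) by auto
        then show "x \<inter> y \<in> E" unfolding E_def using x(2) y(2) by blast
      qed
      show "indep_set (R k) E"
      proof (rule indep_setI)
        show "R k \<subseteq> events" by (rule RM)
        show "E \<subseteq> events" unfolding E_def using measurable_sets[OF em[of "Suc k"]] by auto
        fix x y assume "x \<in> R k" "y \<in> E"
        then obtain A C B where x: "x = Y -` A \<inter> P k -` C \<inter> space M" "A \<in> sets borel" "C \<in> sets (\<Pi>\<^sub>M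
            j\<in>{1..k}. borel :: real measure)"
          and y: "y = e (Suc k) -` B \<inter> space M" "B \<in> sets borel"
          unfolding R_def E_def by blast
        define a where "a = Y -` A \<inter> space M"
        define c where "c = P k -` C \<inter> space M"
        define V where "V = vimage_algebra (space M) (\<lambda>\<omega>. \<lambda>j\<in>{1..}. e j \<omega>) (\<Pi>\<^sub>M j\<in>{1..}. borel)"
        have Pinf: "(\<lambda>\<omega>. \<lambda>j\<in>{1..}. e j \<omega>) \<in> M \<rightarrow>\<^sub>M (\<Pi>\<^sub>M j\<in>{1..}. borel)"
          by (intro measurable_restrict em) auto
        have aV: "a \<in> sets (vimage_algebra (space M) Y borel)" unfolding a_def
            by (rule in_vimage_algebra[OF x(2)])
        have cV: "c \<in> sets V"
        proof -
          define C' where "C' = (\<lambda>f. restrict f {1..k}) -` C \<inter> space (\<Pi>\<^sub>M j\<in>{1..}. borel :: real measure)"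
          have "C' \<in> sets (\<Pi>\<^sub>M j\<in>{1..}. borel)" unfolding C'_def
            by (rule measurable_sets[OF measurable_restrict_subset x(3)]) auto
          moreover have "restrict (\<lambda>j\<in>{1..}. e j \<omega>) {1..k} = P k \<omega>" for \<omega> by (auto simp: P_def fun_eq_iff)
          then have "\<omega> \<in> c \<longleftrightarrow> \<omega> \<in> (\<lambda>\<omega>. \<lambda>j\<in>{1..}. e j \<omega>) -` C' \<inter> space M" for \<omega>
            using measurable_space[OF Pinf, of \<omega>] by (cases "\<omega> \<in> space M") (simp_all add: c_def C'_def)
          then have "c = (\<lambda>\<omega>. \<lambda>j\<in>{1..}. e j \<omega>) -` C' \<inter> space M" by (rule set_eqI)
          ultimately show ?thesis unfolding V_def by (simp add: in_vimage_algebra)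
        qed
        have yV: "y \<in> sets V"
        proof -
          define C' where "C' = (\<lambda>f. f (Suc k)) -` B \<inter> space (\<Pi>\<^sub>M j\<in>{1..}. borel :: real measure)"
          have "C' \<in> sets (\<Pi>\<^sub>M j\<in>{1..}. borel)" unfolding C'_def
            by (rule comp[OF _ y(2)]) auto
          moreover have "\<omega> \<in> y \<longleftrightarrow> \<omega> \<in> (\<lambda>\<omega>. \<lambda>j\<in>{1..}. e j \<omega>) -` C' \<inter> space M" for \<omega>
            using measurable_space[OF Pinf, of \<omega>] by (cases "\<omega> \<in> space M") (simp_all add: y(1) C'_def)
          then have "y = (\<lambda>\<omega>. \<lambda>j\<in>{1..}. e j \<omega>) -` C' \<inter> space M" by (rule set_eqI)
          ultimately show ?thesis unfolding V_def by (simp add: in_vimage_algebra)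
        qed
        \<comment> \<open>The innovations are grouped into the index sets \<open>{1..k}\<close> and
          \<open>{Suc k}\<close>, numbered by the two truth values, so that one independence
          statement covers both.\<close>
        have cy: "prob (c \<inter> y) = prob c * prob y"
        proof -
          define L where "L i = (if i then {1..k} else {Suc k})" for i
          have IV: "indep_vars (\<lambda>i. PiM (L i) (\<lambda>_. borel)) (\<lambda>i \<omega>. restrict (\<lambda>j. e j \<omega>) (L i)) UNIV"
            by (rule indep_vars_restrict[OF ind]) (auto simp: L_def disjoint_family_on_def)
          define D where "D i = (if i then C else (\<lambda>f. f (Suc k)) -` B \<inter> space (\<Pi>\<^sub>M j\<in>{Suc k}. borel ::
              real measure))" for i
          have Ds: "D i \<in> sets (PiM (L i) (\<lambda>_. borel))" for i
          proof (cases i)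
            case False
            have "(\<lambda>f. f (Suc k)) -` B \<inter> space (\<Pi>\<^sub>M j\<in>{Suc k}. borel :: real measure) \<in> sets (\<Pi>\<^sub>M j\<in>{Suc
                k}. borel :: real measure)"
              by (rule comp[OF _ y(2)]) auto
            then show ?thesis using False by (simp add: D_def L_def)
          qed (use x(3) in \<open>simp add: D_def L_def\<close>)
          have "prob (\<Inter>i\<in>UNIV. (\<lambda>\<omega>. restrict (\<lambda>j. e j \<omega>) (L i)) -` D i \<inter> space M) =
              (\<Prod>i\<in>UNIV. prob ((\<lambda>\<omega>. restrict (\<lambda>j. e j \<omega>) (L i)) -` D i \<inter> space M))"
            by (rule indep_varsD_finite[OF IV]) (auto intro: Ds)
          moreover have "(\<lambda>\<omega>. restrict (\<lambda>j. e j \<omega>) (L True)) -` D True \<inter> space M = c"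
            by (simp add: L_def D_def c_def P_def[abs_def])
          moreover have "(\<lambda>\<omega>. restrict (\<lambda>j. e j \<omega>) (L False)) -` D False \<inter> space M = y"
            by (auto simp: L_def D_def y(1) space_PiM)
          ultimately show ?thesis by (simp add: UNIV_bool Int_commute mult.commute)
        qed
        \<comment> \<open>Both \<open>c\<close> and \<open>c \<inter> y\<close> are events of the
          whole innovation sequence, hence independent of \<open>a\<close>; with \<open>cy\<close>
          the three factors separate.\<close>
        have "x = a \<inter> c" unfolding x(1) a_def c_def by auto
        moreover have "prob (a \<inter> c) = prob a * prob c" using indep_setD[OF Y_ind aV] cV unfolding V_def
            by blast
        moreover have "prob (a \<inter> (c \<inter> y)) = prob a * prob (c \<inter> y)"
          using indep_setD[OF Y_ind aV] sets.Int[OF cV yV] unfolding V_def by blast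
        ultimately show "prob (x \<inter> y) = prob x * prob y" using cy by (simp add: Int_assoc)
      qed
    qed
    then show ?thesis unfolding sG sE .
  qed
qed

end

text \<open>Division by the stationary standard deviation \<open>\<delta>\<close> produces the
  normalised chain. Stationarity transfers the law of \<open>Y 0\<close> to every
  \<open>Y k\<close>.\<close>

lemma (in prob_space) gaussian_chain_ar1:
  assumes a: "0 \<le> a" "a < 1" and s: "s > 0" and \<delta>: "\<delta> = sqrt (s\<^sup>2 / (1 - a\<^sup>2))"
    and eps_indep: "indep_vars (\<lambda>_. borel) \<epsilon> {1..}"
    and eps_normal: "\<And>j. j \<ge> 1 \<Longrightarrow> distributed M lborel (\<epsilon> j) std_normal_density"
    and Y0_normal: "distributed M lborel (Y 0) (normal_density 0 \<delta>)"
    and Y0_indep: "indep_set (sets (vimage_algebra (space M) (Y 0) borel))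
        (sets (vimage_algebra (space M) (\<lambda>\<omega>. \<lambda>j\<in>{1..}. \<epsilon> j \<omega>) (\<Pi>\<^sub>M j\<in>{1..}. borel)))"
    and recursion: "\<And>j \<omega>. \<omega> \<in> space M \<Longrightarrow> Y (Suc j) \<omega> = a * Y j \<omega> + s * \<epsilon> (Suc j) \<omega>"
    and stationary: "stationary_process M Y"
  shows "gaussian_chain M (natural_filtration (Y 0) \<epsilon>) (\<lambda>k \<omega>. Y k \<omega> / \<delta>) \<epsilon> a (s / \<delta>)" "\<delta> > 0"
proof -
  have a2: "a\<^sup>2 < 1" using a by (simp add: power_less_one_iff abs_square_less_1)
  show \<delta>0: "\<delta> > 0" using s a2 by (simp add: \<delta>)
  have \<delta>2: "\<delta>\<^sup>2 = s\<^sup>2 / (1 - a\<^sup>2)" using a2 by (simp add: \<delta>)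
  have Ym[measurable]: "Y k \<in> borel_measurable M" for k using stationary
      by (simp add: stationary_process_def)
  note G = natural_filtration[OF Ym eps_indep Y0_indep]
  have YG: "Y k \<in> borel_measurable (natural_filtration (Y 0) \<epsilon> k)" for k
  proof (induction k)
    case 0
    show ?case by (rule G(3))
  next
    case (Suc k)
    have "Y k \<in> borel_measurable (natural_filtration (Y 0) \<epsilon> (Suc k))"
        by (rule measurable_from_subalg[OF G(2) Suc])
    moreover have "\<epsilon> (Suc k) \<in> borel_measurable (natural_filtration (Y 0) \<epsilon> (Suc k))" by (rule G(4)) auto
    ultimately have "(\<lambda>\<omega>. a * Y k \<omega> + s * \<epsilon> (Suc k) \<omega>) \<in> borel_measurable (natural_filtration (Y 0) \<epsilon> (Suc
        k))" by measurable
    moreover have "space (natural_filtration (Y 0) \<epsilon> (Suc k)) = space M" using G(1)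
        by (simp add: subalgebra_def)
    ultimately show ?case by (subst measurable_cong[OF recursion]) auto
  qed
  have distr_Y: "distr M borel (Y k) = distr M borel (Y 0)" for k
  proof -
    have m: "(\<lambda>\<omega> j. Y (j + h) \<omega>) \<in> M \<rightarrow>\<^sub>M (\<Pi>\<^sub>M j\<in>UNIV. borel)" for h
      by (rule measurable_PiM_single') auto
    have c: "(\<lambda>f. f 0) \<in> (\<Pi>\<^sub>M j\<in>(UNIV :: nat set). borel :: real measure) \<rightarrow>\<^sub>M borel"
      using measurable_component_singleton[of 0 UNIV "\<lambda>_. borel :: real measure"] by simp
    have d: "distr (distr M (\<Pi>\<^sub>M j\<in>UNIV. borel) (\<lambda>\<omega> j. Y (j + h) \<omega>)) borel (\<lambda>f. f 0) =
        distr M borel (Y h)" for h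
      by (subst distr_distr[OF c m]) (simp add: comp_def)
    have "distr M (\<Pi>\<^sub>M j\<in>UNIV. borel) (\<lambda>\<omega> j. Y (j + k) \<omega>) = distr M (\<Pi>\<^sub>M j\<in>UNIV. borel) (\<lambda>\<omega> j. Y (j + 0) \<omega>)"
      using stationary by (simp add: stationary_process_def)
    then show ?thesis using d[of k] d[of 0] by (simp only:)
  qed
  have normal: "distributed M lborel (\<lambda>\<omega>. Y k \<omega> / \<delta>) std_normal_density" for k
  proof -
    have "distr M lborel (Y k) = distr M borel (Y k)" for k by (rule distr_cong) auto
    then have "distr M lborel (Y k) = distr M lborel (Y 0)" using distr_Y[of k] by simp
    then have "distributed M lborel (Y k) (normal_density 0 \<delta>)" using Y0_normal Ym[of k]
        unfolding distributed_def by simp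
    then show ?thesis using normal_standard_normal_convert[OF \<delta>0, of "Y k" 0] by simp
  qed
  show "gaussian_chain M (natural_filtration (Y 0) \<epsilon>) (\<lambda>k \<omega>. Y k \<omega> / \<delta>) \<epsilon> a (s / \<delta>)"
  proof (intro gaussian_chain.intro gaussian_chain_axioms.intro)
    show "prob_space M" by unfold_locales
    show "a\<^sup>2 + (s / \<delta>)\<^sup>2 = 1" using s a2 by (simp add: power_divide \<delta>2)
    show "0 \<le> a" "a < 1" by fact+
    show "0 < s / \<delta>" using s \<delta>0 by simp
    show "(\<lambda>\<omega>. Y k \<omega> / \<delta>) \<in> borel_measurable (natural_filtration (Y 0) \<epsilon> k)" for k using YG[of k]
        by measurable
    show "\<epsilon> (Suc k) \<in> borel_measurable (natural_filtration (Y 0) \<epsilon> (Suc k))" for k by (rule G(4)) auto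
    show "distributed M lborel (\<epsilon> (Suc k)) std_normal_density" for k by (rule eps_normal) simp
    show "Y (Suc k) \<omega> / \<delta> = a * (Y k \<omega> / \<delta>) + s / \<delta> * \<epsilon> (Suc k) \<omega>" if "\<omega> \<in> space M" for \<omega> k
      unfolding recursion[OF that] by (simp add: add_divide_distrib)
  qed (rule G normal)+
qed

text \<open>Dividing by \<open>1 - a ^ q\<close> inverts the identity minus the transition operator
  order by order; at order 0, where the divisor is 0, \<open>A 0 = 0\<close> makes both sides 0.
  Order \<open>q\<close> alone contributes at least \<open>(b * w q)\<^sup>2\<close> to the
  variance, which gives the bound on the coefficients. A nonzero coefficient at \<open>l\<close>
  makes the variance positive.\<close>

lemma gaussian_chain_martingaleI:
  assumes "gaussian_chain M F \<xi> e a b" and A0: "A 0 = 0" and Am: "l \<le> d" "A l \<noteq> 0" and v: "v > 0"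
  defines "\<kappa>0 \<equiv> sqrt (\<Sum>q\<le>d. (A q / (1 - a ^ q))\<^sup>2 * fact q * (1 - a ^ (2 * q)))"
  shows "gaussian_chain_martingale M F \<xi> e a b d (\<lambda>q. A q / (1 - a ^ q) / v) (\<kappa>0 / v)"
    and "(1 - a ^ q) * (A q / (1 - a ^ q) / v) = A q / v" and "0 < \<kappa>0"
proof -
  interpret gaussian_chain M F \<xi> e a b by fact
  have gap: "1 - a ^ (Suc q) > 0" for q
  proof -
    have "a ^ Suc q \<le> a ^ 1" using a by (intro power_decreasing) auto
    then show ?thesis using a by simp
  qed
  have gap2: "b\<^sup>2 \<le> 1 - a ^ (2 * Suc q)" for q
  proof -
    have "a ^ (2 * Suc q) \<le> a ^ 2" using a by (intro power_decreasing) auto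
    then show ?thesis using ab by simp
  qed
  define w where "w q = A q / (1 - a ^ q)" for q
  define T where "T q = (w q)\<^sup>2 * fact q * (1 - a ^ (2 * q))" for q
  have w0: "w 0 = 0" by (simp add: w_def)
  have T: "(b * \<bar>w q\<bar>)\<^sup>2 \<le> T q" for q
  proof (cases q)
    case (Suc r)
    have "(w q)\<^sup>2 * 1 * b\<^sup>2 \<le> (w q)\<^sup>2 * fact q * (1 - a ^ (2 * q))"
      unfolding Suc using gap2[of r] fact_ge_1[of "Suc r"] by (intro mult_mono) auto
    then show ?thesis by (simp add: T_def power_mult_distrib mult.commute)
  qed (simp add: w0 T_def)
  have T0: "0 \<le> T q" for q using T[of q] zero_le_power2[of "b * \<bar>w q\<bar>"] by linarith
  have \<kappa>0: "\<kappa>0 = sqrt (\<Sum>q\<le>d. T q)" unfolding \<kappa>0_def T_def w_def ..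
  have le: "b * \<bar>w q\<bar> \<le> \<kappa>0" if "q \<le> d" for q
  proof -
    have "T q \<le> (\<Sum>q\<le>d. T q)" using that T0 by (intro member_le_sum) auto
    then show ?thesis unfolding \<kappa>0 using T[of q] by (intro real_le_rsqrt) linarith
  qed
  have l: "l > 0" using Am(2) A0 by (cases l) auto
  have "w l \<noteq> 0" unfolding w_def using Am(2) gap[of "l - 1"] l by simp
  then have "0 < b * \<bar>w l\<bar>" using b by simp
  then show "0 < \<kappa>0" using le[OF Am(1)] by linarith
  show "(1 - a ^ q) * (A q / (1 - a ^ q) / v) = A q / v"
    using A0 gap[of "q - 1"] by (cases "q = 0") auto
  show "gaussian_chain_martingale M F \<xi> e a b d (\<lambda>q. A q / (1 - a ^ q) / v) (\<kappa>0 / v)"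
  proof (intro gaussian_chain_martingale.intro gaussian_chain_martingale_axioms.intro)
    show "gaussian_chain M F \<xi> e a b" by fact
    show "0 < \<kappa>0 / v" using \<open>0 < \<kappa>0\<close> v by simp
    show "b * \<bar>A q / (1 - a ^ q) / v\<bar> \<le> \<kappa>0 / v" if "q \<le> d" for q
      using le[OF that] v by (simp add: w_def[symmetric] abs_divide divide_right_mono)
    have "(\<Sum>q\<le>d. (A q / (1 - a ^ q) / v)\<^sup>2 * fact q * (1 - a ^ (2 * q))) = (\<Sum>q\<le>d. T q / v\<^sup>2)"
      unfolding T_def w_def[symmetric] by (intro sum.cong refl) (simp add: power_divide)
    also have "\<dots> = (\<Sum>q\<le>d. T q) / v\<^sup>2" by (rule sum_divide_distrib[symmetric])
    also have "\<dots> = (\<kappa>0 / v)\<^sup>2" unfolding \<kappa>0 power_divide using T0 by (simp add: sum_nonneg)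
    finally show "(\<Sum>q\<le>d. (A q / (1 - a ^ q) / v)\<^sup>2 * fact q * (1 - a ^ (2 * q))) = (\<kappa>0 / v)\<^sup>2" .
  qed
qed

theorem theorem3p5:
  fixes M :: "'a measure" and X :: "nat \<Rightarrow> nat \<Rightarrow> 'a \<Rightarrow> real" and \<epsilon> :: "nat \<Rightarrow> 'a \<Rightarrow> real"
    and N :: "'b measure" and B :: "real \<Rightarrow> 'b \<Rightarrow> real"
    and \<gamma> \<beta> :: real and \<alpha> \<sigma> \<delta> :: "nat \<Rightarrow> real"
    and m p :: nat and c :: "nat \<Rightarrow> real" and f :: "nat \<Rightarrow> real \<Rightarrow> real"
  assumes "prob_space M"
    and "0 < \<gamma>" "\<gamma> < 1" and "0 < \<beta>" "\<beta> < 1"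
    and "\<And>n. n \<ge> 1 \<Longrightarrow> \<alpha> n = 1 - \<gamma> / real n powr \<beta>"
    and "\<And>n. n \<ge> 1 \<Longrightarrow> \<sigma> n > 0"
    and "\<And>n. n \<ge> 1 \<Longrightarrow> \<delta> n = sqrt ((\<sigma> n)\<^sup>2 / (1 - (\<alpha> n)\<^sup>2))"
    and eps_indep: "prob_space.indep_vars M (\<lambda>_. borel) \<epsilon> {1..}"
    and eps_normal: "\<And>j. j \<ge> 1 \<Longrightarrow> distributed M lborel (\<epsilon> j) std_normal_density"
    and X0_normal: "\<And>n. n \<ge> 1 \<Longrightarrow> distributed M lborel (X 0 n) (normal_density 0 (\<delta> n))"
    and X0_indep: "\<And>n. n \<ge> 1 \<Longrightarrow>
      prob_space.indep_set M
        (sets (vimage_algebra (space M) (X 0 n) borel))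
        (sets (vimage_algebra (space M) (\<lambda>\<omega>. \<lambda>j\<in>{1..}. \<epsilon> j \<omega>) (\<Pi>\<^sub>M j\<in>{1..}. borel)))"
    and recursion: "\<And>n j \<omega>. n \<ge> 1 \<Longrightarrow> j \<ge> 1 \<Longrightarrow> \<omega> \<in> space M \<Longrightarrow>
      X j n \<omega> = \<alpha> n * X (j - 1) n \<omega> + \<sigma> n * \<epsilon> j \<omega>"
    and stationary: "\<And>n. n \<ge> 1 \<Longrightarrow> stationary_process M (\<lambda>j. X j n)"
    and "1 \<le> m" "m \<le> p" and "c m \<noteq> 0" "c p \<noteq> 0"
    and "\<And>n x. n \<ge> 1 \<Longrightarrow> f n x = (\<Sum>q = m..p. c q * \<delta> n ^ q * hermite q (x / \<delta> n))"
    and "standard_brownian_motion N B"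
  shows "converges_in_distribution skorokhod_topology
           M (\<lambda>n. sample_path (normalized_sum M X (f n) n)) N (sample_path B)"
proof -
  note \<gamma> = assms(2,3) and \<beta> = assms(4,5) and \<alpha> = assms(6) and \<sigma> = assms(7) and \<delta> = assms(8) and f =
      assms(19)
  interpret prob_space M by fact
  have \<alpha>01: "0 \<le> \<alpha> n" "\<alpha> n < 1" if "n \<ge> 1" for n
  proof -
    have 1: "real n powr \<beta> \<ge> 1" using that \<beta> by (intro ge_one_powr_ge_zero) auto
    then have "0 < \<gamma> / real n powr \<beta>" using \<gamma> that by (intro divide_pos_pos) auto
    moreover have "\<gamma> / real n powr \<beta> \<le> 1" using 1 \<gamma> by (simp add: divide_le_eq)
    ultimately show "0 \<le> \<alpha> n" "\<alpha> n < 1" using \<alpha>[OF that] by auto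
  qed
  define b where "b n = \<sigma> n / \<delta> n" for n
  define \<xi> where "\<xi> n k \<omega> = X k n \<omega> / \<delta> n" for n k \<omega>
  define F where "F n = natural_filtration (X 0 n) \<epsilon>" for n
  have chain: "gaussian_chain M (F n) (\<xi> n) \<epsilon> (\<alpha> n) (b n)" and \<delta>0: "\<delta> n > 0" if n: "n \<ge> 1" for n
    unfolding F_def \<xi>_def b_def
    using gaussian_chain_ar1[OF \<alpha>01[OF n] \<sigma>[OF n] \<delta>[OF n] eps_indep eps_normal, of "\<lambda>j. X j n"]
      X0_normal[OF n] X0_indep[OF n] recursion[OF n] stationary[OF n] by auto
  \<comment> \<open>The powers of \<open>\<delta> n\<close> are absorbed into the coefficients and
    may grow or vanish with \<open>n\<close>.\<close>
  define A where "A n q = (if m \<le> q \<and> q \<le> p then c q * \<delta> n ^ q else 0)" for n q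
  have A0: "A n 0 = 0" for n using \<open>1 \<le> m\<close> by (simp add: A_def)
  have Am: "A n m \<noteq> 0" if "n \<ge> 1" for n using \<delta>0[OF that] \<open>c m \<noteq> 0\<close> \<open>m \<le> p\<close> by (simp add: A_def)
  have fA: "f n (X k n \<omega>) = hermite_sum p (A n) (\<xi> n k \<omega>)" if n: "n \<ge> 1" for n k \<omega>
  proof -
    have "f n (X k n \<omega>) = (\<Sum>q=m..p. A n q * hermite q (\<xi> n k \<omega>))"
      unfolding f[OF n] \<xi>_def by (intro sum.cong refl) (simp add: A_def)
    also have "\<dots> = hermite_sum p (A n) (\<xi> n k \<omega>)"
      unfolding hermite_sum_def by (rule sum.mono_neutral_left) (auto simp: A_def)
    finally show ?thesis .
  qed
  define V where "V n = variance (partial_sum X (f n) n 1)" for n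
  define \<kappa>0 where "\<kappa>0 n = sqrt (\<Sum>q\<le>p. (A n q / (1 - \<alpha> n ^ q))\<^sup>2 * fact q * (1 - \<alpha> n ^ (2 * q)))" for n
  define w where "w v n q = A n q / (1 - \<alpha> n ^ q) / v" for v n q
  \<comment> \<open>Stated for every normalisation \<open>v\<close>: first \<open>v = 1\<close>, to
    find the variance of the sum, later \<open>v\<close> the square root of that variance.\<close>
  have mart: "gaussian_chain_martingale M (F n) (\<xi> n) \<epsilon> (\<alpha> n) (b n) p (w v n) (\<kappa>0 n / v)"
    and wA: "(1 - \<alpha> n ^ q) * w v n q = A n q / v" and \<kappa>0: "0 < \<kappa>0 n" if n: "n \<ge> 1" and v: "v > 0" for n v q
    unfolding w_def \<kappa>0_def
    using gaussian_chain_martingaleI[where A = "A n" and v = v and d = p and l = m, OF chain[OF n] A0 \<open>m \<le>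
        p\<close> Am[OF n] v] by auto
  have hA: "hermite_sum p (\<lambda>q. (1 - \<alpha> n ^ q) * w v n q) x = hermite_sum p (A n) x / v" if "n \<ge> 1" "v > 0"
      for n v x
    unfolding wA[OF that] hermite_sum_def by (simp add: sum_divide_distrib)
  define S where "S n k \<omega> = (\<Sum>j=1..k. f n (X j n \<omega>))" for n k \<omega>
  have S_eq: "S n k \<omega> = (\<Sum>j=1..k. hermite_sum p (\<lambda>q. (1 - \<alpha> n ^ q) * w 1 n q) (\<xi> n j \<omega>))" if "n \<ge> 1"
      for n k \<omega>
    unfolding S_def fA[OF that] hA[OF that zero_less_one] by simp
  have ES: "(\<integral>\<omega>. S n k \<omega> \<partial>M) = 0" and Sm: "S n k \<in> borel_measurable M" if n: "n \<ge> 1" for n k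
  proof -
    interpret C: gaussian_chain_martingale M "F n" "\<xi> n" \<epsilon> "\<alpha> n" "b n" p "w 1 n" "\<kappa>0 n / 1"
        by (rule mart[OF n zero_less_one])
    show "(\<integral>\<omega>. S n k \<omega> \<partial>M) = 0" unfolding S_eq[OF n]
      by (subst Bochner_Integration.integral_sum) (auto intro: C.expectation_hermite_sum(1) simp:
          C.expectation_hermite_sum(2))
    have [measurable]: "\<xi> n j \<in> borel_measurable M" for j by (rule C.\<xi>_M)
    show "S n k \<in> borel_measurable M" unfolding S_eq[OF n, abs_def] by measurable
  qed
  have V_eq: "V n = (\<integral>\<omega>. (S n n \<omega>)\<^sup>2 \<partial>M)" if "n \<ge> 1" for n
  proof -
    have "partial_sum X (f n) n 1 = S n n" by (simp add: fun_eq_iff partial_sum_def S_def)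
    then show ?thesis unfolding V_def by (simp add: ES[OF that])
  qed
  \<comment> \<open>Variance of the unnormalised martingale after \<open>n\<close> steps; it agrees
    with the variance \<open>V n\<close> of the sum up to a factor tending to 1.\<close>
  define T where "T n = real n * (\<kappa>0 n)\<^sup>2" for n
  define r where "r n = 4 * hermite_moment p 2 / ((b n)\<^sup>2 * real n)" for n
  have T0: "T n > 0" if "n \<ge> 1" for n using \<kappa>0[OF that zero_less_one] that by (simp add: T_def)
  have VT: "\<bar>V n / T n - 1\<bar> \<le> 2 * sqrt (r n) + r n" if n: "n \<ge> 1" for n
  proof -
    interpret C: gaussian_chain_martingale M "F n" "\<xi> n" \<epsilon> "\<alpha> n" "b n" p "w 1 n" "\<kappa>0 n / 1"
        by (rule mart[OF n zero_less_one])
    have "\<bar>V n - T n\<bar> \<le> T n * (2 * sqrt (r n) + r n)"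
      using C.second_moment_partial_sum[OF n] unfolding V_eq[OF n] S_eq[OF n] T_def r_def by simp
    moreover have "V n / T n - 1 = (V n - T n) / T n" using T0[OF n] by (simp add: diff_divide_distrib)
    ultimately show ?thesis using T0[OF n] by (simp add: abs_divide divide_le_eq mult.commute)
  qed
  \<comment> \<open>Relaxation time of the chain relative to \<open>n\<close>; it vanishes because
    \<beta> < 1.\<close>
  define g where "g n = 1 / (real n * (1 - \<alpha> n))" for n
  have g_eq: "g n = real n powr (\<beta> - 1) / \<gamma>" if "n \<ge> 1" for n
    using that \<gamma> by (simp add: g_def \<alpha>[OF that] powr_diff)
  have g_lim: "g \<longlonglongrightarrow> 0"
  proof -
    have "(\<lambda>n. real n powr (\<beta> - 1) / \<gamma>) \<longlonglongrightarrow> 0 / \<gamma>"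
      using \<beta> \<gamma> by (intro tendsto_divide tendsto_const tendsto_neg_powr filterlim_real_sequentially) auto
    moreover have "\<forall>\<^sub>F n in sequentially. real n powr (\<beta> - 1) / \<gamma> = g n"
      using eventually_ge_at_top[of 1] by eventually_elim (simp add: g_eq)
    ultimately show ?thesis by (simp add: tendsto_cong)
  qed
  have b2: "1 - \<alpha> n \<le> (b n)\<^sup>2" if n: "n \<ge> 1" for n
  proof -
    interpret C: gaussian_chain M "F n" "\<xi> n" \<epsilon> "\<alpha> n" "b n" by (rule chain[OF n])
    have "(b n)\<^sup>2 = (1 - \<alpha> n) * (1 + \<alpha> n)" using C.ab by (simp add: power2_eq_square algebra_simps)
    moreover have "(1 - \<alpha> n) * 1 \<le> (1 - \<alpha> n) * (1 + \<alpha> n)" using \<alpha>01[OF n] by (intro mult_left_mono) auto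
    ultimately show ?thesis by simp
  qed
  have r_lim: "r \<longlonglongrightarrow> 0"
  proof (rule Lim_null_comparison)
    show "\<forall>\<^sub>F n in sequentially. norm (r n) \<le> 4 * hermite_moment p 2 * g n"
      using eventually_ge_at_top[of 1]
    proof eventually_elim
      case (elim n)
      have h: "0 \<le> hermite_moment p 2" using hermite_moment_ge_1[of p 2] by linarith
      have pos: "0 < real n * (1 - \<alpha> n)" using \<alpha>01[OF elim] elim by simp
      have "real n * (1 - \<alpha> n) \<le> (b n)\<^sup>2 * real n" using b2[OF elim] elim by (simp add: mult.commute)
      then have "1 / ((b n)\<^sup>2 * real n) \<le> g n" unfolding g_def using pos
          by (intro divide_left_mono) (auto intro!: mult_pos_pos)
      then have "4 * hermite_moment p 2 * (1 / ((b n)\<^sup>2 * real n)) \<le> 4 * hermite_moment p 2 * g n"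
        using h by (intro mult_left_mono) auto
      moreover have "0 \<le> r n" unfolding r_def using h by simp
      ultimately show ?case by (simp add: r_def)
    qed
    show "(\<lambda>n. 4 * hermite_moment p 2 * g n) \<longlonglongrightarrow> 0" using tendsto_mult_right_zero[OF g_lim] .
  qed
  have VT_lim: "(\<lambda>n. V n / T n) \<longlonglongrightarrow> 1"
  proof -
    have "(\<lambda>n. V n / T n - 1) \<longlonglongrightarrow> 0"
    proof (rule Lim_null_comparison)
      show "\<forall>\<^sub>F n in sequentially. norm (V n / T n - 1) \<le> 2 * sqrt (r n) + r n"
        using eventually_ge_at_top[of 1] by eventually_elim (use VT in simp)
      have "(\<lambda>n. 2 * sqrt (r n) + r n) \<longlonglongrightarrow> 2 * sqrt 0 + 0" by (intro tendsto_intros r_lim)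
      then show "(\<lambda>n. 2 * sqrt (r n) + r n) \<longlonglongrightarrow> 0" by simp
    qed
    then show ?thesis by (rule LIM_zero_cancel)
  qed
  have "\<forall>\<^sub>F n in sequentially. V n / T n > 0" by (rule order_tendstoD(1)[OF VT_lim]) simp
  then have "\<forall>\<^sub>F n in sequentially. n \<ge> 1 \<and> V n > 0"
    using eventually_ge_at_top[of 1]
  proof eventually_elim
    case (elim n)
    then show ?case using T0[of n] by (simp add: zero_less_divide_iff)
  qed
  \<comment> \<open>The variance is positive from some row on, since \<open>V n / T n\<close> tends
    to 1 and \<open>T n > 0\<close>; this fixes the first row of the array.\<close>
  then obtain n0 where n0: "\<And>n. n \<ge> n0 \<Longrightarrow> n \<ge> 1" "\<And>n. n \<ge> n0 \<Longrightarrow> V n > 0"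
    unfolding eventually_sequentially by blast
  define \<kappa> where "\<kappa> n = \<kappa>0 n / sqrt (V n)" for n
  have \<kappa>_lim: "(\<lambda>n. real n * (\<kappa> n)\<^sup>2) \<longlonglongrightarrow> 1"
  proof -
    have "(\<lambda>n. 1 / (V n / T n)) \<longlonglongrightarrow> 1 / 1" by (intro tendsto_divide tendsto_const VT_lim) simp
    moreover have "\<forall>\<^sub>F n in sequentially. 1 / (V n / T n) = real n * (\<kappa> n)\<^sup>2"
      using eventually_ge_at_top[of n0]
      by eventually_elim (use n0 in \<open>simp add: \<kappa>_def T_def power_divide less_imp_le\<close>)
    ultimately show ?thesis by (simp add: tendsto_cong)
  qed
  have mix: "(\<lambda>n. (\<kappa> n)\<^sup>2 / (1 - \<alpha> n)) \<longlonglongrightarrow> 0"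
  proof -
    have "(\<lambda>n. (real n * (\<kappa> n)\<^sup>2) * g n) \<longlonglongrightarrow> 1 * 0" by (intro tendsto_mult \<kappa>_lim g_lim)
    moreover have "\<forall>\<^sub>F n in sequentially. (real n * (\<kappa> n)\<^sup>2) * g n = (\<kappa> n)\<^sup>2 / (1 - \<alpha> n)"
      using eventually_ge_at_top[of 1] by eventually_elim (simp add: g_def)
    ultimately show ?thesis by (simp add: tendsto_cong)
  qed
  interpret Arr: gaussian_chain_array M F \<xi> \<epsilon> \<alpha> b \<kappa> p "\<lambda>n. w (sqrt (V n)) n" n0
  proof (intro gaussian_chain_array.intro gaussian_chain_array_axioms.intro \<kappa>_lim mix)
    show "gaussian_chain_martingale M (F n) (\<xi> n) \<epsilon> (\<alpha> n) (b n) p (w (sqrt (V n)) n) (\<kappa> n)" if "n0 \<le> n"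
        for n
      unfolding \<kappa>_def using mart n0[OF that] by simp
  qed unfold_locales
  \<comment> \<open>Row 0 is set to 0: the hypotheses concern \<open>n >= 1\<close>, and the
    normalised sum of row 0 is an empty sum.\<close>
  define s where "s n k \<omega> = (if n = 0 then 0 else (S n k \<omega> - (\<integral>\<omega>. S n k \<omega> \<partial>M)) / sqrt (V n))" for n k \<omega>
  have sm: "s n k \<in> borel_measurable M" for n k
  proof (cases "n = 0")
    case False
    then have [measurable]: "S n k \<in> borel_measurable M" by (intro Sm) simp
    show ?thesis unfolding s_def[abs_def] using False by simp
  qed (simp add: s_def[abs_def])
  have path: "sample_path (normalized_sum M X (f n) n) = (\<lambda>\<omega>. step_path n (\<lambda>k. s n k \<omega>))" for n
  proof (intro ext)
    fix \<omega> t
    have "partial_sum X (f n) n t = S n (nat \<lfloor>real n * t\<rfloor>)" for t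
      by (simp add: fun_eq_iff partial_sum_def S_def)
    moreover have "S n 0 = (\<lambda>_. 0)" by (simp add: S_def[abs_def])
    ultimately have "normalized_sum M X (f n) n t \<omega> = s n (nat \<lfloor>real n * t\<rfloor>) \<omega>" for t \<omega>
      unfolding normalized_sum_def V_def[symmetric] by (cases "n = 0") (simp_all add: s_def)
    then show "sample_path (normalized_sum M X (f n) n) \<omega> t = step_path n (\<lambda>k. s n k \<omega>) t"
      by (simp add: sample_path_def step_path_def)
  qed

  have rem_bound: "prob {\<omega> \<in> space M. \<exists>k\<le>n. e < \<bar>s n k \<omega> - Arr.amart n k \<omega>\<bar>} \<le>
      real (Suc n) * hermite_moment p (2 * j) * (4 / e\<^sup>2 * ((\<kappa> n)\<^sup>2 / (b n)\<^sup>2)) ^ j" if n: "n \<ge> n0"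
          and e: "e > 0" for n e j
  proof -
    interpret C: gaussian_chain_martingale M "F n" "\<xi> n" \<epsilon> "\<alpha> n" "b n" p "w (sqrt (V n)) n" "\<kappa> n"
        by (rule Arr.chain[OF n])
    have "s n k \<omega> - Arr.amart n k \<omega> = - (C.coboundary k \<omega> - C.coboundary 0 \<omega>)" if "\<omega> \<in> space M" for k \<omega>
    proof -
      have "s n k \<omega> = (\<Sum>j=1..k. hermite_sum p (\<lambda>q. (1 - \<alpha> n ^ q) * w (sqrt (V n)) n q) (\<xi> n j \<omega>))"
        unfolding s_def ES[OF n0(1)[OF n]] S_def fA[OF n0(1)[OF n]]
        using n0[OF n] by (simp add: hA sum_divide_distrib)
      also have "\<dots> = C.mart k \<omega> - (C.coboundary k \<omega> - C.coboundary 0 \<omega>)"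
        by (rule C.martingale_decomposition[OF that])
      finally show ?thesis using n by (simp add: Arr.amart_def)
    qed
    then have "{\<omega> \<in> space M. \<exists>k\<le>n. e < \<bar>s n k \<omega> - Arr.amart n k \<omega>\<bar>} =
        {\<omega> \<in> space M. \<exists>k\<le>n. e < \<bar>C.coboundary k \<omega> - C.coboundary 0 \<omega>\<bar>}"
      by (intro Collect_cong) (auto simp: abs_minus_commute)
    then show ?thesis using C.coboundary_maximal_bound[OF e, of n j] by simp
  qed
  have rem_lim: "(\<lambda>n. prob {\<omega> \<in> space M. \<exists>k\<le>n. e < \<bar>s n k \<omega> - Arr.amart n k \<omega>\<bar>}) \<longlonglongrightarrow> 0" if e: "e > 0" for e
  proof -
    \<comment> \<open>The moment order: with \<open>j * (1 - \<beta>) > 1\<close> the decay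
      \<open>n powr (- (j * (1 - \<beta>)))\<close> beats the factor \<open>Suc n\<close> of the
      union bound.\<close>
    obtain j :: nat where j: "real j * (1 - \<beta>) > 1" using reals_Archimedean3[of "1 - \<beta>"] \<beta> by auto
    define C where "C = hermite_moment p (2 * j) * (4 / e\<^sup>2 / \<gamma>) ^ j"
    define h where "h n = real (Suc n) * real n powr (- (real j * (1 - \<beta>)))" for n
    have h_lim: "h \<longlonglongrightarrow> 0"
    proof -
      have "(\<lambda>n. (1 + 1 / real n) * real n powr (1 - real j * (1 - \<beta>))) \<longlonglongrightarrow> (1 + 0) * 0"
        using j by (intro tendsto_intros lim_1_over_n tendsto_neg_powr filterlim_real_sequentially) auto
      moreover have "\<forall>\<^sub>F n in sequentially. (1 + 1 / real n) * real n powr (1 - real j * (1 - \<beta>)) = h n"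
        using eventually_ge_at_top[of 1]
      proof eventually_elim
        case (elim n)
        have "real n powr (1 - real j * (1 - \<beta>)) = real n * real n powr (- (real j * (1 - \<beta>)))"
          using elim powr_add[of "real n" 1 "- (real j * (1 - \<beta>))"] by simp
        then show ?case using elim by (simp add: h_def field_simps)
      qed
      ultimately show ?thesis by (simp add: tendsto_cong)
    qed
    show ?thesis
    proof (rule Lim_null_comparison)
      have "(\<lambda>n. C * h n * (real n * (\<kappa> n)\<^sup>2) ^ j) \<longlonglongrightarrow> C * 0 * 1 ^ j"
        by (intro tendsto_intros h_lim \<kappa>_lim)
      then show "(\<lambda>n. C * h n * (real n * (\<kappa> n)\<^sup>2) ^ j) \<longlonglongrightarrow> 0" by simp
      show "\<forall>\<^sub>F n in sequentially. norm (prob {\<omega> \<in> space M. \<exists>k\<le>n. e < \<bar>s n k \<omega> - Arr.amart n k \<omega>\<bar>}) \<le>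
          C * h n * (real n * (\<kappa> n)\<^sup>2) ^ j"
        using eventually_ge_at_top[of n0]
      proof eventually_elim
        case (elim n)
        have n: "n \<ge> 1" by (rule n0(1)[OF elim])
        have pos: "0 < 1 - \<alpha> n" using \<alpha>01[OF n] by simp
        have "(\<kappa> n)\<^sup>2 / (b n)\<^sup>2 \<le> (\<kappa> n)\<^sup>2 / (1 - \<alpha> n)"
          using b2[OF n] pos by (intro divide_left_mono mult_pos_pos) auto
        also have "\<dots> = (real n * (\<kappa> n)\<^sup>2) * (real n powr (\<beta> - 1) / \<gamma>)"
          unfolding g_eq[OF n, symmetric] g_def using n by simp
        finally have k: "4 / e\<^sup>2 * ((\<kappa> n)\<^sup>2 / (b n)\<^sup>2) \<le>
            4 / e\<^sup>2 * ((real n * (\<kappa> n)\<^sup>2) * (real n powr (\<beta> - 1) / \<gamma>))"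
          by (intro mult_left_mono) auto
        have hm: "0 \<le> hermite_moment p (2 * j)" using hermite_moment_ge_1[of p "2 * j"] by linarith
        have "prob {\<omega> \<in> space M. \<exists>k\<le>n. e < \<bar>s n k \<omega> - Arr.amart n k \<omega>\<bar>} \<le>
            real (Suc n) * hermite_moment p (2 * j) * (4 / e\<^sup>2 * ((\<kappa> n)\<^sup>2 / (b n)\<^sup>2)) ^ j"
          by (rule rem_bound[OF elim e])
        also have "\<dots> \<le> real (Suc n) * hermite_moment p (2 * j) * (4 / e\<^sup>2 * ((real n * (\<kappa> n)\<^sup>2) * (real n
            powr (\<beta> - 1) / \<gamma>))) ^ j"
          using hm by (intro mult_left_mono power_mono k) auto
        also have "\<dots> = C * (real (Suc n) * (real n powr (\<beta> - 1)) ^ j) * (real n * (\<kappa> n)\<^sup>2) ^ j"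
          unfolding C_def by (simp add: power_mult_distrib power_divide)
        also have "(real n powr (\<beta> - 1)) ^ j = real n powr (- (real j * (1 - \<beta>)))"
        proof -
          have "(real n powr (\<beta> - 1)) ^ j = (real n powr (\<beta> - 1)) powr real j" using n
              by (simp add: powr_realpow)
          also have "\<dots> = real n powr ((\<beta> - 1) * real j)" by (rule powr_powr)
          also have "(\<beta> - 1) * real j = - (real j * (1 - \<beta>))" by (simp add: algebra_simps)
          finally show ?thesis .
        qed
        finally show ?case by (simp add: h_def)
      qed
    qed
  qed
  show ?thesis unfolding path
  proof (rule functional_clt_criterion[OF \<open>prob_space M\<close> \<open>standard_brownian_motion N B\<close> sm Arr.amart_M
      Arr.amart_0 _ Arr.oscillation_limit rem_lim])
    fix K :: nat and \<phi> :: "nat \<Rightarrow> real \<Rightarrow> real"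
    assume K: "1 \<le> K" and \<phi>: "\<And>i. continuous_on UNIV (\<phi> i)" "\<And>i z. \<bar>\<phi> i z\<bar> \<le> 1"
    show "(\<lambda>n. \<integral>\<omega>. (\<Prod>i<K. \<phi> i (Arr.amart n (n * Suc i div K) \<omega> - Arr.amart n (n * i div K) \<omega>)) \<partial>M) \<longlonglongrightarrow>
       (\<integral>\<omega>. (\<Prod>i<K. \<phi> i (B (real (Suc i) / real K) \<omega> - B (real i / real K) \<omega>)) \<partial>N)"
      unfolding brownian_increments_expectation[OF \<open>standard_brownian_motion N B\<close> K \<phi>]
      by (rule Arr.increments_limit[OF K \<phi> order_refl])
  qed
qed

end
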